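(* Let $n\ge2$, $1<p<\infty$, $F$ as in the context, $\Omega\subset\mathbb R^n$ a bounded open set with $C^{1,\alpha}$ boundary ($\alpha\in\,]0,1[$), and let $\beta\in C(\overline\Omega)$, $\beta\ge0$, with $\int_{\partial\Omega}\beta F(\nu)\,d\mathcal H^{n-1}>0$. Then $$\ell_1(\beta,\Omega)\ge h_\beta(\Omega)-(p-1)\,\|\beta^{p'}\|_{L^\infty(\overline\Omega)},\qquad p'=\tfrac{p}{p-1},$$ where in $\ell_1(\beta,\Omega)$ the boundary weight is the restriction of $\beta$ to $\partial\Omega$.
   Context: $F:\mathbb R^n\to[0,\infty)$ is convex, even, $F(t\xi)=|t|F(\xi)$, $a|\xi|\le F(\xi)\le b|\xi|$ ($0<a\le b$), $F\in C^2(\mathbb R^n\setminus\{0\})$, Hessian of $F^p$ positive definite off the origin. $\nu$ is the Euclidean unit outer normal. $\ell_1(\beta,\Omega)=\inf_{v\in W^{1,p}(\Omega),v\not\equiv0}\frac{\int_\Omega F^p(\nabla v)dx+\int_{\partial\Omega}\beta|v|^pF(\nu)d\mathcal H^{n-1}}{\int_\Omega|v|^pdx}$ is the first Robin eigenvalue of $\mathcal Q_pu=\operatorname{div}(F^{p-1}(\nabla u)F_\xi(\nabla u))$. For a continuous weight $g\ge0$ on $\overline\Omega$, $h_g(\Omega)=\inf_{U\subset\Omega}\frac{\int_{\partial U}gF(\nu)\,d\mathcal H^{n-1}}{|U|}$, the infimum over subsets $U\subset\Omega$ of positive measure and finite perimeter, $\nu$ the outer unit normal to $\partial U$. *)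

theory Defs
  imports "HOL-Analysis.Analysis"
begin

definition hausdorff_delta :: "real \<Rightarrow> real \<Rightarrow> 'a::euclidean_space set \<Rightarrow> ennreal" where
  "hausdorff_delta s \<delta> A =
     (INF C \<in> {C :: nat \<Rightarrow> 'a set. A \<subseteq> (\<Union>i. C i) \<and> (\<forall>i. bounded (C i) \<and> diameter (C i) \<le> \<delta>)}.
        (\<Sum>i. ennreal (unit_ball_vol s * (diameter (C i) / 2) powr s)))"

definition hausdorff_outer :: "real \<Rightarrow> 'a::euclidean_space set \<Rightarrow> ennreal" where
  "hausdorff_outer s A = (SUP \<delta> \<in> {0<..}. hausdorff_delta s \<delta> A)"

definition hausdorff_measure :: "real \<Rightarrow> 'a::euclidean_space measure" where
  "hausdorff_measure s = measure_of UNIV (sets borel) (hausdorff_outer s)"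

definition C2_on :: "'a::euclidean_space set \<Rightarrow> ('a \<Rightarrow> real) \<Rightarrow> bool" where
  "C2_on S f \<longleftrightarrow> (\<exists>Df D2f. (\<forall>x\<in>S. (f has_derivative (\<lambda>h. Df x \<bullet> h)) (at x) \<and>
        (Df has_derivative D2f x) (at x)) \<and>
        (\<forall>h. continuous_on S (\<lambda>x. D2f x h)))"

definition hessian_posdef_on :: "'a::euclidean_space set \<Rightarrow> ('a \<Rightarrow> real) \<Rightarrow> bool" where
  "hessian_posdef_on S f \<longleftrightarrow> (\<exists>Df D2f. \<forall>x\<in>S. (f has_derivative (\<lambda>h. Df x \<bullet> h)) (at x) \<and>
        (Df has_derivative D2f x) (at x) \<and> (\<forall>h. h \<noteq> 0 \<longrightarrow> h \<bullet> D2f x h > 0))"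

definition C1c_with_grad :: "'a::euclidean_space set \<Rightarrow> ('a \<Rightarrow> real) \<Rightarrow> ('a \<Rightarrow> 'a) \<Rightarrow> bool" where
  "C1c_with_grad S \<phi> G \<longleftrightarrow> (\<forall>x. (\<phi> has_derivative (\<lambda>h. G x \<bullet> h)) (at x)) \<and>
     continuous_on UNIV G \<and> compact (closure {x. \<phi> x \<noteq> 0}) \<and> closure {x. \<phi> x \<noteq> 0} \<subseteq> S"

definition C1c_field :: "('a::euclidean_space \<Rightarrow> 'a) \<Rightarrow> ('a \<Rightarrow> 'a \<Rightarrow> 'a) \<Rightarrow> bool" where
  "C1c_field \<phi> D \<longleftrightarrow> (\<forall>x. (\<phi> has_derivative D x) (at x)) \<and>
     (\<forall>h. continuous_on UNIV (\<lambda>x. D x h)) \<and> compact (closure {x. \<phi> x \<noteq> 0})"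

definition divergence :: "('a::euclidean_space \<Rightarrow> 'a \<Rightarrow> 'a) \<Rightarrow> 'a \<Rightarrow> real" where
  "divergence D x = (\<Sum>b\<in>Basis. D x b \<bullet> b)"

text \<open>Bounded open set with C^{1,alpha} boundary: locally the subgraph of a C^{1,alpha} function
  in suitable orthogonal coordinates (vertical direction e, graph over the hyperplane orthogonal to e)\<close>
definition C1alpha_boundary :: "real \<Rightarrow> 'a::euclidean_space set \<Rightarrow> bool" where
  "C1alpha_boundary \<alpha> \<Omega> \<longleftrightarrow> (\<forall>x0 \<in> frontier \<Omega>. \<exists>r>0. \<exists>e \<gamma> G L.
      norm e = 1 \<and> (\<forall>y. \<gamma> y = \<gamma> (y - (y \<bullet> e) *\<^sub>R e)) \<and>
      (\<forall>y. (\<gamma> has_derivative (\<lambda>h. G y \<bullet> h)) (at y)) \<and> continuous_on UNIV G \<and>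
      (\<forall>y\<in>ball x0 r. \<forall>z\<in>ball x0 r. norm (G y - G z) \<le> L * norm (y - z) powr \<alpha>) \<and>
      \<Omega> \<inter> ball x0 r = {x \<in> ball x0 r. x \<bullet> e < \<gamma> x})"

definition outer_normal_at :: "'a::euclidean_space set \<Rightarrow> 'a \<Rightarrow> 'a \<Rightarrow> bool" where
  "outer_normal_at E x \<nu> \<longleftrightarrow> norm \<nu> = 1 \<and>
     ((\<lambda>r. measure lebesgue (ball x r \<inter> E \<inter> {y. (y - x) \<bullet> \<nu> > 0}) / r ^ DIM('a)) \<longlongrightarrow> 0) (at_right 0) \<and>
     ((\<lambda>r. measure lebesgue ((ball x r \<inter> {y. (y - x) \<bullet> \<nu> < 0}) - E) / r ^ DIM('a)) \<longlongrightarrow> 0) (at_right 0)"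

definition reduced_boundary :: "'a::euclidean_space set \<Rightarrow> 'a set" where
  "reduced_boundary E = {x. \<exists>\<nu>. outer_normal_at E x \<nu>}"

definition outer_normal :: "'a::euclidean_space set \<Rightarrow> 'a \<Rightarrow> 'a" where
  "outer_normal E x = (THE \<nu>. outer_normal_at E x \<nu>)"

definition finite_perimeter :: "'a::euclidean_space set \<Rightarrow> bool" where
  "finite_perimeter E \<longleftrightarrow> E \<in> sets lebesgue \<and> (\<exists>M. \<forall>\<phi> D. C1c_field \<phi> D \<and> (\<forall>x. norm (\<phi> x) \<le> 1) \<longrightarrow>
       (LINT x|lebesgue_on E. divergence D x) \<le> M)"

definition weak_gradient :: "'a::euclidean_space set \<Rightarrow> ('a \<Rightarrow> real) \<Rightarrow> ('a \<Rightarrow> 'a) \<Rightarrow> bool" where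
  "weak_gradient \<Omega> v g \<longleftrightarrow> (\<forall>\<phi> G. C1c_with_grad \<Omega> \<phi> G \<longrightarrow> (\<forall>b\<in>Basis.
      (LINT x|lebesgue_on \<Omega>. v x * (G x \<bullet> b)) = - (LINT x|lebesgue_on \<Omega>. \<phi> x * (g x \<bullet> b))))"

definition sobolev :: "real \<Rightarrow> 'a::euclidean_space set \<Rightarrow> ('a \<Rightarrow> real) \<Rightarrow> ('a \<Rightarrow> 'a) \<Rightarrow> bool" where
  "sobolev p \<Omega> v g \<longleftrightarrow> v \<in> borel_measurable (lebesgue_on \<Omega>) \<and> g \<in> borel_measurable (lebesgue_on \<Omega>) \<and>
     integrable (lebesgue_on \<Omega>) (\<lambda>x. \<bar>v x\<bar> powr p) \<and>
     integrable (lebesgue_on \<Omega>) (\<lambda>x. norm (g x) powr p) \<and> weak_gradient \<Omega> v g"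

definition sobolev_trace :: "real \<Rightarrow> 'a::euclidean_space set \<Rightarrow> ('a \<Rightarrow> real) \<Rightarrow> ('a \<Rightarrow> 'a) \<Rightarrow> ('a \<Rightarrow> real) \<Rightarrow> bool" where
  "sobolev_trace p \<Omega> v g t \<longleftrightarrow> t \<in> borel_measurable borel \<and>
     (\<exists>\<phi> G. (\<forall>k. C1c_with_grad UNIV (\<phi> k) (G k)) \<and>
       (\<lambda>k. \<integral>\<^sup>+ x. ennreal (\<bar>\<phi> k x - v x\<bar> powr p) \<partial>lebesgue_on \<Omega>) \<longlonglongrightarrow> 0 \<and>
       (\<lambda>k. \<integral>\<^sup>+ x. ennreal (norm (G k x - g x) powr p) \<partial>lebesgue_on \<Omega>) \<longlonglongrightarrow> 0 \<and>
       (\<lambda>k. \<integral>\<^sup>+ x. indicator (frontier \<Omega>) x * ennreal (\<bar>\<phi> k x - t x\<bar> powr p)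
              \<partial>hausdorff_measure (real DIM('a) - 1)) \<longlonglongrightarrow> 0)"

definition robin_quotient ::
  "('a::euclidean_space \<Rightarrow> real) \<Rightarrow> real \<Rightarrow> ('a \<Rightarrow> real) \<Rightarrow> 'a set \<Rightarrow> ('a \<Rightarrow> real) \<Rightarrow> ('a \<Rightarrow> 'a) \<Rightarrow> ('a \<Rightarrow> real) \<Rightarrow> ennreal" where
  "robin_quotient F p \<beta> \<Omega> v g t =
     ((\<integral>\<^sup>+ x. ennreal (F (g x) powr p) \<partial>lebesgue_on \<Omega>) +
      (\<integral>\<^sup>+ x. indicator (frontier \<Omega>) x * ennreal (\<beta> x * \<bar>t x\<bar> powr p * F (outer_normal \<Omega> x))
          \<partial>hausdorff_measure (real DIM('a) - 1)))
     / (\<integral>\<^sup>+ x. ennreal (\<bar>v x\<bar> powr p) \<partial>lebesgue_on \<Omega>)"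

definition robin_ev1 :: "('a::euclidean_space \<Rightarrow> real) \<Rightarrow> real \<Rightarrow> ('a \<Rightarrow> real) \<Rightarrow> 'a set \<Rightarrow> ennreal" where
  "robin_ev1 F p \<beta> \<Omega> =
     (INF (v, g, t) \<in> {(v, g, t). sobolev p \<Omega> v g \<and> sobolev_trace p \<Omega> v g t \<and>
                         (\<integral>\<^sup>+ x. ennreal (\<bar>v x\<bar> powr p) \<partial>lebesgue_on \<Omega>) \<noteq> 0}.
        robin_quotient F p \<beta> \<Omega> v g t)"

definition weighted_cheeger :: "('a::euclidean_space \<Rightarrow> real) \<Rightarrow> ('a \<Rightarrow> real) \<Rightarrow> 'a set \<Rightarrow> ennreal" where
  "weighted_cheeger F w \<Omega> =
     (INF U \<in> {U. U \<subseteq> \<Omega> \<and> U \<in> sets lebesgue \<and> emeasure lebesgue U > 0 \<and> finite_perimeter U}.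
        (\<integral>\<^sup>+ x. indicator (reduced_boundary U) x * ennreal (w x * F (outer_normal U x))
            \<partial>hausdorff_measure (real DIM('a) - 1)) / emeasure lebesgue U)"

end

theory Submission
  imports Defs
begin

text \<open>
  For a nonnegative \<open>C\<^sup>1\<close> function \<open>w\<close>, test \<open>h\<^sub>\<beta>(\<Omega>)\<close> with the sets \<open>U\<^sub>t = {x \<in> \<Omega>. w x > t}\<close> and
  integrate over \<open>t > 0\<close>. The reduced boundary of \<open>U\<^sub>t\<close> consists of a part of the level set
  \<open>{w = t}\<close> inside \<open>\<Omega>\<close>, where the normal is \<open>-\<nabla>w/|\<nabla>w|\<close>, and a part of \<open>\<partial>\<Omega> \<inter> {w \<ge> t}\<close>, where the normal is
  that of \<open>\<Omega>\<close>. The coarea inequality and the layer cake formula give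
  \<open>h\<^sub>\<beta>(\<Omega>) \<integral>w \<le> \<integral>\<beta> F(\<nabla>w) + \<integral>\<beta> w F(\<nu>)\<close>, the last integral being over \<open>\<partial>\<Omega>\<close>. With \<open>w = |\<phi>|\<^sup>p\<close> and Young's inequality
  this is the claim for \<open>\<phi> \<in> C\<^sup>1\<close>, and it passes to Sobolev functions and their traces by approximation.

  Only the upper bound in the coarea formula is needed. On a small ball where \<open>w\<close> is nearly affine, a level
  set lies close to a hyperplane slice, so its diameter is almost that of a slice of the ball, and the
  volumes of the slices integrate to the volume of the ball; a Vitali covering does the rest.
  That almost every \<open>U\<^sub>t\<close> has finite perimeter follows by comparing \<open>U\<^sub>t\<close> with its small translates.
\<close>

section \<open>The coarea inequality\<close>

text \<open>Three obstacles shape the argument. Measurability in t: it is never established that the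
  Hausdorff measures of the level sets depend measurably on t, so integrals of them over t are upper
  integrals, controlled through Borel majorants. Critical points: where the gradient W of w
  vanishes, the normal of a level set is uncontrolled, so the density put into the coarea inequality
  is infinity there; on the other side it is multiplied by |W| = 0, and infinity times 0 is 0. Away
  from them F(-W/|W|) = F(W)/|W| by evenness and homogeneity, and the coarea factor |W| cancels the
  denominator. The boundary: a level set may meet the frontier of \<Omega> at any angle, but if one
  set contains another and both have an outer normal at a point, a density argument forces the two
  normals to agree. In the final approximation no constant may be lost, hence a version of convexity
  whose main coefficient tends to 1.\<close>

text \<open>Cavalieri's principle for a ball of radius R in dimension N + 1: level t of an affine
  function with slope c is the slice at height (t - t0)/c, whence the factor c. The substitution t =
  t0 + c*R*x leads to a Beta integral, which is the quotient of the two unit ball volumes.\<close>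

lemma nn_integral_ball_slices:
  fixes c R t0 :: real
  assumes "0 < c" "0 < R"
  shows "(\<integral>\<^sup>+t. ennreal (indicator {t. \<bar>t - t0\<bar> \<le> c * R} t *
            (unit_ball_vol (real N) * sqrt (R\<^sup>2 - ((t - t0) / c)\<^sup>2) ^ N)) \<partial>lborel)
         = ennreal (c * (unit_ball_vol (real (Suc N)) * R ^ Suc N))"
    (is "(\<integral>\<^sup>+t. ennreal (?f t) \<partial>lborel) = _")
proof -
  have meas: "(\<lambda>t. ennreal (?f t)) \<in> borel_measurable borel" by measurable
  have eq: "?f (t0 + c * R * x) =
      unit_ball_vol (real N) * R ^ N * (indicator {-1..1} x * sqrt (1 - x\<^sup>2) ^ N)" for x
  proof -
    have "\<bar>c * R * x\<bar> \<le> c * R \<longleftrightarrow> x \<in> {-1..1}"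
      using assms by (auto simp: abs_mult abs_le_iff)
    moreover have "sqrt (R\<^sup>2 - (R * x)\<^sup>2) = R * sqrt (1 - x\<^sup>2)"
    proof -
      have "R\<^sup>2 - (R * x)\<^sup>2 = R\<^sup>2 * (1 - x\<^sup>2)" by (simp add: algebra_simps power_mult_distrib)
      then show ?thesis using assms by (simp add: real_sqrt_mult)
    qed
    ultimately show ?thesis using assms by (simp add: indicator_def power_mult_distrib)
  qed
  have "(\<integral>\<^sup>+t. ennreal (?f t) \<partial>lborel) = ennreal \<bar>c * R\<bar> * (\<integral>\<^sup>+x. ennreal (?f (t0 + c * R * x)) \<partial>lborel)"
    by (rule nn_integral_real_affine[OF meas]) (use assms in auto)
  also have "(\<integral>\<^sup>+x. ennreal (?f (t0 + c * R * x)) \<partial>lborel) =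
      (\<integral>\<^sup>+x. ennreal (unit_ball_vol (real N) * R ^ N) * ennreal (indicator {-1..1} x * sqrt (1 - x\<^sup>2) ^ N) \<partial>lborel)"
    unfolding eq using assms by (intro nn_integral_cong) (auto simp: ennreal_mult' )
  also have "\<dots> = ennreal (unit_ball_vol (real N) * R ^ N) * ennreal (Beta (1 / 2) (real N / 2 + 1))"
    by (subst nn_integral_cmult) (auto simp: emeasure_cball_aux_integral)
  also have "ennreal \<bar>c * R\<bar> * \<dots> =
      ennreal (c * (unit_ball_vol (real N) * Beta (1/2) (real N / 2 + 1) * R ^ Suc N))"
    using assms by (simp add: ennreal_mult' [symmetric] mult_ac)
  also have "unit_ball_vol (real N) * Beta (1/2) (real N / 2 + 1) = unit_ball_vol (real (Suc N))"
    by (auto simp: unit_ball_vol_def Beta_def Gamma_eq_zero_iff field_simps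
          Gamma_one_half_real powr_half_sqrt [symmetric] powr_add [symmetric])
  finally show ?thesis .
qed

text \<open>Apply the parallelogram law to \<open>y - x\<close> and \<open>z - x\<close>.\<close>
lemma norm_diff_near_slice:
  fixes x y z u :: "'a::real_inner"
  assumes u: "norm u = 1" and r: "0 < r" and k: "0 \<le> k"
    and y: "norm (y - x) \<le> r" "\<bar>s - u \<bullet> (y - x)\<bar> \<le> k * r"
    and z: "norm (z - x) \<le> r" "\<bar>s - u \<bullet> (z - x)\<bar> \<le> k * r"
  shows "\<bar>s\<bar> \<le> (1 + 2 * k) * r" "norm (y - z) \<le> 2 * sqrt (((1 + 2 * k) * r)\<^sup>2 - s\<^sup>2)"
proof -
  define c d where "c = u \<bullet> (y - x)" and "d = u \<bullet> (z - x)"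
  have cr: "\<bar>c\<bar> \<le> r"
    unfolding c_def using Cauchy_Schwarz_ineq2[of u "y - x"] u y by simp
  have kr: "0 \<le> k * r" using k r by simp
  have s1: "\<bar>s\<bar> \<le> r + k * r" using cr y(2) c_def by linarith
  then show s2: "\<bar>s\<bar> \<le> (1 + 2 * k) * r" using kr by (simp add: algebra_simps)
  have cd: "\<bar>c + d\<bar> \<ge> 2 * \<bar>s\<bar> - 2 * (k * r)" using y(2) z(2) c_def d_def by linarith
  have "(norm ((y - x) - (z - x)))\<^sup>2 + (norm ((y - x) + (z - x)))\<^sup>2 = 2 * (norm (y - x))\<^sup>2 + 2 * (norm (z - x))\<^sup>2"
    by (simp add: power2_norm_eq_inner algebra_simps inner_commute)
  moreover have "(norm (y - x))\<^sup>2 \<le> r\<^sup>2" "(norm (z - x))\<^sup>2 \<le> r\<^sup>2"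
    using y z by (auto intro: power_mono)
  moreover have "(c + d)\<^sup>2 \<le> (norm ((y - x) + (z - x)))\<^sup>2"
  proof -
    have "\<bar>c + d\<bar> \<le> norm ((y - x) + (z - x))"
      using Cauchy_Schwarz_ineq2[of u "(y - x) + (z - x)"] u
      unfolding c_def d_def by (simp add: inner_add_right)
    then show ?thesis by (metis abs_ge_zero power2_abs power_mono)
  qed
  ultimately have 1: "(norm (y - z))\<^sup>2 \<le> 4 * r\<^sup>2 - (c + d)\<^sup>2" by simp
  \<comment> \<open>Both heights are within k*r of s, so |c + d| is nearly 2*|s|; for |s| < k*r the
    right-hand side is not positive anyway. The loss 8*k*r*(r + k*r) is at most four times the gain
    in squared radius from r to (1 + 2*k)*r.\<close>
  have 2: "(c + d)\<^sup>2 \<ge> 4 * s\<^sup>2 - 8 * (k * r) * (r + k * r)"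
  proof (cases "\<bar>s\<bar> \<ge> k * r")
    case True
    then have "(2 * \<bar>s\<bar> - 2 * (k * r))\<^sup>2 \<le> (c + d)\<^sup>2"
      using cd by (metis (no_types, opaque_lifting) abs_le_square_iff abs_of_nonneg diff_ge_0_iff_ge mult_left_mono zero_le_numeral)
    moreover have "(2 * \<bar>s\<bar> - 2 * (k * r))\<^sup>2 = 4 * s\<^sup>2 - 8 * (k * r) * \<bar>s\<bar> + 4 * (k * r)\<^sup>2"
      by (simp add: power2_eq_square algebra_simps)
    moreover have "8 * (k * r) * \<bar>s\<bar> \<le> 8 * (k * r) * (r + k * r)"
      using s1 kr by (intro mult_left_mono) auto
    ultimately show ?thesis using zero_le_power2[of "k*r"] by linarith
  next
    case False
    then have "s\<^sup>2 \<le> (k * r)\<^sup>2" using kr by (intro abs_le_square_iff[THEN iffD1]) auto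
    moreover have "0 \<le> (k * r) * r" using kr r by simp
    ultimately have "4 * s\<^sup>2 - 8 * (k * r) * (r + k * r) \<le> 0"
      by (simp add: algebra_simps power2_eq_square) (use zero_le_square[of "k*r"] in \<open>simp add: algebra_simps\<close>)
    also have "0 \<le> (c + d)\<^sup>2" by simp
    finally show ?thesis .
  qed
  have "((1 + 2 * k) * r)\<^sup>2 = r\<^sup>2 + 4 * (k * r) * r + 4 * (k * r)\<^sup>2"
    by (simp add: power2_eq_square algebra_simps)
  moreover have "0 \<le> (k * r) * r" "0 \<le> (k * r) * (k * r)" using kr r by simp_all
  ultimately have "(norm (y - z))\<^sup>2 \<le> 4 * (((1 + 2 * k) * r)\<^sup>2 - s\<^sup>2)"
    using 1 2 kr by (simp add: algebra_simps power2_eq_square)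
  then have "norm (y - z) \<le> sqrt (4 * (((1 + 2 * k) * r)\<^sup>2 - s\<^sup>2))"
    by (rule real_le_rsqrt)
  then show "norm (y - z) \<le> 2 * sqrt (((1 + 2 * k) * r)\<^sup>2 - s\<^sup>2)"
    unfolding real_sqrt_mult by simp
qed

text \<open>\<open>hausdorff_delta\<close> asks for sequences, while the Vitali families below are
  countable index sets, possibly finite. Free slots receive the empty set at no cost: its diameter
  is 0, and \<open>0 powr s = 0\<close> for every s.\<close>

lemma hausdorff_delta_le_countable:
  fixes C :: "'i \<Rightarrow> 'a::euclidean_space set"
  assumes I: "countable I" and A: "A \<subseteq> (\<Union>i\<in>I. C i)" and d: "0 \<le> \<delta>"
    and C: "\<And>i. i \<in> I \<Longrightarrow> bounded (C i)" "\<And>i. i \<in> I \<Longrightarrow> diameter (C i) \<le> \<delta>"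
  shows "hausdorff_delta s \<delta> A
    \<le> (\<integral>\<^sup>+i. ennreal (unit_ball_vol s * (diameter (C i) / 2) powr s) \<partial>count_space I)"
proof -
  let ?h = "\<lambda>C. ennreal (unit_ball_vol s * (diameter C / 2) powr s)"
  define J where "J = to_nat_on I ` I"
  define B where "B n = (if n \<in> J then C (from_nat_into I n) else {})" for n
  have inj: "inj_on (to_nat_on I) I" using I by (rule inj_on_to_nat_on)
  have B_to: "B (to_nat_on I i) = C i" if "i \<in> I" for i
    using that I by (auto simp: B_def J_def)
  have "hausdorff_delta s \<delta> A \<le> (\<Sum>n. ?h (B n))"
    unfolding hausdorff_delta_def
  proof (rule INF_lower, safe)
    fix x assume "x \<in> A"
    then obtain i where "i \<in> I" "x \<in> C i" using A by blast
    then show "x \<in> (\<Union>n. B n)" using B_to by blast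
  next
    fix n
    show "bounded (B n)" "diameter (B n) \<le> \<delta>"
      using C d B_to by (auto simp: B_def J_def I)
  qed
  also have "\<dots> = (\<integral>\<^sup>+n. ?h (B n) \<partial>count_space UNIV)"
    by (simp add: nn_integral_count_space_nat)
  also have "\<dots> = (\<integral>\<^sup>+n. ?h (B n) \<partial>count_space J)"
    by (rule nn_integral_count_space_eq) (auto simp: B_def)
  also have "\<dots> = (\<integral>\<^sup>+i. ?h (B (to_nat_on I i)) \<partial>count_space I)"
    by (rule nn_integral_bij_count_space[symmetric]) (use inj in \<open>auto simp: J_def bij_betw_def\<close>)
  also have "\<dots> = (\<integral>\<^sup>+i. ?h (C i) \<partial>count_space I)"
    by (rule nn_integral_cong) (use B_to in auto)
  finally show ?thesis .
qed

lemma hausdorff_term_le: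
  assumes "1 \<le> N" "diameter C \<le> 2 * d" "0 \<le> d"  "bounded C"
  shows "unit_ball_vol (real N) * (diameter C / 2) powr real N \<le> unit_ball_vol (real N) * d ^ N"
proof -
  have "(diameter C / 2) powr real N \<le> d powr real N"
    using assms diameter_ge_0[of C] by (intro powr_mono2) auto
  also have "d powr real N = d ^ N" using assms by (simp add: powr_realpow')
  finally show ?thesis by (intro mult_left_mono) auto
qed

text \<open>Near x the function w is affine up to o(r). Half of e pays for replacing
  \<open>W x\<close> by \<open>W y\<close> on the ball, the other half for the error in the slices.
  The Borel majorant D spares a study of how the diameter of a slice depends on t.\<close>

lemma ball_slice_bound:
  fixes w :: "'a::euclidean_space \<Rightarrow> real" and W :: "'a \<Rightarrow> 'a"
  assumes dim: "DIM('a) = Suc N" "1 \<le> N"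
    and der: "(w has_derivative (\<lambda>h. W x \<bullet> h)) (at x)" and cont: "continuous_on UNIV W"
    and e: "0 < e"
  obtains r0 where "0 < r0"
    "\<And>r. 0 < r \<Longrightarrow> r \<le> r0 \<Longrightarrow> \<exists>D\<in>borel_measurable borel.
       (\<forall>t. ennreal (unit_ball_vol (real N) * (diameter (cball x r \<inter> {y. w y = t}) / 2) powr real N) \<le> D t) \<and>
       (\<integral>\<^sup>+t. D t \<partial>lborel) \<le> (\<integral>\<^sup>+y\<in>cball x r. ennreal (norm (W y) + e) \<partial>lborel)"
proof -
  define c where "c = norm (W x)"
  have c0: "0 \<le> c" by (simp add: c_def)
  have vN: "0 < unit_ball_vol (real N)" and vS: "0 < unit_ball_vol (real (Suc N))"
    by (auto intro: unit_ball_vol_pos)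
  have cball: "emeasure lborel (cball x r) = ennreal (unit_ball_vol (real (Suc N)) * r ^ Suc N)"
    if "0 < r" for r using emeasure_cball[of r x] dim that by simp
  obtain d1 where d1: "0 < d1" "\<And>y. dist y x < d1 \<Longrightarrow> dist (W y) (W x) < e / 2"
    using cont e unfolding continuous_on_iff by (metis UNIV_I half_gt_zero)
  have lower: "ennreal ((c + e / 2) * (unit_ball_vol (real (Suc N)) * r ^ Suc N))
      \<le> (\<integral>\<^sup>+y\<in>cball x r. ennreal (norm (W y) + e) \<partial>lborel)" if "0 < r" "r < d1" for r
  proof -
    have "ennreal ((c + e / 2) * (unit_ball_vol (real (Suc N)) * r ^ Suc N))
        = (\<integral>\<^sup>+y\<in>cball x r. ennreal (c + e / 2) \<partial>lborel)"
      using that c0 e vS by (subst nn_integral_cmult_indicator) (simp_all add: cball ennreal_mult del: ennreal_plus power_Suc)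
    also have "\<dots> \<le> (\<integral>\<^sup>+y\<in>cball x r. ennreal (norm (W y) + e) \<partial>lborel)"
    proof (intro nn_integral_mono)
      fix y
      show "ennreal (c + e / 2) * indicator (cball x r) y \<le> ennreal (norm (W y) + e) * indicator (cball x r) y"
      proof (cases "y \<in> cball x r")
        case True
        then have "dist (W y) (W x) < e / 2" using d1(2)[of y] that by (simp add: dist_commute)
        then have "c \<le> norm (W y) + e / 2"
          unfolding c_def dist_norm using norm_triangle_ineq2[of "W x" "W y"] by (simp add: norm_minus_commute)
        then show ?thesis by (intro mult_right_mono ennreal_leI) auto
      qed simp
    qed
    finally show ?thesis .
  qed
  have expand: "\<exists>d>0. \<forall>y. norm (y - x) < d \<longrightarrow> \<bar>w y - w x - W x \<bullet> (y - x)\<bar> \<le> \<eta> * norm (y - x)" if "0 < \<eta>" for \<eta>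
    using der[unfolded has_derivative_at_alt] that by auto
  show thesis
  proof (cases "c = 0")
    case True
    \<comment> \<open>With zero gradient at x a slice may be as wide as the ball, but only levels in
      an interval of length 2*\<eta>*r occur. Writing v_N for the unit ball volume, \<eta> solves
      v_N * r^N * (2*\<eta>*r) = (e/2) * v_(N+1) * r^(N+1).\<close>
    define \<eta> where "\<eta> = e / 4 * unit_ball_vol (real (Suc N)) / unit_ball_vol (real N)"
    have eta: "0 < \<eta>" using vN vS e by (simp add: \<eta>_def)
    obtain d2 where d2: "0 < d2" "\<And>y. norm (y - x) < d2 \<Longrightarrow> \<bar>w y - w x - W x \<bullet> (y - x)\<bar> \<le> \<eta> * norm (y - x)"
      using expand[OF eta] by blast
    show thesis
    proof (rule that[of "min d1 d2 / 2"], use d1 d2 in simp)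
      fix r assume r: "0 < r" "r \<le> min d1 d2 / 2"
      define D where "D t = ennreal (unit_ball_vol (real N) * r ^ N) * indicator {w x - \<eta> * r..w x + \<eta> * r} t" for t
      have "D \<in> borel_measurable borel" unfolding D_def by measurable
      moreover have "ennreal (unit_ball_vol (real N) * (diameter (cball x r \<inter> {y. w y = t}) / 2) powr real N) \<le> D t" for t
      proof (cases "cball x r \<inter> {y. w y = t} = {}")
        case True
        then show ?thesis using dim by simp
      next
        case False
        then obtain y where y: "dist x y \<le> r" "w y = t" by force
        have "\<bar>w y - w x - W x \<bullet> (y - x)\<bar> \<le> \<eta> * norm (y - x)"
          using d2(2)[of y] y r d2 d1 by (simp add: dist_norm norm_minus_commute)
        also have "\<dots> \<le> \<eta> * r" using y eta by (simp add: dist_norm norm_minus_commute)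
        finally have t: "t \<in> {w x - \<eta> * r..w x + \<eta> * r}" using y True c_def by (auto simp: abs_le_iff)
        have "diameter (cball x r \<inter> {y. w y = t}) \<le> diameter (cball x r)"
          by (rule diameter_subset) auto
        then have "diameter (cball x r \<inter> {y. w y = t}) \<le> 2 * r" using r by simp
        then have "unit_ball_vol (real N) * (diameter (cball x r \<inter> {y. w y = t}) / 2) powr real N \<le> unit_ball_vol (real N) * r ^ N"
          using r dim by (intro hausdorff_term_le) (auto intro: bounded_subset[OF bounded_cball])
        then show ?thesis using t by (simp add: D_def ennreal_leI)
      qed
      moreover have "(\<integral>\<^sup>+t. D t \<partial>lborel) \<le> (\<integral>\<^sup>+y\<in>cball x r. ennreal (norm (W y) + e) \<partial>lborel)"
      proof -
        have "(\<integral>\<^sup>+t. D t \<partial>lborel) = ennreal (unit_ball_vol (real N) * r ^ N) * ennreal (2 * \<eta> * r)"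
          unfolding D_def using eta r by (simp add: nn_integral_cmult mult.assoc)
        also have "\<dots> = ennreal ((c + e / 2) * (unit_ball_vol (real (Suc N)) * r ^ Suc N))"
        proof -
          have "ennreal (a * r ^ N) * ennreal (2 * (e / 4 * b / a) * r) = ennreal ((0 + e / 2) * (b * r ^ Suc N))"
            if "0 < a" "0 < b" for a b using that r e
            by (subst ennreal_mult[symmetric]) (auto simp: field_simps)
          from this[OF vN vS] show ?thesis unfolding \<eta>_def True .
        qed
        also have "\<dots> \<le> (\<integral>\<^sup>+y\<in>cball x r. ennreal (norm (W y) + e) \<partial>lborel)"
          using r d1 d2 by (intro lower) auto
        finally show ?thesis .
      qed
      ultimately show "\<exists>D\<in>borel_measurable borel.
       (\<forall>t. ennreal (unit_ball_vol (real N) * (diameter (cball x r \<inter> {y. w y = t}) / 2) powr real N) \<le> D t) \<and>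
       (\<integral>\<^sup>+t. D t \<partial>lborel) \<le> (\<integral>\<^sup>+y\<in>cball x r. ennreal (norm (W y) + e) \<partial>lborel)" by blast
    qed
  next
    case False
    then have c: "0 < c" using c0 by simp
    \<comment> \<open>k is the relative error of the affine approximation. By
      \<open>norm_diff_near_slice\<close> it enlarges the radius of the sliced ball to (1 + 2*k)*r;
      k is taken so small that the larger volume raises the slope factor c by less than e/2.\<close>
    have "((\<lambda>k. c * (1 + 2 * k) ^ Suc N) \<longlongrightarrow> c * (1 + 2 * 0) ^ Suc N) (at_right 0)"
      by (intro tendsto_intros)
    then have "eventually (\<lambda>k. c * (1 + 2 * k) ^ Suc N < c + e / 2) (at_right 0)"
      by (rule order_tendstoD) (use e in simp)
    moreover have "eventually (\<lambda>k::real. 0 < k) (at_right 0)" by (rule eventually_at_right_less)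
    ultimately have "eventually (\<lambda>k. 0 < k \<and> c * (1 + 2 * k) ^ Suc N < c + e / 2) (at_right 0)"
      by eventually_elim auto
    then obtain k where k: "0 < k" "c * (1 + 2 * k) ^ Suc N < c + e / 2"
      using eventually_happens'[OF trivial_limit_at_right_real] by blast
    define u where "u = W x /\<^sub>R c"
    have u: "norm u = 1" using c by (simp add: u_def c_def)
    have Wu: "W x = c *\<^sub>R u" using c by (simp add: u_def)
    have eta: "0 < c * k" using c k by simp
    obtain d2 where d2: "0 < d2" "\<And>y. norm (y - x) < d2 \<Longrightarrow> \<bar>w y - w x - W x \<bullet> (y - x)\<bar> \<le> (c * k) * norm (y - x)"
      using expand[OF eta] by blast
    show thesis
    proof (rule that[of "min d1 d2 / 2"], use d1 d2 in simp)
      fix r assume r: "0 < r" "r \<le> min d1 d2 / 2"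
      define R where "R = (1 + 2 * k) * r"
      have R: "0 < R" using r k by (simp add: R_def)
      define D where "D t = ennreal (indicator {t. \<bar>t - w x\<bar> \<le> c * R} t *
            (unit_ball_vol (real N) * sqrt (R\<^sup>2 - ((t - w x) / c)\<^sup>2) ^ N))" for t
      have "D \<in> borel_measurable borel" unfolding D_def by measurable
      moreover have "ennreal (unit_ball_vol (real N) * (diameter (cball x r \<inter> {y. w y = t}) / 2) powr real N) \<le> D t" for t
      proof (cases "cball x r \<inter> {y. w y = t} = {}")
        case True
        then show ?thesis using dim by simp
      next
        case False
        define s where "s = (t - w x) / c"
        have near: "norm (y - x) \<le> r \<and> \<bar>s - u \<bullet> (y - x)\<bar> \<le> k * r" if "y \<in> cball x r \<inter> {y. w y = t}" for y
        proof -
          have y: "norm (y - x) \<le> r" "w y = t" using that by (auto simp: dist_norm norm_minus_commute)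
          have "\<bar>w y - w x - W x \<bullet> (y - x)\<bar> \<le> (c * k) * norm (y - x)"
            using d2(2)[of y] y r d2 d1 by (simp add: dist_norm norm_minus_commute)
          also have "\<dots> \<le> (c * k) * r" using y eta by (intro mult_left_mono) auto
          finally have "\<bar>t - w x - c * (u \<bullet> (y - x))\<bar> \<le> c * (k * r)"
            using y by (simp add: Wu mult.assoc)
          also have "t - w x - c * (u \<bullet> (y - x)) = c * (s - u \<bullet> (y - x))"
            using c by (simp add: s_def field_simps)
          finally have "c * \<bar>s - u \<bullet> (y - x)\<bar> \<le> c * (k * r)" using c by (simp add: abs_mult)
          then show ?thesis using c y by simp
        qed
        have diff: "norm (y - z) \<le> 2 * sqrt (R\<^sup>2 - s\<^sup>2)" "\<bar>s\<bar> \<le> R"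
          if "y \<in> cball x r \<inter> {y. w y = t}" "z \<in> cball x r \<inter> {y. w y = t}" for y z
          unfolding R_def using norm_diff_near_slice[OF u r(1) less_imp_le[OF k(1)], of y x s z] near that by auto
        have s: "\<bar>s\<bar> \<le> R" using diff False by blast
        then have s2: "s\<^sup>2 \<le> R\<^sup>2" using R by (metis abs_le_square_iff abs_of_pos)
        have t: "\<bar>t - w x\<bar> \<le> c * R" using s c by (simp add: s_def abs_divide field_simps)
        have "diameter (cball x r \<inter> {y. w y = t}) \<le> 2 * sqrt (R\<^sup>2 - s\<^sup>2)"
          using diff s2 by (intro diameter_le) auto
        then have "unit_ball_vol (real N) * (diameter (cball x r \<inter> {y. w y = t}) / 2) powr real N
            \<le> unit_ball_vol (real N) * sqrt (R\<^sup>2 - s\<^sup>2) ^ N"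
          using s2 dim by (intro hausdorff_term_le) (auto intro: bounded_subset[OF bounded_cball])
        then show ?thesis using t by (simp add: D_def s_def ennreal_leI)
      qed
      moreover have "(\<integral>\<^sup>+t. D t \<partial>lborel) \<le> (\<integral>\<^sup>+y\<in>cball x r. ennreal (norm (W y) + e) \<partial>lborel)"
      proof -
        have "(\<integral>\<^sup>+t. D t \<partial>lborel) = ennreal (c * (unit_ball_vol (real (Suc N)) * R ^ Suc N))"
          unfolding D_def by (rule nn_integral_ball_slices[OF c R])
        also have "\<dots> = ennreal ((c * (1 + 2 * k) ^ Suc N) * (unit_ball_vol (real (Suc N)) * r ^ Suc N))"
          by (simp add: R_def power_mult_distrib mult_ac)
        also have "\<dots> \<le> ennreal ((c + e / 2) * (unit_ball_vol (real (Suc N)) * r ^ Suc N))"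
          using k vS r by (intro ennreal_leI mult_right_mono) auto
        also have "\<dots> \<le> (\<integral>\<^sup>+y\<in>cball x r. ennreal (norm (W y) + e) \<partial>lborel)"
          using r d1 d2 by (intro lower) auto
        finally show ?thesis .
      qed
      ultimately show "\<exists>D\<in>borel_measurable borel.
       (\<forall>t. ennreal (unit_ball_vol (real N) * (diameter (cball x r \<inter> {y. w y = t}) / 2) powr real N) \<le> D t) \<and>
       (\<integral>\<^sup>+t. D t \<partial>lborel) \<le> (\<integral>\<^sup>+y\<in>cball x r. ennreal (norm (W y) + e) \<partial>lborel)" by blast
    qed
  qed
qed

section \<open>Upper integrals over the levels\<close>

text \<open>The upper integral is encoded as a predicate with a Borel majorant valid at every t, so
  that sums, multiples and lower limits can be formed pointwise without any measurability of
  f.\<close>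

definition upper_integral_le :: "(real \<Rightarrow> ennreal) \<Rightarrow> ennreal \<Rightarrow> bool" where
  "upper_integral_le f Q \<longleftrightarrow>
     (\<exists>g\<in>borel_measurable borel. (\<forall>t. f t \<le> g t) \<and> (\<integral>\<^sup>+t. g t \<partial>lborel) \<le> Q)"

lemma upper_integral_leI:
  "g \<in> borel_measurable borel \<Longrightarrow> (\<And>t. f t \<le> g t) \<Longrightarrow> (\<integral>\<^sup>+t. g t \<partial>lborel) \<le> Q \<Longrightarrow> upper_integral_le f Q"
  unfolding upper_integral_le_def by blast

lemma upper_integral_le_mono:
  assumes "upper_integral_le f Q" "\<And>t. f' t \<le> f t" "Q \<le> Q'"
  shows "upper_integral_le f' Q'"
  using assms unfolding upper_integral_le_def by (meson order_trans)

lemma upper_integral_le_add: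
  assumes "upper_integral_le f Q" "upper_integral_le f' Q'"
  shows "upper_integral_le (\<lambda>t. f t + f' t) (Q + Q')"
proof -
  obtain g g' where "g \<in> borel_measurable borel" "\<forall>t. f t \<le> g t" "(\<integral>\<^sup>+t. g t \<partial>lborel) \<le> Q"
    "g' \<in> borel_measurable borel" "\<forall>t. f' t \<le> g' t" "(\<integral>\<^sup>+t. g' t \<partial>lborel) \<le> Q'"
    using assms unfolding upper_integral_le_def by blast
  then show ?thesis
    by (intro upper_integral_leI[of "\<lambda>t. g t + g' t"]) (auto simp: nn_integral_add intro: add_mono)
qed

lemma upper_integral_le_cmult:
  assumes "upper_integral_le f Q"
  shows "upper_integral_le (\<lambda>t. c * f t) (c * Q)"
proof -
  obtain g where "g \<in> borel_measurable borel" "\<forall>t. f t \<le> g t" "(\<integral>\<^sup>+t. g t \<partial>lborel) \<le> Q"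
    using assms unfolding upper_integral_le_def by blast
  then show ?thesis
    by (intro upper_integral_leI[of "\<lambda>t. c * g t"]) (auto simp: nn_integral_cmult intro: mult_left_mono)
qed

text \<open>Fatou's lemma, applied to the majorants. It serves twice: for \<delta> tending to 0 in
  the Hausdorff premeasures, and for increasing sequences of densities in the coarea
  inequality.\<close>

lemma upper_integral_le_liminf:
  assumes f: "\<And>k. upper_integral_le (f k) (Q k)"
  shows "upper_integral_le (\<lambda>t. liminf (\<lambda>k. f k t)) (liminf Q)"
proof -
  obtain g where g: "\<And>k. g k \<in> borel_measurable borel" "\<And>k t. f k t \<le> g k t" "\<And>k. (\<integral>\<^sup>+t. g k t \<partial>lborel) \<le> Q k"
    using f unfolding upper_integral_le_def by metis
  show ?thesis
  proof (rule upper_integral_leI[of "\<lambda>t. liminf (\<lambda>k. g k t)"])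
    show "(\<lambda>t. liminf (\<lambda>k. g k t)) \<in> borel_measurable borel" using g by measurable
    show "liminf (\<lambda>k. f k t) \<le> liminf (\<lambda>k. g k t)" for t by (intro Liminf_mono always_eventually allI g)
    have "(\<integral>\<^sup>+t. liminf (\<lambda>k. g k t) \<partial>lborel) \<le> liminf (\<lambda>k. \<integral>\<^sup>+t. g k t \<partial>lborel)"
      by (rule nn_integral_liminf) (use g in simp)
    also have "\<dots> \<le> liminf Q" by (intro Liminf_mono always_eventually allI g)
    finally show "(\<integral>\<^sup>+t. liminf (\<lambda>k. g k t) \<partial>lborel) \<le> liminf Q" .
  qed
qed

lemma upper_integral_le_count_space:
  assumes I: "countable I" and f: "\<And>i. i \<in> I \<Longrightarrow> upper_integral_le (f i) (q i)"
  shows "upper_integral_le (\<lambda>t. \<integral>\<^sup>+i. f i t \<partial>count_space I) (\<integral>\<^sup>+i. q i \<partial>count_space I)"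
proof -
  obtain g where g: "\<And>i. i \<in> I \<Longrightarrow> g i \<in> borel_measurable borel" "\<And>i t. i \<in> I \<Longrightarrow> f i t \<le> g i t"
    "\<And>i. i \<in> I \<Longrightarrow> (\<integral>\<^sup>+t. g i t \<partial>lborel) \<le> q i"
    using f unfolding upper_integral_le_def by metis
  interpret sigma_finite_measure "count_space I" using I by (rule sigma_finite_measure_count_space_countable)
  show ?thesis
  proof (rule upper_integral_leI[of "\<lambda>t. \<integral>\<^sup>+i. g i t \<partial>count_space I"])
    have "(\<lambda>(t, i). g i t) \<in> borel_measurable (borel \<Otimes>\<^sub>M count_space I)"
      by (rule measurable_pair_swap_iff[THEN iffD2], rule measurable_pair_measure_countable1[OF I]) (use g in simp)
    then show "(\<lambda>t. \<integral>\<^sup>+i. g i t \<partial>count_space I) \<in> borel_measurable borel"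
      by (rule borel_measurable_nn_integral)
    show "(\<integral>\<^sup>+i. f i t \<partial>count_space I) \<le> (\<integral>\<^sup>+i. g i t \<partial>count_space I)" for t
      by (rule nn_integral_mono) (use g in simp)
    have "(\<integral>\<^sup>+t. \<integral>\<^sup>+i. g i t \<partial>count_space I \<partial>lborel) = (\<integral>\<^sup>+i. \<integral>\<^sup>+t. g i t \<partial>lborel \<partial>count_space I)"
      by (rule nn_integral_count_space_nn_integral[OF I]) (use g in simp)
    also have "\<dots> \<le> (\<integral>\<^sup>+i. q i \<partial>count_space I)"
      by (rule nn_integral_mono) (use g in simp)
    finally show "(\<integral>\<^sup>+t. \<integral>\<^sup>+i. g i t \<partial>count_space I \<partial>lborel) \<le> (\<integral>\<^sup>+i. q i \<partial>count_space I)" .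
  qed
qed

text \<open>A single cover of A, cut by {w = t}, covers all level sets simultaneously, so the bounds
  of the individual pieces add up under the integral over t.\<close>

lemma upper_integral_hausdorff_delta_cover:
  fixes C :: "'i \<Rightarrow> 'a::euclidean_space set"
  assumes I: "countable I" and A: "A \<subseteq> (\<Union>i\<in>I. C i)" and d: "0 \<le> \<delta>"
    and C: "\<And>i. i \<in> I \<Longrightarrow> bounded (C i)" "\<And>i. i \<in> I \<Longrightarrow> diameter (C i) \<le> \<delta>"
    and q: "\<And>i. i \<in> I \<Longrightarrow> upper_integral_le
              (\<lambda>t. ennreal (unit_ball_vol s * (diameter (C i \<inter> {y. w y = t}) / 2) powr s)) (q i)"
  shows "upper_integral_le (\<lambda>t. hausdorff_delta s \<delta> (A \<inter> {y. w y = t})) (\<integral>\<^sup>+i. q i \<partial>count_space I)"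
proof (rule upper_integral_le_mono[OF upper_integral_le_count_space[OF I q]])
  fix t
  show "hausdorff_delta s \<delta> (A \<inter> {y. w y = t}) \<le>
     (\<integral>\<^sup>+i. ennreal (unit_ball_vol s * (diameter (C i \<inter> {y. w y = t}) / 2) powr s) \<partial>count_space I)"
  proof (rule hausdorff_delta_le_countable[OF I _ d])
    show "A \<inter> {y. w y = t} \<subseteq> (\<Union>i\<in>I. C i \<inter> {y. w y = t})" using A by blast
    fix i assume i: "i \<in> I"
    show "bounded (C i \<inter> {y. w y = t})" using C(1)[OF i] by (rule bounded_subset) auto
    have "diameter (C i \<inter> {y. w y = t}) \<le> diameter (C i)"
      by (rule diameter_subset) (use C i in auto)
    then show "diameter (C i \<inter> {y. w y = t}) \<le> \<delta>" using C(2)[OF i] by simp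
  qed
qed auto

section \<open>From balls to Borel sets by Vitali covering\<close>

text \<open>The factor 5 makes up for the loss in the Vitali covering lemma.\<close>
lemma upper_integral_lipschitz_ball:
  fixes w :: "'a::euclidean_space \<Rightarrow> real"
  assumes dim: "DIM('a) = Suc N" "1 \<le> N" and L: "0 \<le> L" and r: "0 < r"
    and lip: "\<And>x y. \<bar>w x - w y\<bar> \<le> L * norm (x - y)"
  shows "upper_integral_le
    (\<lambda>t. ennreal (unit_ball_vol (real N) * (diameter (cball x r \<inter> {y. w y = t}) / 2) powr real N))
    (ennreal (2 * L * 5 ^ Suc N * unit_ball_vol (real N) / unit_ball_vol (real (Suc N)))
       * emeasure lborel (cball x (r / 5)))"
proof -
  have vN: "0 < unit_ball_vol (real N)" and vS: "0 < unit_ball_vol (real (Suc N))"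
    by (auto intro: unit_ball_vol_pos)
  define D where "D t = ennreal (unit_ball_vol (real N) * r ^ N) * indicator {w x - L * r..w x + L * r} t" for t
  show ?thesis
  proof (rule upper_integral_leI[of D])
    show "D \<in> borel_measurable borel" unfolding D_def by measurable
  next
    fix t
    show "ennreal (unit_ball_vol (real N) * (diameter (cball x r \<inter> {y. w y = t}) / 2) powr real N) \<le> D t"
    proof (cases "cball x r \<inter> {y. w y = t} = {}")
      case True
      then show ?thesis using dim by simp
    next
      case False
      then obtain y where y: "norm (x - y) \<le> r" "w y = t" by (force simp: dist_norm)
      have "\<bar>w x - w y\<bar> \<le> L * norm (x - y)" by (rule lip)
      also have "\<dots> \<le> L * r" using y L by (intro mult_left_mono) auto
      finally have t: "t \<in> {w x - L * r..w x + L * r}" using y by (auto simp: abs_le_iff)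
      have "diameter (cball x r \<inter> {y. w y = t}) \<le> diameter (cball x r)"
        by (rule diameter_subset) auto
      then have "diameter (cball x r \<inter> {y. w y = t}) \<le> 2 * r" using r by simp
      then have "unit_ball_vol (real N) * (diameter (cball x r \<inter> {y. w y = t}) / 2) powr real N \<le> unit_ball_vol (real N) * r ^ N"
        using r dim by (intro hausdorff_term_le) (auto intro: bounded_subset[OF bounded_cball])
      then show ?thesis using t by (simp add: D_def ennreal_leI)
    qed
  next
    have "(\<integral>\<^sup>+t. D t \<partial>lborel) = ennreal (unit_ball_vol (real N) * r ^ N) * ennreal (2 * L * r)"
      unfolding D_def using L r by (simp add: nn_integral_cmult mult.assoc)
    also have "\<dots> = ennreal (2 * L * 5 ^ Suc N * unit_ball_vol (real N) / unit_ball_vol (real (Suc N)))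
       * ennreal (unit_ball_vol (real (Suc N)) * (r / 5) ^ Suc N)"
      using less_imp_neq[OF vN] less_imp_neq[OF vS] L r
      by (subst (1 2) ennreal_mult[symmetric]) (auto simp: field_simps power_divide)
    also have "ennreal (unit_ball_vol (real (Suc N)) * (r / 5) ^ Suc N) = emeasure lborel (cball x (r / 5))"
      using emeasure_cball[of "r / 5" x] dim r by simp
    finally show "(\<integral>\<^sup>+t. D t \<partial>lborel) \<le> ennreal (2 * L * 5 ^ Suc N * unit_ball_vol (real N) / unit_ball_vol (real (Suc N)))
       * emeasure lborel (cball x (r / 5))" by simp
  qed
qed

lemma lborel_measure_disjoint_cballs_le:
  fixes x :: "'i \<Rightarrow> 'a::euclidean_space"
  assumes "countable C" "\<And>i. i \<in> C \<Longrightarrow> cball (x i) (r i) \<subseteq> S" "S \<in> sets borel"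
    and "pairwise (\<lambda>i j. disjnt (cball (x i) (r i)) (cball (x j) (r j))) C"
    and f: "f \<in> borel_measurable borel"
  shows "(\<integral>\<^sup>+i. (\<integral>\<^sup>+y\<in>cball (x i) (r i). f y \<partial>lborel) \<partial>count_space C) \<le> (\<integral>\<^sup>+y\<in>S. f y \<partial>lborel)"
proof -
  have em: "emeasure (density lborel f) A = (\<integral>\<^sup>+y\<in>A. f y \<partial>lborel)" if "A \<in> sets borel" for A
    using that f by (subst emeasure_density) auto
  have "(\<integral>\<^sup>+i. (\<integral>\<^sup>+y\<in>cball (x i) (r i). f y \<partial>lborel) \<partial>count_space C)
      = (\<integral>\<^sup>+i. emeasure (density lborel f) (cball (x i) (r i)) \<partial>count_space C)"
    by (rule nn_integral_cong) (simp add: em)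
  also have "\<dots> = emeasure (density lborel f) (\<Union>i\<in>C. cball (x i) (r i))"
    by (rule emeasure_UN_countable[symmetric])
       (use assms in \<open>auto simp: disjoint_family_on_def pairwise_def disjnt_def\<close>)
  also have "\<dots> \<le> emeasure (density lborel f) S"
    by (rule emeasure_mono) (use assms in auto)
  finally show ?thesis using assms by (simp add: em)
qed

lemma gradient_bound_imp_lipschitz:
  fixes w :: "'a::euclidean_space \<Rightarrow> real"
  assumes S: "convex S" and der: "\<And>x. x \<in> S \<Longrightarrow> (w has_derivative (\<lambda>h. W x \<bullet> h)) (at x)"
    and L: "\<And>x. x \<in> S \<Longrightarrow> norm (W x) \<le> L" and xy: "x \<in> S" "y \<in> S"
  shows "\<bar>w x - w y\<bar> \<le> L * norm (x - y)"
proof -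
  have L0: "0 \<le> L" using order_trans[OF norm_ge_zero L] xy by blast
  have "norm (w x - w y) \<le> L * norm (x - y)"
  proof (rule differentiable_bound[OF S _ _ xy, of w "\<lambda>x h. W x \<bullet> h"])
    fix z assume z: "z \<in> S"
    show "(w has_derivative (\<lambda>h. W z \<bullet> h)) (at z within S)"
      by (rule has_derivative_at_withinI[OF der[OF z]])
    show "onorm (\<lambda>h. W z \<bullet> h) \<le> L"
    proof (rule onorm_bound[OF L0])
      fix h
      have "\<bar>W z \<bullet> h\<bar> \<le> norm (W z) * norm h" by (rule Cauchy_Schwarz_ineq2)
      also have "\<dots> \<le> L * norm h" by (rule mult_right_mono[OF L[OF z]]) simp
      finally show "norm (W z \<bullet> h) \<le> L * norm h" by simp
    qed
  qed
  then show ?thesis by simp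
qed

text \<open>The balls with the sharp bound of \<open>ball_slice_bound\<close> cover A finely, but
  Vitali's theorem exhausts A only up to a Lebesgue null set N', and a null set (a hyperplane, say)
  can meet a level set in positive premeasure. So N' is covered by a second family inside a small
  open set V, where the crude Lipschitz bound is affordable.\<close>

lemma upper_integral_hausdorff_delta_level_sets:
  fixes w :: "'a::euclidean_space \<Rightarrow> real" and W :: "'a \<Rightarrow> 'a"
  assumes dim: "DIM('a) = Suc N" "1 \<le> N"
    and der: "\<And>x. (w has_derivative (\<lambda>h. W x \<bullet> h)) (at x)" and cont: "continuous_on UNIV W"
    and L: "\<And>x. norm (W x) \<le> L"
    and A: "A \<in> sets borel" "emeasure lborel A < \<infinity>"
    and e: "0 < e" and \<delta>: "0 < \<delta>"
  shows "upper_integral_le (\<lambda>t. hausdorff_delta (real N) \<delta> (A \<inter> {y. w y = t}))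
     ((\<integral>\<^sup>+y\<in>A. ennreal (norm (W y)) \<partial>lborel) + ennreal e)"
proof -
  have L0: "0 \<le> L" using L[of 0] norm_ge_zero order_trans by blast
  have lip: "\<bar>w x - w y\<bar> \<le> L * norm (x - y)" for x y
    by (rule gradient_bound_imp_lipschitz[OF convex_UNIV der L]) auto
  have Wm [measurable]: "W \<in> borel_measurable borel" using cont by (rule borel_measurable_continuous_onI)
  define mA where "mA = measure lborel A"
  have mA: "emeasure lborel A = ennreal mA" using A by (simp add: mA_def emeasure_eq_ennreal_measure)
  \<comment> \<open>The slack in f costs e1*|A|, and enlarging A to U costs (L + e1)*|U - A|. As |U
    - A| < min e1 1, the sum is at most e1*(L + mA + 1) = e/3.\<close>
  define e1 where "e1 = e / (3 * (L + mA + 1))"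
  have mA0: "0 \<le> mA" by (simp add: mA_def)
  have e1: "0 < e1" using e L0 mA0 by (simp add: e1_def)
  obtain U where U: "open U" "A \<subseteq> U" "emeasure lborel (U - A) < ennreal (min e1 1)"
    using outer_regular_lborel[of A "min e1 1"] A e1 by auto
  define f where "f y = ennreal (norm (W y) + e1)" for y
  have fm [measurable]: "f \<in> borel_measurable borel" unfolding f_def by measurable
  define T where "T x r t = ennreal (unit_ball_vol (real N) * (diameter (cball x r \<inter> {y. w y = t}) / 2) powr real N)" for x r t
  define K where "K = {(x, r). x \<in> A \<and> 0 < r \<and> 2 * r \<le> \<delta> \<and> cball x r \<subseteq> U \<and>
      upper_integral_le (T x r) (\<integral>\<^sup>+y\<in>cball x r. f y \<partial>lborel)}"
  obtain C1 where C1: "countable C1" "C1 \<subseteq> K"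
     "pairwise (\<lambda>i j. disjnt (cball (fst i) (snd i)) (cball (fst j) (snd j))) C1"
     "negligible (A - (\<Union>i\<in>C1. cball (fst i) (snd i)))"
  proof (rule Vitali_covering_theorem_cballs[of K snd A fst])
    show "0 < snd i" if "i \<in> K" for i using that by (auto simp: K_def)
    fix x and d :: real assume x: "x \<in> A" and d: "0 < d"
    obtain r0 where r0: "0 < r0" "\<And>r. 0 < r \<Longrightarrow> r \<le> r0 \<Longrightarrow> upper_integral_le (T x r) (\<integral>\<^sup>+y\<in>cball x r. f y \<partial>lborel)"
      unfolding T_def f_def upper_integral_le_def
      by (rule ball_slice_bound[OF dim der cont e1, of x]) blast
    obtain r1 where r1: "0 < r1" "cball x r1 \<subseteq> U"
      using U x by (meson open_contains_cball subsetD)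
    define r where "r = Min {r0, r1, d / 2, \<delta> / 2}"
    have "0 < r" "r \<le> r0" "r \<le> r1" "r \<le> d / 2" "r \<le> \<delta> / 2" using r0 r1 d \<delta> by (auto simp: r_def)
    then have "(x, r) \<in> K" "r < d" using r0(2)[of r] r1 x d by (auto simp: K_def)
    then show "\<exists>i. i \<in> K \<and> x \<in> cball (fst i) (snd i) \<and> snd i < d"
      using \<open>0 < r\<close> by (intro exI[of _ "(x, r)"]) auto
  qed auto
  define N' where "N' = A - (\<Union>i\<in>C1. cball (fst i) (snd i))"
  define M where "M = 2 * L * 5 ^ Suc N * unit_ball_vol (real N) / unit_ball_vol (real (Suc N))"
  have M0: "0 \<le> M" using L0 by (simp add: M_def)
  \<comment> \<open>Chosen to give M*e2 \<le> e/3, where M is the constant of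
    \<open>upper_integral_lipschitz_ball\<close>; the added 1 keeps the denominator positive when M
    = 0.\<close>
  define e2 where "e2 = e / (3 * (M + 1))"
  have e2: "0 < e2" using e M0 by (simp add: e2_def)
  have N': "N' \<in> sets borel" unfolding N'_def using A C1(1) by (auto intro!: sets.Diff sets.countable_UN' )
  have N'0: "emeasure lborel N' = 0"
    using C1(4) N' unfolding N'_def[symmetric] negligible_iff_null_sets null_sets_completion_iff[OF N'[folded sets_lborel]] by auto
  obtain V where V: "open V" "N' \<subseteq> V" "emeasure lborel (V - N') < ennreal e2"
    using outer_regular_lborel[OF N' e2] by auto
  have V2: "emeasure lborel V \<le> ennreal e2"
  proof -
    have "emeasure lborel V = emeasure lborel (V - N' \<union> N')" using V(2) by (simp add: Un_absorb2)
    also have "\<dots> = emeasure lborel (V - N')"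
      using V(1) N' N'0 by (intro emeasure_Un_null_set) auto
    finally show ?thesis using V(3) by simp
  qed
  \<comment> \<open>The selected balls of radius r/5 are disjoint and lie in V, so their volumes sum
    to at most |V|; their fivefold enlargements cover N' and have diameter 2*r \<le>
    \<delta>.\<close>
  define K2 where "K2 = {(x, r). x \<in> N' \<and> 0 < r \<and> 2 * r \<le> \<delta> \<and> cball x (r / 5) \<subseteq> V}"
  obtain C2 where C2: "countable C2" "C2 \<subseteq> K2"
     "pairwise (\<lambda>i j. disjnt (cball (fst i) (snd i / 5)) (cball (fst j) (snd j / 5))) C2"
     "N' \<subseteq> (\<Union>i\<in>C2. cball (fst i) (5 * (snd i / 5)))"
  proof (rule Vitali_covering_lemma_cballs[of N' fst "\<lambda>i. snd i / 5" K2 \<delta>])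
    show "0 < snd i / 5 \<and> snd i / 5 \<le> \<delta>" if "i \<in> K2" for i using that by (auto simp: K2_def)
    show "N' \<subseteq> (\<Union>i\<in>K2. cball (fst i) (snd i / 5))"
    proof
      fix x assume x: "x \<in> N'"
      obtain r1 where r1: "0 < r1" "cball x r1 \<subseteq> V"
        using V x by (meson open_contains_cball subsetD)
      define r where "r = min r1 (\<delta> / 2)"
      have "0 < r" "r \<le> r1" "r \<le> \<delta> / 2" using r1 \<delta> by (auto simp: r_def)
      then have "(x, r) \<in> K2" using r1 x by (auto simp: K2_def)
      then show "x \<in> (\<Union>i\<in>K2. cball (fst i) (snd i / 5))"
        using \<open>0 < r\<close> by (intro UN_I[of "(x, r)"]) auto
    qed
  qed auto
  have sub1: "cball (fst i) (snd i) \<subseteq> U" if "i \<in> C1" for i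
    using subsetD[OF C1(2) that] by (cases i) (simp add: K_def)
  have sub2: "cball (fst i) (snd i / 5) \<subseteq> V" if "i \<in> C2" for i
    using subsetD[OF C2(2) that] by (cases i) (simp add: K2_def)
  \<comment> \<open>An index in both families is charged at the sharp rate only, so the sum over the
    union is at most the sum over C1 plus the sum over C2.\<close>
  define q where "q i = (if i \<in> C1 then \<integral>\<^sup>+y\<in>cball (fst i) (snd i). f y \<partial>lborel
     else ennreal M * emeasure lborel (cball (fst i) (snd i / 5)))" for i
  have "upper_integral_le (\<lambda>t. hausdorff_delta (real N) \<delta> (A \<inter> {y. w y = t})) (\<integral>\<^sup>+i. q i \<partial>count_space (C1 \<union> C2))"
  proof (rule upper_integral_hausdorff_delta_cover[where C="\<lambda>i. cball (fst i) (snd i)"])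
    show "countable (C1 \<union> C2)" using C1 C2 by simp
    show "A \<subseteq> (\<Union>i\<in>C1 \<union> C2. cball (fst i) (snd i))" using C2(4) unfolding N'_def by auto
    show "0 \<le> \<delta>" using \<delta> by simp
    fix i assume i: "i \<in> C1 \<union> C2"
    show "bounded (cball (fst i) (snd i))" by simp
    show "diameter (cball (fst i) (snd i)) \<le> \<delta>" using i C1(2) C2(2) by (auto simp: K_def K2_def)
    show "upper_integral_le (\<lambda>t. ennreal (unit_ball_vol (real N) *
       (diameter (cball (fst i) (snd i) \<inter> {y. w y = t}) / 2) powr real N)) (q i)"
    proof (cases "i \<in> C1")
      case True
      then show ?thesis using C1(2) unfolding q_def K_def T_def by auto
    next
      case False
      then have "0 < snd i" using i C2(2) by (auto simp: K2_def)
      from upper_integral_lipschitz_ball[OF dim L0 this lip, of "fst i"] False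
      show ?thesis unfolding q_def M_def by simp
    qed
  qed
  then show ?thesis
  proof (rule upper_integral_le_mono)
    have "(\<integral>\<^sup>+i. q i \<partial>count_space (C1 \<union> C2)) = (\<integral>\<^sup>+i. q i * indicator (C1 \<union> C2) i \<partial>count_space UNIV)"
      by (simp add: nn_integral_count_space_indicator)
    also have "\<dots> \<le> (\<integral>\<^sup>+i. (\<integral>\<^sup>+y\<in>cball (fst i) (snd i). f y \<partial>lborel) * indicator C1 i
          + (ennreal M * emeasure lborel (cball (fst i) (snd i / 5))) * indicator C2 i \<partial>count_space UNIV)"
      by (rule nn_integral_mono) (auto simp: q_def indicator_def)
    also have "\<dots> = (\<integral>\<^sup>+i. (\<integral>\<^sup>+y\<in>cball (fst i) (snd i). f y \<partial>lborel) \<partial>count_space C1)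
        + ennreal M * (\<integral>\<^sup>+i. emeasure lborel (cball (fst i) (snd i / 5)) \<partial>count_space C2)"
      by (subst nn_integral_add) (auto simp: nn_integral_count_space_indicator nn_integral_cmult mult.assoc)
    also have "\<dots> \<le> (\<integral>\<^sup>+y\<in>U. f y \<partial>lborel) + ennreal M * ennreal e2"
    proof (intro add_mono mult_left_mono)
      show "(\<integral>\<^sup>+i. (\<integral>\<^sup>+y\<in>cball (fst i) (snd i). f y \<partial>lborel) \<partial>count_space C1) \<le> (\<integral>\<^sup>+y\<in>U. f y \<partial>lborel)"
        by (rule lborel_measure_disjoint_cballs_le[OF C1(1) _ _ C1(3) fm]) (use sub1 U in auto)
      have "(\<integral>\<^sup>+i. (\<integral>\<^sup>+y\<in>cball (fst i) (snd i / 5). 1 \<partial>lborel) \<partial>count_space C2) \<le> (\<integral>\<^sup>+y\<in>V. 1 \<partial>lborel)"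
        by (rule lborel_measure_disjoint_cballs_le[OF C2(1) _ _ C2(3)]) (use sub2 V in auto)
      then show "(\<integral>\<^sup>+i. emeasure lborel (cball (fst i) (snd i / 5)) \<partial>count_space C2) \<le> ennreal e2"
        using V2 V(1) by simp
    qed simp
    also have "(\<integral>\<^sup>+y\<in>U. f y \<partial>lborel) \<le> (\<integral>\<^sup>+y\<in>A. ennreal (norm (W y)) \<partial>lborel) + ennreal (2 * e / 3)"
    proof -
      have [measurable]: "A \<in> sets borel" "U \<in> sets borel" using A U by auto
      have "(\<integral>\<^sup>+y\<in>U. f y \<partial>lborel) \<le> (\<integral>\<^sup>+y. ennreal (norm (W y)) * indicator A y
            + (ennreal e1 * indicator A y + ennreal (L + e1) * indicator (U - A) y) \<partial>lborel)"
        using e1 U L by (intro nn_integral_mono)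
          (auto simp: f_def indicator_def ennreal_plus[symmetric] simp del: ennreal_plus intro!: ennreal_leI)
      also have "\<dots> = (\<integral>\<^sup>+y\<in>A. ennreal (norm (W y)) \<partial>lborel) + (ennreal e1 * emeasure lborel A + ennreal (L + e1) * emeasure lborel (U - A))"
        by (simp add: nn_integral_add nn_integral_cmult)
      also have "ennreal e1 * emeasure lborel A + ennreal (L + e1) * emeasure lborel (U - A)
          \<le> ennreal e1 * ennreal mA + (ennreal L * ennreal e1 + ennreal e1 * ennreal 1)"
      proof -
        have "ennreal (L + e1) * emeasure lborel (U - A) = ennreal L * emeasure lborel (U - A) + ennreal e1 * emeasure lborel (U - A)"
          using L0 e1 by (simp add: distrib_right)
        moreover have "emeasure lborel (U - A) \<le> ennreal e1" "emeasure lborel (U - A) \<le> ennreal 1"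
          using order_trans[OF less_imp_le[OF U(3)] ennreal_leI] by (blast intro: min.cobounded1 min.cobounded2)+
        ultimately show ?thesis unfolding mA
          by (simp only:) (intro add_mono mult_left_mono order_refl; simp)
      qed
      also have "\<dots> = ennreal (e1 * (L + mA + 1))"
        using e1 L0 mA0 by (simp add: ennreal_mult[symmetric] ennreal_plus[symmetric] algebra_simps del: ennreal_plus)
      also have "e1 * (L + mA + 1) = e / 3" using L0 mA0 by (simp add: e1_def field_simps)
      also have "ennreal (e / 3) \<le> ennreal (2 * e / 3)" using e by (intro ennreal_leI) simp
      finally show ?thesis by (simp add: add_left_mono)
    qed
    also have "ennreal M * ennreal e2 \<le> ennreal (e / 3)"
      using M0 e e2 by (simp add: ennreal_mult[symmetric] e2_def field_simps)
    also have "(\<integral>\<^sup>+y\<in>A. ennreal (norm (W y)) \<partial>lborel) + ennreal (2 * e / 3) + ennreal (e / 3)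
        = (\<integral>\<^sup>+y\<in>A. ennreal (norm (W y)) \<partial>lborel) + ennreal e"
      using e by (simp add: add.assoc ennreal_plus[symmetric] del: ennreal_plus)
    finally show "(\<integral>\<^sup>+i. q i \<partial>count_space (C1 \<union> C2)) \<le> (\<integral>\<^sup>+y\<in>A. ennreal (norm (W y)) \<partial>lborel) + ennreal e"
      by (simp add: add_mono)
  qed simp
qed

section \<open>The coarea inequality for the Hausdorff measure\<close>

lemma sets_hausdorff_measure [measurable_cong, simp]: "sets (hausdorff_measure s) = sets borel"
  unfolding hausdorff_measure_def by (subst sets_measure_of) (auto simp: sets.sigma_sets_eq[of borel, simplified])

lemma space_hausdorff_measure [simp]: "space (hausdorff_measure s) = UNIV"
  unfolding hausdorff_measure_def by (subst space_measure_of) auto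

text \<open>If \<open>hausdorff_outer\<close> were not countably additive on the Borel sets, then
  \<open>measure_of\<close> would return the zero measure; the bound holds in either case.\<close>
lemma emeasure_hausdorff_measure_le: "emeasure (hausdorff_measure s) A \<le> hausdorff_outer s A"
  unfolding hausdorff_measure_def emeasure_measure_of_conv by simp

lemma hausdorff_delta_antimono: "\<delta> \<le> \<delta>' \<Longrightarrow> hausdorff_delta s \<delta>' A \<le> hausdorff_delta s \<delta> A"
  unfolding hausdorff_delta_def by (rule INF_superset_mono) (auto intro: order_trans)

lemma hausdorff_outer_le_liminf:
  "hausdorff_outer s A \<le> liminf (\<lambda>k. hausdorff_delta s (1 / real (Suc k)) A)"
  unfolding hausdorff_outer_def
proof (rule SUP_least)
  fix \<delta> :: real assume d: "\<delta> \<in> {0<..}"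
  have "eventually (\<lambda>k. 1 / real (Suc k) < \<delta>) sequentially"
    using d by (intro order_tendstoD[OF LIMSEQ_inverse_real_of_nat[unfolded inverse_eq_divide]]) auto
  then show "hausdorff_delta s \<delta> A \<le> liminf (\<lambda>k. hausdorff_delta s (1 / real (Suc k)) A)"
    by (intro Liminf_bounded) (auto elim!: eventually_mono intro: hausdorff_delta_antimono)
qed

text \<open>Both the mesh \<delta> and the error e of the previous estimate are set to 1/(k+1);
  Fatou's lemma then removes them together.\<close>

lemma upper_integral_hausdorff_level_sets:
  fixes w :: "'a::euclidean_space \<Rightarrow> real" and W :: "'a \<Rightarrow> 'a"
  assumes dim: "DIM('a) = Suc N" "1 \<le> N"
    and der: "\<And>x. (w has_derivative (\<lambda>h. W x \<bullet> h)) (at x)" and cont: "continuous_on UNIV W"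
    and L: "\<And>x. norm (W x) \<le> L"
    and A: "A \<in> sets borel" "emeasure lborel A < \<infinity>"
  shows "upper_integral_le (\<lambda>t. hausdorff_outer (real N) (A \<inter> {y. w y = t}))
     (\<integral>\<^sup>+y\<in>A. ennreal (norm (W y)) \<partial>lborel)"
proof (rule upper_integral_le_mono[OF upper_integral_le_liminf])
  fix k
  show "upper_integral_le (\<lambda>t. hausdorff_delta (real N) (1 / real (Suc k)) (A \<inter> {y. w y = t}))
      ((\<integral>\<^sup>+y\<in>A. ennreal (norm (W y)) \<partial>lborel) + ennreal (1 / real (Suc k)))"
    by (rule upper_integral_hausdorff_delta_level_sets[OF dim der cont L A]) auto
next
  show "hausdorff_outer (real N) (A \<inter> {y. w y = t})
      \<le> liminf (\<lambda>k. hausdorff_delta (real N) (1 / real (Suc k)) (A \<inter> {y. w y = t}))" for t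
    by (rule hausdorff_outer_le_liminf)
next
  let ?I = "\<integral>\<^sup>+y\<in>A. ennreal (norm (W y)) \<partial>lborel"
  have "(\<lambda>k. ?I + ennreal (1 / real (Suc k))) \<longlonglongrightarrow> ?I + ennreal 0"
    by (intro tendsto_add tendsto_const tendsto_ennrealI LIMSEQ_inverse_real_of_nat[unfolded inverse_eq_divide])
  from lim_imp_Liminf[OF _ this]
  show "liminf (\<lambda>k. ?I + ennreal (1 / real (Suc k))) \<le> ?I" by simp
qed

text \<open>This half of the coarea formula needs neither rectifiability of the level sets
  nor the isodiametric inequality.\<close>
lemma coarea_le:
  fixes w :: "'a::euclidean_space \<Rightarrow> real" and W :: "'a \<Rightarrow> 'a"
  assumes dim: "DIM('a) = Suc N" "1 \<le> N"
    and der: "\<And>x. (w has_derivative (\<lambda>h. W x \<bullet> h)) (at x)" and cont: "continuous_on UNIV W"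
    and L: "\<And>x. norm (W x) \<le> L"
    and B: "B \<in> sets borel" "emeasure lborel B < \<infinity>"
    and f: "f \<in> borel_measurable borel"
  shows "upper_integral_le (\<lambda>t. \<integral>\<^sup>+x. f x * indicator (B \<inter> {y. w y = t}) x \<partial>hausdorff_measure (real N))
     (\<integral>\<^sup>+y. f y * (ennreal (norm (W y)) * indicator B y) \<partial>lborel)"
proof -
  have wm: "w \<in> borel_measurable borel"
    using der by (intro borel_measurable_continuous_onI) (meson continuous_at_imp_continuous_on has_derivative_continuous)
  have Wm [measurable]: "W \<in> borel_measurable borel" using cont by (rule borel_measurable_continuous_onI)
  have S: "B \<inter> {y. w y = t} \<in> sets borel" for t using B wm by measurable
  have Sm: "(\<lambda>x. indicator (B \<inter> {y. w y = t}) x :: ennreal) \<in> borel_measurable (hausdorff_measure (real N))" for t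
    using S[of t] by (intro borel_measurable_indicator) simp
  have Bm: "(\<lambda>y. ennreal (norm (W y)) * indicator B y) \<in> borel_measurable lborel"
    using B by measurable
  have fm: "g \<in> borel_measurable (hausdorff_measure (real N))" if "g \<in> borel_measurable borel" for g :: "'a \<Rightarrow> ennreal"
    using that by (simp cong: measurable_cong_sets)
  \<comment> \<open>The case of indicators is the level set bound for A \<inter> B. It extends to
    nonnegative Borel densities because \<open>upper_integral_le\<close> is stable under sums,
    multiples and lower limits, the last of which handles increasing sequences.\<close>
  show ?thesis
    using f
  proof (induction rule: borel_measurable_induct)
    case (cong f g)
    then have "f = g" by auto
    then show ?case using cong by simp
  next
    case (set A)
    have "upper_integral_le (\<lambda>t. hausdorff_outer (real N) ((A \<inter> B) \<inter> {y. w y = t}))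
       (\<integral>\<^sup>+y\<in>A \<inter> B. ennreal (norm (W y)) \<partial>lborel)"
    proof (rule upper_integral_hausdorff_level_sets[OF dim der cont L])
      show "A \<inter> B \<in> sets borel" using set B by simp
      have "emeasure lborel (A \<inter> B) \<le> emeasure lborel B" using B set by (intro emeasure_mono) auto
      then show "emeasure lborel (A \<inter> B) < \<infinity>" using B by (simp add: le_less_trans)
    qed
    then show ?case
    proof (rule upper_integral_le_mono)
      fix t
      have "(\<integral>\<^sup>+x. indicator A x * indicator (B \<inter> {y. w y = t}) x \<partial>hausdorff_measure (real N))
         = (\<integral>\<^sup>+x. indicator ((A \<inter> B) \<inter> {y. w y = t}) x \<partial>hausdorff_measure (real N))"
        by (intro nn_integral_cong) (auto simp: indicator_def)
      also have "\<dots> = emeasure (hausdorff_measure (real N)) ((A \<inter> B) \<inter> {y. w y = t})"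
        using set S[of t] by (intro nn_integral_indicator) (auto simp: Int_assoc)
      also have "\<dots> \<le> hausdorff_outer (real N) ((A \<inter> B) \<inter> {y. w y = t})"
        by (rule emeasure_hausdorff_measure_le)
      finally show "(\<integral>\<^sup>+x. indicator A x * indicator (B \<inter> {y. w y = t}) x \<partial>hausdorff_measure (real N)) \<le> \<dots>" .
      have "(\<integral>\<^sup>+y\<in>A \<inter> B. ennreal (norm (W y)) \<partial>lborel) = (\<integral>\<^sup>+y. indicator A y * (ennreal (norm (W y)) * indicator B y) \<partial>lborel)"
        by (intro nn_integral_cong) (auto simp: indicator_def)
      then show "(\<integral>\<^sup>+y\<in>A \<inter> B. ennreal (norm (W y)) \<partial>lborel) \<le> (\<integral>\<^sup>+y. indicator A y * (ennreal (norm (W y)) * indicator B y) \<partial>lborel)"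
        by simp
    qed
  next
    case (mult u c)
    have 1: "(\<integral>\<^sup>+x. c * u x * h x \<partial>M) = c * (\<integral>\<^sup>+x. u x * h x \<partial>M)"
      if "u \<in> borel_measurable M" "h \<in> borel_measurable M" for h :: "'a \<Rightarrow> ennreal" and M
      using that by (subst nn_integral_cmult[symmetric]) (auto simp: mult.assoc)
    have m: "u \<in> borel_measurable lborel" using mult(2) by simp
    show ?case
      using upper_integral_le_cmult[OF mult.IH, of c]
      unfolding 1[OF fm[OF mult(2)] Sm] 1[OF m Bm] .
  next
    case (add u v)
    have 1: "(\<integral>\<^sup>+x. (v x + u x) * h x \<partial>M) = (\<integral>\<^sup>+x. v x * h x \<partial>M) + (\<integral>\<^sup>+x. u x * h x \<partial>M)"
      if "u \<in> borel_measurable M" "v \<in> borel_measurable M" "h \<in> borel_measurable M" for h :: "'a \<Rightarrow> ennreal" and M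
      using that by (subst nn_integral_add[symmetric]) (auto simp: distrib_right)
    have m: "u \<in> borel_measurable lborel" "v \<in> borel_measurable lborel" using add(1,3) by simp_all
    from upper_integral_le_add[OF add.IH(2) add.IH(1)] show ?case
      unfolding 1[OF fm[OF add(1)] fm[OF add(3)] Sm] 1[OF m Bm] .
  next
    case (seq U)
    have mono: "incseq (\<lambda>i x. U i x * h x)" for h :: "'a \<Rightarrow> ennreal"
      using \<open>incseq U\<close> by (auto simp: incseq_def le_fun_def intro: mult_right_mono)
    have lim: "(\<integral>\<^sup>+x. (SUP i. U i) x * h x \<partial>M) = (SUP i. \<integral>\<^sup>+x. U i x * h x \<partial>M)"
      if "h \<in> borel_measurable M" "\<And>i. U i \<in> borel_measurable M" for M and h :: "'a \<Rightarrow> ennreal"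
      using that mono[of h] by (subst nn_integral_monotone_convergence_SUP[symmetric]) (auto simp: image_comp SUP_mult_right_ennreal)
    have incs: "incseq (\<lambda>i. \<integral>\<^sup>+x. U i x * h x \<partial>M)" for M and h :: "'a \<Rightarrow> ennreal"
      using mono[of h] by (auto simp: incseq_def le_fun_def intro: nn_integral_mono)
    have m: "U i \<in> borel_measurable lborel" for i using seq(1)[of i] by simp
    show ?case
    proof (rule upper_integral_le_mono[OF upper_integral_le_liminf[OF seq.IH]])
      fix t
      show "(\<integral>\<^sup>+x. (SUP i. U i) x * indicator (B \<inter> {y. w y = t}) x \<partial>hausdorff_measure (real N))
         \<le> liminf (\<lambda>k. \<integral>\<^sup>+x. U k x * indicator (B \<inter> {y. w y = t}) x \<partial>hausdorff_measure (real N))"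
        using LIMSEQ_SUP[OF incs, of "hausdorff_measure (real N)" "indicator (B \<inter> {y. w y = t})"]
        unfolding lim[OF Sm fm[OF seq(1)]] by (simp add: lim_imp_Liminf)
    next
      show "liminf (\<lambda>k. \<integral>\<^sup>+y. U k y * (ennreal (norm (W y)) * indicator B y) \<partial>lborel)
         \<le> (\<integral>\<^sup>+y. (SUP i. U i) y * (ennreal (norm (W y)) * indicator B y) \<partial>lborel)"
        using LIMSEQ_SUP[OF incs, of "lborel" "\<lambda>y. ennreal (norm (W y)) * indicator B y"]
        unfolding lim[OF Bm m] by (simp add: lim_imp_Liminf)
    qed
  qed
qed

section \<open>Sets of finite perimeter\<close>

text \<open>On the compact support the derivative in direction b is continuous; off it \<phi>
  vanishes on an open set and so does the derivative. The bound dominates the difference quotients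
  below.\<close>

lemma C1c_field_bounded_derivative:
  assumes "C1c_field \<phi> D"
  obtains B where "\<And>x. norm (D x b) \<le> B"
proof -
  let ?K = "closure {x. \<phi> x \<noteq> 0}"
  have der: "(\<phi> has_derivative D x) (at x)" and cont: "continuous_on UNIV (\<lambda>x. D x b)" and K: "compact ?K" for x
    using assms unfolding C1c_field_def by auto
  have "compact ((\<lambda>x. D x b) ` ?K)"
    by (rule compact_continuous_image[OF continuous_on_subset[OF cont] K]) simp
  then have "bounded ((\<lambda>x. D x b) ` ?K)" by (rule compact_imp_bounded)
  then obtain B where B: "\<And>x. x \<in> ?K \<Longrightarrow> norm (D x b) \<le> B"
    by (auto simp: bounded_iff)
  have zero: "\<phi> y = 0" if "y \<notin> ?K" for y using that closure_subset[of "{x. \<phi> x \<noteq> 0}"] by auto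
  have "norm (D x b) \<le> max B 0" for x
  proof (cases "x \<in> ?K")
    case True
    then show ?thesis using B[of x] by simp
  next
    case False
    have "((\<lambda>_. 0) has_derivative D x) (at x)"
    proof (rule has_derivative_transform_within_open[OF der])
      show "open (- ?K)" by (rule open_Compl) (rule closed_closure)
      show "x \<in> - ?K" using False by (simp only: Compl_iff simp_thms)
      show "\<phi> y = 0" if "y \<in> - ?K" for y using zero[of y] that by (simp only: Compl_iff simp_thms)
    qed
    then have "D x = (\<lambda>_. 0)" by (rule has_derivative_unique) simp
    then show ?thesis by simp
  qed
  then show thesis by (rule that)
qed

text \<open>A difference quotient of the indicator function tests the divergence in the limit, so
  it is enough to control the symmetric differences with small translates.\<close>
lemma finite_perimeter_translates:
  fixes E :: "'a::euclidean_space set"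
  assumes E: "E \<in> sets borel" "bounded E"
    and T: "\<And>e. 0 < e \<Longrightarrow> \<exists>h T. 0 < h \<and> h < e \<and> T \<in> sets borel \<and> emeasure lborel T \<le> ennreal (C * h) \<and>
              (\<forall>b\<in>Basis. \<forall>y. (y - h *\<^sub>R b \<in> E) \<noteq> (y \<in> E) \<longrightarrow> y \<in> T)"
    and C: "0 \<le> C"
  shows "finite_perimeter E"
  unfolding finite_perimeter_def
proof (intro conjI exI allI impI)
  show "E \<in> sets lebesgue" using E by simp
  have Efin: "emeasure lborel E < \<infinity>" using E(2) by (rule emeasure_bounded_finite)
  fix \<phi> :: "'a \<Rightarrow> 'a" and D :: "'a \<Rightarrow> 'a \<Rightarrow> 'a"
  assume asm: "C1c_field \<phi> D \<and> (\<forall>x. norm (\<phi> x) \<le> 1)"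
  then have der: "\<And>x. (\<phi> has_derivative D x) (at x)" and cont: "\<And>b. continuous_on UNIV (\<lambda>x. D x b)"
    and phi1: "\<And>x. norm (\<phi> x) \<le> 1"
    unfolding C1c_field_def by auto
  have [measurable]: "(\<lambda>x. D x b) \<in> borel_measurable borel" for b
    using cont by (rule borel_measurable_continuous_onI)
  have phic: "continuous_on UNIV \<phi>"
    using der by (meson continuous_at_imp_continuous_on has_derivative_continuous)
  have [measurable]: "\<phi> \<in> borel_measurable borel" using phic by (rule borel_measurable_continuous_onI)
  have [measurable]: "E \<in> sets borel" by fact
  obtain h T where h: "\<And>k::nat. 0 < h k" "\<And>k. h k < 1 / Suc k" and [measurable]: "\<And>k. T k \<in> sets borel"
    and Tm: "\<And>k. emeasure lborel (T k) \<le> ennreal (C * h k)"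
    and TE: "\<And>k b y. b \<in> Basis \<Longrightarrow> (y - h k *\<^sub>R b \<in> E) \<noteq> (y \<in> E) \<Longrightarrow> y \<in> T k"
  proof -
    have "\<forall>k. \<exists>h T. 0 < h \<and> h < 1 / Suc k \<and> T \<in> sets borel \<and> emeasure lborel T \<le> ennreal (C * h) \<and>
              (\<forall>b\<in>Basis. \<forall>y. (y - h *\<^sub>R b \<in> E) \<noteq> (y \<in> E) \<longrightarrow> y \<in> T)"
      using T by simp
    then obtain h T where "\<And>k. 0 < h k \<and> h k < 1 / Suc k \<and> T k \<in> sets borel \<and> emeasure lborel (T k) \<le> ennreal (C * h k) \<and>
              (\<forall>b\<in>Basis. \<forall>y. (y - h k *\<^sub>R b \<in> E) \<noteq> (y \<in> E) \<longrightarrow> y \<in> T k)" by metis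
    then show thesis by (intro that[of h T]) blast+
  qed
  have h0: "h \<longlonglongrightarrow> 0"
  proof (rule tendsto_sandwich[OF _ _ tendsto_const LIMSEQ_inverse_real_of_nat])
    show "\<forall>\<^sub>F k in sequentially. 0 \<le> h k" "\<forall>\<^sub>F k in sequentially. h k \<le> inverse (real (Suc k))"
      using h by (auto intro!: always_eventually less_imp_le simp: inverse_eq_divide)
  qed
  have intE: "integrable lborel (\<lambda>x. indicator E x * g x)"
    if [measurable]: "g \<in> borel_measurable borel" and "\<And>x. \<bar>g x\<bar> \<le> B" for g :: "'a \<Rightarrow> real" and B
  proof -
    have "integrable lborel (\<lambda>x. indicator E x *\<^sub>R g x)"
      by (rule integrableI_bounded_set_indicator[where B=B]) (use Efin that in auto)
    then show ?thesis by simp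
  qed
  have main: "(\<integral>x. indicator E x * (D x b \<bullet> b) \<partial>lborel) \<le> C" if b: "b \<in> Basis" for b
  proof -
    have nb: "norm b = 1" using b by simp
    define f where "f x = \<phi> x \<bullet> b" for x
    have [measurable]: "f \<in> borel_measurable borel" unfolding f_def by measurable
    have f1: "\<bar>f x\<bar> \<le> 1" for x
      unfolding f_def using Cauchy_Schwarz_ineq2[of "\<phi> x" b] phi1[of x] nb by simp
    obtain B where B: "\<And>x. norm (D x b) \<le> B"
      using C1c_field_bounded_derivative asm by blast
    have DB: "\<bar>D x b \<bullet> b\<bar> \<le> B" for x
      using Cauchy_Schwarz_ineq2[of "D x b" b] B[of x] nb by simp
    have fd: "((\<lambda>s. f (x + s *\<^sub>R b)) has_field_derivative (D (x + s *\<^sub>R b) b \<bullet> b)) (at s)" for x s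
    proof -
      have lin: "linear (D y)" for y using der[of y] has_derivative_linear by blast
      have "((\<lambda>s. \<phi> (x + s *\<^sub>R b) \<bullet> b) has_derivative (\<lambda>t. D (x + s *\<^sub>R b) (t *\<^sub>R b) \<bullet> b)) (at s)"
        by (rule derivative_eq_intros has_derivative_compose[of "\<lambda>s. x + s *\<^sub>R b", OF _ der] refl | simp)+
      then show ?thesis unfolding f_def has_field_derivative_def
        by (simp add: linear_cmul[OF lin] mult_commute_abs)
    qed
    define q where "q k x = (f (x + h k *\<^sub>R b) - f x) / h k" for k x
    have [measurable]: "q k \<in> borel_measurable borel" for k unfolding q_def by measurable
    have qlim: "(\<lambda>k. q k x) \<longlonglongrightarrow> D x b \<bullet> b" for x
    proof -
      have "((\<lambda>s. (f (x + s *\<^sub>R b) - f x) / s) \<longlongrightarrow> D x b \<bullet> b) (at 0)"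
        using fd[of x 0] by (simp add: DERIV_def)
      moreover have "filterlim h (at 0) sequentially"
        using h0 h(1) by (auto simp: filterlim_at less_imp_neq[THEN not_sym] intro!: always_eventually)
      ultimately show ?thesis unfolding q_def by (rule filterlim_compose)
    qed
    have qB: "\<bar>q k x\<bar> \<le> B" for k x
    proof -
      obtain z where "f (x + h k *\<^sub>R b) - f (x + 0 *\<^sub>R b) = (h k - 0) * (D (x + z *\<^sub>R b) b \<bullet> b)"
        using MVT2[of 0 "h k" "\<lambda>s. f (x + s *\<^sub>R b)" "\<lambda>s. D (x + s *\<^sub>R b) b \<bullet> b"] h(1)[of k] fd by blast
      then have "q k x = D (x + z *\<^sub>R b) b \<bullet> b" using h(1)[of k] by (simp add: q_def)
      then show ?thesis using DB by simp
    qed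
    have "(\<lambda>k. \<integral>x. indicator E x * q k x \<partial>lborel) \<longlonglongrightarrow> (\<integral>x. indicator E x * (D x b \<bullet> b) \<partial>lborel)"
    proof (rule integral_dominated_convergence[where w="\<lambda>x. indicator E x * B"])
      show "integrable lborel (\<lambda>x. indicator E x * B)" by (rule intE[of _ "\<bar>B\<bar>"]) auto
      show "AE x in lborel. (\<lambda>k. indicator E x * q k x) \<longlonglongrightarrow> indicator E x * (D x b \<bullet> b)"
        by (intro AE_I2 tendsto_mult tendsto_const qlim)
      show "AE x in lborel. norm (indicator E x * q k x) \<le> indicator E x * B" for k
        using qB[of k] by (intro AE_I2) (auto simp: indicator_def)
    qed measurable
    \<comment> \<open>A translation by h k moves the difference from f to the indicator of E, which
      changes only on T k. As |f| \<le> 1, the integral of the difference is at most |T k| \<le> C *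
      h k, and dividing by h k leaves C.\<close>
    moreover have "(\<integral>x. indicator E x * q k x \<partial>lborel) \<le> C" for k
    proof -
      have i1: "integrable lborel (\<lambda>x. indicator E x * f (x + h k *\<^sub>R b))"
        by (rule intE[of _ 1]) (use f1 in auto)
      have i2: "integrable lborel (\<lambda>x. indicator E x * f x)"
        by (rule intE[of _ 1]) (use f1 in auto)
      have dist: "distr lborel borel (\<lambda>x. h k *\<^sub>R b + x) = (lborel :: 'a measure)"
        by (rule lborel_distr_plus)
      have eq: "(\<integral>x. indicator E x * f (x + h k *\<^sub>R b) \<partial>lborel)
          = (\<integral>y. indicator E (y - h k *\<^sub>R b) * f y \<partial>lborel)"
        by (subst (2) dist[symmetric], subst integral_distr) (auto simp: add.commute)
      have i3: "integrable lborel (\<lambda>y. indicator E (y - h k *\<^sub>R b) * f y)"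
        by (subst dist[symmetric], subst integrable_distr_eq) (use i1 in \<open>auto simp: add.commute\<close>)
      have Tfin: "emeasure lborel (T k) < \<infinity>" using le_less_trans[OF Tm[of k] ennreal_less_top] by simp
      have "(\<integral>y. indicator E (y - h k *\<^sub>R b) * f y - indicator E y * f y \<partial>lborel) \<le> (\<integral>y. indicator (T k) y \<partial>lborel)"
      proof (rule integral_mono)
        show "integrable lborel (\<lambda>y. indicator E (y - h k *\<^sub>R b) * f y - indicator E y * f y)"
          using i2 i3 by auto
        show "integrable lborel (indicator (T k) :: 'a \<Rightarrow> real)"
          using Tfin by (intro integrable_real_indicator) auto
        fix y
        show "indicator E (y - h k *\<^sub>R b) * f y - indicator E y * f y \<le> indicator (T k) y"
          using TE[OF b, of y k] f1[of y] by (auto simp: indicator_def abs_le_iff)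
      qed
      also have "(\<integral>y. indicator (T k) y \<partial>lborel) \<le> C * h k"
        using Tm[of k] C h(1)[of k] Tfin
        by (simp add: measure_def enn2real_leI)
      finally have le: "(\<integral>y. indicator E (y - h k *\<^sub>R b) * f y - indicator E y * f y \<partial>lborel) \<le> C * h k" .
      have "(\<integral>x. indicator E x * q k x \<partial>lborel)
         = ((\<integral>x. indicator E x * f (x + h k *\<^sub>R b) \<partial>lborel) - (\<integral>x. indicator E x * f x \<partial>lborel)) / h k"
      proof -
        have "indicator E x * q k x = (indicator E x * f (x + h k *\<^sub>R b) - indicator E x * f x) / h k" for x
          by (simp add: q_def right_diff_distrib diff_divide_distrib)
        then show ?thesis by (simp only: integral_divide_zero Bochner_Integration.integral_diff[OF i1 i2])
      qed
      also have "\<dots> = (\<integral>y. indicator E (y - h k *\<^sub>R b) * f y - indicator E y * f y \<partial>lborel) / h k"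
        unfolding eq by (simp only: Bochner_Integration.integral_diff[OF i3 i2])
      finally show ?thesis using le h(1)[of k] by (simp add: divide_le_eq)
    qed
    ultimately show ?thesis using LIMSEQ_le_const2 by blast
  qed
  have "(LINT x|lebesgue_on E. divergence D x) = (LINT x|lebesgue. indicator E x *\<^sub>R divergence D x)"
    by (rule integral_restrict_space) simp
  also have "\<dots> = (\<integral>x. indicator E x *\<^sub>R divergence D x \<partial>lborel)"
    unfolding divergence_def by (rule integral_completion) measurable
  also have "\<dots> = (\<integral>x. (\<Sum>b\<in>Basis. indicator E x * (D x b \<bullet> b)) \<partial>lborel)"
    by (simp add: divergence_def sum_distrib_left)
  also have "\<dots> = (\<Sum>b\<in>Basis. \<integral>x. indicator E x * (D x b \<bullet> b) \<partial>lborel)"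
  proof (rule Bochner_Integration.integral_sum)
    fix b :: 'a assume b: "b \<in> Basis"
    obtain B where B: "\<And>x. norm (D x b) \<le> B"
      using C1c_field_bounded_derivative asm by blast
    show "integrable lborel (\<lambda>x. indicator E x * (D x b \<bullet> b))"
    proof (rule intE)
      show "\<bar>D x b \<bullet> b\<bar> \<le> B" for x
        using Cauchy_Schwarz_ineq2[of "D x b" b] B[of x] b by simp
    qed measurable
  qed
  also have "\<dots> \<le> (\<Sum>b\<in>(Basis::'a set). C)" by (rule sum_mono) (rule main)
  finally show "(LINT x|lebesgue_on E. divergence D x) \<le> real DIM('a) * C" by simp
qed

section \<open>Slabs and the tube around the boundary\<close>

text \<open>A packing argument: moving the slab by 3*d*j along e shifts the values of f by 3*d*j, so
  these translates are disjoint, and floor(l/(3*d)) of them fit into the larger ball. Since 3*d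
  \<le> l, this number is at least l/(6*d), which explains the 6. The lemma is used for a graph over
  the hyperplane orthogonal to e and for a tangent plane.\<close>

lemma emeasure_slab_le:
  fixes f :: "'a::euclidean_space \<Rightarrow> real"
  assumes [measurable]: "f \<in> borel_measurable borel"
    and e: "norm e = 1" and f: "\<And>x s. f (x + s *\<^sub>R e) = f x + s" and d: "0 < d" "3 * d \<le> l"
  shows "emeasure lborel {x \<in> ball a r. \<bar>f x\<bar> \<le> d} \<le> ennreal (6 * d / l * measure lborel (ball a (r + l)))"
proof -
  define S where "S = {x \<in> ball a r. \<bar>f x\<bar> \<le> d}"
  have [measurable]: "S \<in> sets borel" unfolding S_def by measurable
  have Sb: "bounded S" unfolding S_def by (rule bounded_subset[OF bounded_ball]) auto
  define m M where "m = measure lborel S" and "M = measure lborel (ball a (r + l))"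
  have Sfin: "emeasure lborel S = ennreal m"
    unfolding m_def by (rule emeasure_eq_ennreal_measure)
      (use emeasure_bounded_finite[OF Sb] in auto)
  have Mfin: "emeasure lborel (ball a (r + l)) = ennreal M"
    unfolding M_def by (rule emeasure_eq_ennreal_measure) (use emeasure_bounded_finite[of "ball a (r+l)"] in auto)
  define N where "N = nat \<lfloor>l / (3 * d)\<rfloor>"
  have x1: "1 \<le> l / (3 * d)" using d by (simp add: field_simps)
  have N1: "real N \<le> l / (3 * d)" using x1 unfolding N_def by linarith
  have N2: "l / (6 * d) \<le> real N"
  proof -
    define y where "y = l / (6 * d)"
    have y: "l / (3 * d) = 2 * y" by (simp add: y_def)
    have "1 \<le> \<lfloor>2 * y\<rfloor>" using x1 y by simp
    then have "real N = of_int \<lfloor>2 * y\<rfloor>" "1 \<le> real_of_int \<lfloor>2 * y\<rfloor>" unfolding N_def y by simp_all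
    then show ?thesis unfolding y_def[symmetric] by linarith
  qed
  define T where "T j = {x. x - (3 * d * real j) *\<^sub>R e \<in> S}" for j :: nat
  have Tm [measurable]: "T j \<in> sets borel" for j unfolding T_def by measurable
  have Te: "emeasure lborel (T j) = ennreal m" for j
  proof -
    have "emeasure lborel S = emeasure (distr lborel borel (\<lambda>x. - ((3 * d * real j) *\<^sub>R e) + x)) S"
      by (simp only: lborel_distr_plus)
    also have "\<dots> = emeasure lborel (T j)"
      by (subst emeasure_distr) (auto simp: T_def vimage_def)
    finally show ?thesis using Sfin by simp
  qed
  have fT: "\<bar>f x - 3 * d * real j\<bar> \<le> d" if "x \<in> T j" for x j
    using that f[of x "- (3 * d * real j)"] by (simp add: T_def S_def)
  have disj: "disjoint_family_on T {..<N}"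
    unfolding disjoint_family_on_def
  proof (intro ballI impI)
    fix i j assume ij: "i \<in> {..<N}" "j \<in> {..<N}" "i \<noteq> j"
    show "T i \<inter> T j = {}"
    proof (rule ccontr)
      assume "T i \<inter> T j \<noteq> {}"
      then obtain x where "\<bar>f x - 3 * d * real i\<bar> \<le> d" "\<bar>f x - 3 * d * real j\<bar> \<le> d" using fT by blast
      then have "\<bar>3 * d * real i - 3 * d * real j\<bar> \<le> 2 * d" by linarith
      then have "3 * d * \<bar>real i - real j\<bar> \<le> 2 * d"
        using d by (simp add: abs_mult flip: right_diff_distrib)
      moreover have "1 \<le> \<bar>real i - real j\<bar>" using ij by linarith
      then have "3 * d * 1 \<le> 3 * d * \<bar>real i - real j\<bar>" using d by (intro mult_left_mono) auto
      ultimately show False using d by linarith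
    qed
  qed
  have sub: "(\<Union>j<N. T j) \<subseteq> ball a (r + l)"
  proof
    fix x assume "x \<in> (\<Union>j<N. T j)"
    then obtain j where j: "j < N" "x - (3 * d * real j) *\<^sub>R e \<in> ball a r" by (auto simp: T_def S_def)
    have "3 * d * real j \<le> 3 * d * (l / (3 * d))" using j N1 d by (intro mult_left_mono) auto
    then have 1: "3 * d * real j \<le> l" using d by simp
    have "dist a x \<le> dist a (x - (3 * d * real j) *\<^sub>R e) + norm ((3 * d * real j) *\<^sub>R e)"
      using norm_triangle_ineq4[of "a - (x - (3 * d * real j) *\<^sub>R e)" "(3 * d * real j) *\<^sub>R e"]
      by (simp add: dist_norm)
    then show "x \<in> ball a (r + l)" using j 1 d e by simp
  qed
  have "ennreal (real N * m) = (\<Sum>j<N. emeasure lborel (T j))"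
    by (simp add: Te m_def ennreal_mult ennreal_of_nat_eq_real_of_nat)
  also have "\<dots> = emeasure lborel (\<Union>j<N. T j)"
    by (rule sum_emeasure) (use disj in auto)
  also have "\<dots> \<le> emeasure lborel (ball a (r + l))" by (rule emeasure_mono[OF sub]) simp
  finally have "real N * m \<le> M" by (simp add: Mfin M_def)
  moreover have "l / (6 * d) * m \<le> real N * m" using N2 by (intro mult_right_mono) (auto simp: m_def)
  ultimately have "l / (6 * d) * m \<le> M" by linarith
  moreover have "0 < l" using d by simp
  ultimately have "m \<le> 6 * d / l * M" using d by (simp add: field_simps)
  then show ?thesis unfolding S_def[symmetric] Sfin M_def[symmetric] by (rule ennreal_leI)
qed

lemma graph_function_translate:
  fixes e :: "'a::real_inner"
  assumes e: "norm e = 1" and inv: "\<forall>y. \<gamma> y = \<gamma> (y - (y \<bullet> e) *\<^sub>R e)"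
  shows "\<gamma> (y + s *\<^sub>R e) = \<gamma> y"
proof -
  have "(y + s *\<^sub>R e) - ((y + s *\<^sub>R e) \<bullet> e) *\<^sub>R e = y - (y \<bullet> e) *\<^sub>R e"
    using e by (simp add: inner_add_left dot_square_norm scaleR_add_left)
  then show ?thesis using inv by metis
qed

text \<open>A frontier point of an open set does not belong to it, so it cannot lie below the graph;
  strictly above the graph it would have a neighbourhood that misses \<Omega>.\<close>

lemma frontier_graph:
  fixes \<Omega> :: "'a::euclidean_space set"
  assumes op: "open \<Omega>" and z: "z \<in> frontier \<Omega>" "z \<in> ball x0 r" and g: "continuous_on UNIV \<gamma>"
    and eq: "\<Omega> \<inter> ball x0 r = {x \<in> ball x0 r. x \<bullet> e < \<gamma> x}"
  shows "z \<bullet> e = \<gamma> z"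
proof (rule ccontr)
  assume ne: "z \<bullet> e \<noteq> \<gamma> z"
  have zn: "z \<notin> \<Omega>" using z op by (simp add: frontier_def interior_open)
  then have gt: "\<gamma> z < z \<bullet> e" using ne z eq by force
  have "open ({x. \<gamma> x < x \<bullet> e} \<inter> ball x0 r)"
    using g by (intro open_Int open_Collect_less) (auto intro!: continuous_intros)
  moreover have "z \<in> {x. \<gamma> x < x \<bullet> e} \<inter> ball x0 r" using gt z by simp
  moreover have "({x. \<gamma> x < x \<bullet> e} \<inter> ball x0 r) \<inter> \<Omega> = {}" using eq by force
  ultimately have "z \<notin> closure \<Omega>" using closure_iff_nhds_not_empty by blast
  then show False using z by (simp add: frontier_def)
qed

text \<open>Moving by h from a frontier point changes x \<bullet> e by at most h and \<gamma> by at
  most B*h, where B bounds the gradient of \<gamma> on the chart ball. So the tube lies in a slab of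
  half-width (1 + B)*h around the graph. Halving the radius of the chart keeps the moved points
  inside it; h < 1/(3*K) is what \<open>emeasure_slab_le\<close> requires with l = 1.\<close>

lemma frontier_tube_local:
  fixes \<Omega> :: "'a::euclidean_space set"
  assumes op: "open \<Omega>" and bd: "C1alpha_boundary \<alpha> \<Omega>" and x0: "x0 \<in> frontier \<Omega>"
  shows "\<exists>r C h0. 0 < r \<and> 0 \<le> C \<and> 0 < h0 \<and> (\<forall>h. 0 < h \<and> h < h0 \<longrightarrow>
     (\<exists>T\<in>sets borel. emeasure lborel T \<le> ennreal (C * h) \<and>
        (\<forall>z\<in>frontier \<Omega> \<inter> ball x0 r. \<forall>x. dist x z \<le> h \<longrightarrow> x \<in> T)))"
proof -
  obtain r e \<gamma> G where r: "0 < r" and e: "norm e = 1" and inv: "\<forall>y. \<gamma> y = \<gamma> (y - (y \<bullet> e) *\<^sub>R e)"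
    and der: "\<And>y. (\<gamma> has_derivative (\<lambda>h. G y \<bullet> h)) (at y)" and Gc: "continuous_on UNIV G"
    and eq: "\<Omega> \<inter> ball x0 r = {x \<in> ball x0 r. x \<bullet> e < \<gamma> x}"
    using bd x0 unfolding C1alpha_boundary_def by meson
  have gc: "continuous_on UNIV \<gamma>"
    using der by (meson continuous_at_imp_continuous_on has_derivative_continuous)
  have [measurable]: "\<gamma> \<in> borel_measurable borel" using gc by (rule borel_measurable_continuous_onI)
  have ee: "e \<bullet> e = 1" using e by (simp add: dot_square_norm)
  note invs = graph_function_translate[OF e inv]
  have "compact (G ` cball x0 r)" by (rule compact_continuous_image[OF continuous_on_subset[OF Gc]]) auto
  then have "bounded (G ` cball x0 r)" by (rule compact_imp_bounded)
  then obtain B where "\<forall>x\<in>cball x0 r. norm (G x) \<le> B"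
    unfolding bounded_iff by blast
  then have B: "norm (G x) \<le> B" if "x \<in> cball x0 r" for x using that by blast
  have B0: "0 \<le> B" using order_trans[OF norm_ge_zero B[of x0]] r by simp
  have lip: "\<bar>\<gamma> x - \<gamma> y\<bar> \<le> B * norm (x - y)" if "x \<in> ball x0 r" "y \<in> ball x0 r" for x y
    by (rule gradient_bound_imp_lipschitz[OF convex_ball der]) (use that B in auto)
  define K where "K = 1 + B"
  have K: "0 < K" using B0 by (simp add: K_def)
  define M where "M = measure lborel (ball x0 (r + 1))"
  have "\<exists>T\<in>sets borel. emeasure lborel T \<le> ennreal (6 * K * M * h) \<and>
        (\<forall>z\<in>frontier \<Omega> \<inter> ball x0 (r / 2). \<forall>x. dist x z \<le> h \<longrightarrow> x \<in> T)"
    if h: "0 < h" "h < min (r / 2) (1 / (3 * K))" for h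
  proof -
    define T where "T = {x \<in> ball x0 r. \<bar>x \<bullet> e - \<gamma> x\<bar> \<le> K * h}"
    have "T \<in> sets borel" unfolding T_def by measurable
    moreover have "emeasure lborel T \<le> ennreal (6 * (K * h) / 1 * M)"
      unfolding T_def M_def
    proof (rule emeasure_slab_le[OF _ e])
      show "(\<lambda>x. x \<bullet> e - \<gamma> x) \<in> borel_measurable borel" by measurable
      show "(x + s *\<^sub>R e) \<bullet> e - \<gamma> (x + s *\<^sub>R e) = x \<bullet> e - \<gamma> x + s" for x s
        by (simp add: invs inner_add_left ee)
      show "0 < K * h" "3 * (K * h) \<le> 1" using h K by (auto simp: field_simps)
    qed
    moreover have "x \<in> T" if z: "z \<in> frontier \<Omega> \<inter> ball x0 (r / 2)" and xz: "dist x z \<le> h" for x z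
    proof -
      have zb: "z \<in> ball x0 r" using z r by auto
      have "dist x0 x \<le> dist x0 z + dist x z" by (metis dist_commute dist_triangle)
      then have xb: "x \<in> ball x0 r" using z xz h by auto
      have "z \<bullet> e = \<gamma> z" by (rule frontier_graph[OF op _ zb gc eq]) (use z in simp)
      moreover have "\<bar>(x - z) \<bullet> e\<bar> \<le> h"
        using Cauchy_Schwarz_ineq2[of "x - z" e] e xz by (simp add: dist_norm)
      moreover have "\<bar>\<gamma> x - \<gamma> z\<bar> \<le> B * h"
        using lip[OF xb zb] mult_left_mono[OF xz B0] by (simp add: dist_norm)
      ultimately have "\<bar>x \<bullet> e - \<gamma> x\<bar> \<le> K * h"
        unfolding K_def by (simp add: inner_diff_left distrib_right abs_le_iff)
      then show ?thesis using xb by (simp add: T_def)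
    qed
    ultimately show ?thesis by (intro bexI[of _ T]) (auto simp: mult_ac)
  qed
  then show ?thesis
    using r K by (intro exI[of _ "r / 2"] exI[of _ "6 * K * M"] exI[of _ "min (r / 2) (1 / (3 * K))"] conjI)
      (auto simp: M_def)
qed

lemma frontier_tube:
  fixes \<Omega> :: "'a::euclidean_space set"
  assumes op: "open \<Omega>" and bdd: "bounded \<Omega>" and bd: "C1alpha_boundary \<alpha> \<Omega>"
  obtains C h0 where "0 \<le> C" "0 < h0"
    "\<And>h. 0 < h \<Longrightarrow> h < h0 \<Longrightarrow> \<exists>T\<in>sets borel. emeasure lborel T \<le> ennreal (C * h) \<and>
        (\<forall>z\<in>frontier \<Omega>. \<forall>x. dist x z \<le> h \<longrightarrow> x \<in> T)"
proof -
  define P where "P x0 r C h0 \<longleftrightarrow> (\<forall>h. 0 < h \<and> h < h0 \<longrightarrow>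
     (\<exists>T\<in>sets borel. emeasure lborel T \<le> ennreal (C * h) \<and>
        (\<forall>z\<in>frontier \<Omega> \<inter> ball x0 r. \<forall>x. dist x z \<le> h \<longrightarrow> x \<in> T)))" for x0 r C h0
  have "\<forall>x0\<in>frontier \<Omega>. \<exists>r C h0. 0 < r \<and> 0 \<le> C \<and> 0 < h0 \<and> P x0 r C h0"
    unfolding P_def using frontier_tube_local[OF op bd] by blast
  then obtain r C h0 where P: "\<And>x0. x0 \<in> frontier \<Omega> \<Longrightarrow> 0 < r x0 \<and> 0 \<le> C x0 \<and> 0 < h0 x0 \<and> P x0 (r x0) (C x0) (h0 x0)"
    by metis
  have "compact (frontier \<Omega>)" using bdd by (rule compact_frontier_bounded)
  then obtain F where F: "F \<subseteq> frontier \<Omega>" "finite F" "frontier \<Omega> \<subseteq> (\<Union>x\<in>F. ball x (r x))"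
    by (rule compactE_image[of _ "frontier \<Omega>" "\<lambda>x. ball x (r x)"]) (use P in auto)
  show thesis
  proof (rule that[of "\<Sum>x\<in>F. C x" "Min (insert 1 (h0 ` F))"])
    show "0 \<le> (\<Sum>x\<in>F. C x)" using F P by (intro sum_nonneg) auto
    show "0 < Min (insert 1 (h0 ` F))" using F P by auto
    fix h assume h: "0 < h" "h < Min (insert 1 (h0 ` F))"
    have "\<forall>x0\<in>F. \<exists>T\<in>sets borel. emeasure lborel T \<le> ennreal (C x0 * h) \<and>
        (\<forall>z\<in>frontier \<Omega> \<inter> ball x0 (r x0). \<forall>x. dist x z \<le> h \<longrightarrow> x \<in> T)"
    proof
      fix x0 assume x0: "x0 \<in> F"
      then have "h < h0 x0" using h F by auto
      then show "\<exists>T\<in>sets borel. emeasure lborel T \<le> ennreal (C x0 * h) \<and>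
        (\<forall>z\<in>frontier \<Omega> \<inter> ball x0 (r x0). \<forall>x. dist x z \<le> h \<longrightarrow> x \<in> T)" using P[of x0] F x0 h unfolding P_def by blast
    qed
    then obtain T where T: "\<And>x0. x0 \<in> F \<Longrightarrow> T x0 \<in> sets borel \<and> emeasure lborel (T x0) \<le> ennreal (C x0 * h) \<and>
        (\<forall>z\<in>frontier \<Omega> \<inter> ball x0 (r x0). \<forall>x. dist x z \<le> h \<longrightarrow> x \<in> T x0)" by metis
    show "\<exists>T\<in>sets borel. emeasure lborel T \<le> ennreal ((\<Sum>x\<in>F. C x) * h) \<and>
        (\<forall>z\<in>frontier \<Omega>. \<forall>x. dist x z \<le> h \<longrightarrow> x \<in> T)"
    proof (intro bexI[of _ "\<Union>x0\<in>F. T x0"] conjI ballI allI impI)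
      have "emeasure lborel (\<Union>x0\<in>F. T x0) \<le> (\<Sum>x0\<in>F. emeasure lborel (T x0))"
        by (rule emeasure_subadditive_finite) (use F T in auto)
      also have "\<dots> \<le> (\<Sum>x0\<in>F. ennreal (C x0 * h))" by (rule sum_mono) (use T in auto)
      also have "\<dots> = ennreal ((\<Sum>x\<in>F. C x) * h)"
        using F P h by (subst sum_ennreal) (auto simp: sum_distrib_right)
      finally show "emeasure lborel (\<Union>x0\<in>F. T x0) \<le> ennreal ((\<Sum>x\<in>F. C x) * h)" .
      show "(\<Union>x0\<in>F. T x0) \<in> sets borel" using F T by auto
      fix z x assume "z \<in> frontier \<Omega>" "dist x z \<le> h"
      then show "x \<in> (\<Union>x0\<in>F. T x0)" using F T by blast
    qed
  qed
qed

section \<open>Superlevel sets of Lipschitz functions\<close>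

text \<open>By Tonelli the strip around level t has measure of total integral 2*L*|A|/(k+1) over t.
  After scaling by k+1 the integrals are constant in k, so by Fatou the lower limit is integrable
  and therefore finite almost everywhere.\<close>

lemma AE_liminf_level_strip_finite:
  fixes w :: "'a::euclidean_space \<Rightarrow> real"
  assumes [measurable]: "A \<in> sets borel" "w \<in> borel_measurable borel"
    and A: "emeasure lborel A < \<infinity>" and L: "0 \<le> L"
  shows "AE t in lborel. liminf (\<lambda>k. ennreal (real (Suc k)) *
      emeasure lborel {y \<in> A. \<bar>w y - t\<bar> \<le> L * (1 / real (Suc k))}) \<noteq> \<infinity>"
proof -
  define m where "m k t = emeasure lborel {y \<in> A. \<bar>w y - t\<bar> \<le> L * (1 / real (Suc k))}" for k t
  have m_eq: "m k t = (\<integral>\<^sup>+y. indicator {(t, y). y \<in> A \<and> \<bar>w y - t\<bar> \<le> L * (1 / real (Suc k))} (t, y) \<partial>lborel)" for k t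
  proof -
    have "m k t = (\<integral>\<^sup>+y. indicator {y \<in> A. \<bar>w y - t\<bar> \<le> L * (1 / real (Suc k))} y \<partial>lborel)"
      unfolding m_def by (rule nn_integral_indicator[symmetric]) measurable
    also have "\<dots> = (\<integral>\<^sup>+y. indicator {(t, y). y \<in> A \<and> \<bar>w y - t\<bar> \<le> L * (1 / real (Suc k))} (t, y) \<partial>lborel)"
      by (intro nn_integral_cong) (auto simp: indicator_def)
    finally show ?thesis .
  qed
  have S: "{(t, y). y \<in> A \<and> \<bar>w y - t\<bar> \<le> L * (1 / real (Suc k))} \<in> sets (lborel \<Otimes>\<^sub>M lborel)" for k
  proof -
    have "{p \<in> space (lborel \<Otimes>\<^sub>M (lborel :: 'a measure)). snd p \<in> A \<and> \<bar>w (snd p) - fst p\<bar> \<le> L * (1 / real (Suc k))}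
       \<in> sets (lborel \<Otimes>\<^sub>M lborel)" by measurable
    then show ?thesis by (simp add: split_def space_pair_measure)
  qed
  have mm [measurable]: "m k \<in> borel_measurable lborel" for k
    unfolding m_eq[abs_def] using S[of k]
    by (intro lborel.borel_measurable_nn_integral) (simp add: split_def)
  have Im: "(\<integral>\<^sup>+t. m k t \<partial>lborel) = ennreal (2 * L * (1 / real (Suc k))) * emeasure lborel A" for k
  proof -
    let ?d = "L * (1 / real (Suc k))"
    have d: "0 \<le> ?d" using L by simp
    have "(\<integral>\<^sup>+t. m k t \<partial>lborel) = (\<integral>\<^sup>+y. \<integral>\<^sup>+t. indicator {(t, y). y \<in> A \<and> \<bar>w y - t\<bar> \<le> ?d} (t, y) \<partial>lborel \<partial>lborel)"
      unfolding m_eq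
      by (rule lborel_pair.Fubini'[symmetric]) (use S[of k] in \<open>simp add: split_def\<close>)
    also have "\<dots> = (\<integral>\<^sup>+y. ennreal (2 * ?d) * indicator A y \<partial>lborel)"
    proof (rule nn_integral_cong)
      fix y
      have "(\<integral>\<^sup>+t. indicator {(t, y). y \<in> A \<and> \<bar>w y - t\<bar> \<le> ?d} (t, y) \<partial>lborel)
          = (\<integral>\<^sup>+t. indicator A y * indicator {w y - ?d..w y + ?d} t \<partial>lborel)"
        by (intro nn_integral_cong) (auto simp: indicator_def abs_le_iff)
      also have "\<dots> = indicator A y * ennreal (2 * ?d)"
        using d by (subst nn_integral_cmult) auto
      finally show "(\<integral>\<^sup>+t. indicator {(t, y). y \<in> A \<and> \<bar>w y - t\<bar> \<le> ?d} (t, y) \<partial>lborel) = ennreal (2 * ?d) * indicator A y"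
        by (simp add: mult.commute)
    qed
    also have "\<dots> = ennreal (2 * ?d) * emeasure lborel A" by (rule nn_integral_cmult_indicator) simp
    finally show ?thesis by simp
  qed
  have "(\<integral>\<^sup>+t. liminf (\<lambda>k. ennreal (real (Suc k)) * m k t) \<partial>lborel)
     \<le> liminf (\<lambda>k. \<integral>\<^sup>+t. ennreal (real (Suc k)) * m k t \<partial>lborel)"
    by (rule nn_integral_liminf) measurable
  also have "(\<lambda>k. \<integral>\<^sup>+t. ennreal (real (Suc k)) * m k t \<partial>lborel) = (\<lambda>k. ennreal (2 * L) * emeasure lborel A)"
  proof
    fix k
    have "(\<integral>\<^sup>+t. ennreal (real (Suc k)) * m k t \<partial>lborel) = ennreal (real (Suc k)) * (ennreal (2 * L * (1 / real (Suc k))) * emeasure lborel A)"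
      by (simp only: nn_integral_cmult[OF mm] Im)
    also have "\<dots> = ennreal (real (Suc k) * (2 * L * (1 / real (Suc k)))) * emeasure lborel A"
      using L by (subst ennreal_mult) (auto simp: mult.assoc)
    finally show "(\<integral>\<^sup>+t. ennreal (real (Suc k)) * m k t \<partial>lborel) = ennreal (2 * L) * emeasure lborel A"
      by simp
  qed
  also have "liminf (\<lambda>k::nat. ennreal (2 * L) * emeasure lborel A) < \<infinity>"
    using A by (simp add: Liminf_const ennreal_mult_less_top)
  finally have "(\<integral>\<^sup>+t. liminf (\<lambda>k. ennreal (real (Suc k)) * m k t) \<partial>lborel) \<noteq> \<infinity>" by simp
  then show ?thesis unfolding m_def[symmetric] by (intro nn_integral_PInf_AE) measurable
qed

text \<open>If a translation by h changes membership of y, there are two cases. Either both points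
  are in \<Omega> and w crosses level t between them, so |w y - t| \<le> L*h; or exactly one is in
  \<Omega>, the segment between them meets the frontier, and y is in the tube. Both sets have
  measure O(h), the strip only along a subsequence; for this reason
  \<open>finite_perimeter_translates\<close> asks for arbitrarily small h rather than for all small
  h.\<close>

lemma AE_finite_perimeter_level_sets:
  fixes \<Omega> :: "'a::euclidean_space set" and w :: "'a \<Rightarrow> real"
  assumes op: "open \<Omega>" and bdd: "bounded \<Omega>" and bd: "C1alpha_boundary \<alpha> \<Omega>" and L: "0 \<le> L"
    and lip: "\<And>x y. \<bar>w x - w y\<bar> \<le> L * norm (x - y)"
    and wc: "continuous_on UNIV w"
  shows "AE t in lborel. finite_perimeter {x \<in> \<Omega>. t < w x}"
proof -
  have [measurable]: "w \<in> borel_measurable borel" using wc by (rule borel_measurable_continuous_onI)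
  have [measurable]: "\<Omega> \<in> sets borel" using op by simp
  have fin: "emeasure lborel \<Omega> < \<infinity>" using bdd by (rule emeasure_bounded_finite)
  obtain C h0 where C: "0 \<le> C" "0 < h0"
    "\<And>h. 0 < h \<Longrightarrow> h < h0 \<Longrightarrow> \<exists>T\<in>sets borel. emeasure lborel T \<le> ennreal (C * h) \<and>
        (\<forall>z\<in>frontier \<Omega>. \<forall>x. dist x z \<le> h \<longrightarrow> x \<in> T)"
    using frontier_tube[OF op bdd bd] by blast
  show ?thesis
    using AE_liminf_level_strip_finite[of \<Omega> w L, OF _ _ fin L]
  proof (rule AE_mp, measurable)
    show "AE t in lborel. liminf (\<lambda>k. ennreal (real (Suc k)) *
      emeasure lborel {y \<in> \<Omega>. \<bar>w y - t\<bar> \<le> L * (1 / real (Suc k))}) \<noteq> \<infinity> \<longrightarrow> finite_perimeter {x \<in> \<Omega>. t < w x}"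
    proof (intro AE_I2 impI)
      fix t :: real
      define m where "m k = emeasure lborel {y \<in> \<Omega>. \<bar>w y - t\<bar> \<le> L * (1 / real (Suc k))}" for k
      assume "liminf (\<lambda>k. ennreal (real (Suc k)) *
        emeasure lborel {y \<in> \<Omega>. \<bar>w y - t\<bar> \<le> L * (1 / real (Suc k))}) \<noteq> \<infinity>"
      then have "liminf (\<lambda>k. ennreal (real (Suc k)) * m k) < \<infinity>" by (simp add: m_def top.not_eq_extremum)
      then obtain c' where c': "liminf (\<lambda>k. ennreal (real (Suc k)) * m k) < c'" "c' < \<infinity>"
        using dense by blast
      define c where "c = enn2real c'"
      have c: "c' = ennreal c" "0 \<le> c" using c' by (auto simp: c_def)
      \<comment> \<open>A finite lower limit bounds the scaled strip measures for infinitely many k,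
        which is enough to find h below any given threshold.\<close>
      have freq: "\<exists>k\<ge>K. ennreal (real (Suc k)) * m k < ennreal c" for K
      proof (rule ccontr)
        assume "\<not> ?thesis"
        then have "\<forall>k\<ge>K. ennreal c \<le> ennreal (real (Suc k)) * m k" by (simp add: not_less)
        then have "eventually (\<lambda>k. ennreal c \<le> ennreal (real (Suc k)) * m k) sequentially"
          unfolding eventually_sequentially by blast
        then have "ennreal c \<le> liminf (\<lambda>k. ennreal (real (Suc k)) * m k)" by (rule Liminf_bounded)
        then show False using c' c by simp
      qed
      show "finite_perimeter {x \<in> \<Omega>. t < w x}"
      proof (rule finite_perimeter_translates[where C="C + c"])
        show "{x \<in> \<Omega>. t < w x} \<in> sets borel" by measurable
        show "bounded {x \<in> \<Omega>. t < w x}" using bdd by (rule bounded_subset) auto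
        show "0 \<le> C + c" using C c by simp
        fix e :: real assume e: "0 < e"
        obtain K where K: "1 / real (Suc K) < min e h0"
          using reals_Archimedean[of "min e h0"] e C by (auto simp: inverse_eq_divide)
        obtain k where k: "K \<le> k" "ennreal (real (Suc k)) * m k < ennreal c" using freq by blast
        define h where "h = 1 / real (Suc k)"
        have "h \<le> 1 / real (Suc K)" using k unfolding h_def by (intro divide_left_mono) auto
        then have h: "0 < h" "h < e" "h < h0" using K by (auto simp: h_def)
        obtain T where T: "T \<in> sets borel" "emeasure lborel T \<le> ennreal (C * h)"
          "\<And>z x. z \<in> frontier \<Omega> \<Longrightarrow> dist x z \<le> h \<Longrightarrow> x \<in> T"
          using C(3)[OF h(1) h(3)] by blast
        define T' where "T' = T \<union> {y \<in> \<Omega>. \<bar>w y - t\<bar> \<le> L * h}"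
        have mk: "m k \<le> ennreal (c * h)"
        proof -
          have "m k = ennreal h * (ennreal (real (Suc k)) * m k)"
            unfolding h_def mult.assoc[symmetric] by (subst ennreal_mult[symmetric]) auto
          also have "\<dots> \<le> ennreal h * ennreal c" using k by (intro mult_left_mono) auto
          also have "\<dots> = ennreal (c * h)" using h c by (simp add: ennreal_mult[symmetric] mult.commute)
          finally show ?thesis .
        qed
        have "emeasure lborel T' \<le> emeasure lborel T + m k"
          unfolding T'_def m_def h_def using T(1) by (intro emeasure_subadditive) auto
        also have "\<dots> \<le> ennreal (C * h) + ennreal (c * h)" using T(2) mk by (rule add_mono)
        also have "\<dots> = ennreal ((C + c) * h)"
          using h C c by (simp add: distrib_right flip: ennreal_plus)
        finally have "emeasure lborel T' \<le> ennreal ((C + c) * h)" .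
        moreover have "y \<in> T'" if b: "b \<in> Basis"
          and y: "(y - h *\<^sub>R b \<in> {x \<in> \<Omega>. t < w x}) \<noteq> (y \<in> {x \<in> \<Omega>. t < w x})" for b y
        proof (cases "(y \<in> \<Omega>) = (y - h *\<^sub>R b \<in> \<Omega>)")
          case True
          then have y\<Omega>: "y \<in> \<Omega>" and ww: "(t < w (y - h *\<^sub>R b)) \<noteq> (t < w y)" using y by auto
          have "\<bar>w y - w (y - h *\<^sub>R b)\<bar> \<le> L * norm (y - (y - h *\<^sub>R b))" by (rule lip)
          also have "norm (y - (y - h *\<^sub>R b)) = h" using b h by simp
          finally have "\<bar>w y - t\<bar> \<le> L * h" using ww by linarith
          then show ?thesis using y\<Omega> by (simp add: T'_def)
        next
          case False
          have "closed_segment y (y - h *\<^sub>R b) \<inter> frontier \<Omega> \<noteq> {}"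
          proof (rule connected_Int_frontier)
            show "closed_segment y (y - h *\<^sub>R b) \<inter> \<Omega> \<noteq> {}" "closed_segment y (y - h *\<^sub>R b) - \<Omega> \<noteq> {}"
              using False by (blast intro: ends_in_segment)+
          qed simp
          then obtain z where z: "z \<in> closed_segment y (y - h *\<^sub>R b)" "z \<in> frontier \<Omega>" by blast
          have "norm (z - y) \<le> norm ((y - h *\<^sub>R b) - y)" using z(1) by (rule segment_bound)
          then have "dist y z \<le> h" using b h by (simp add: dist_norm norm_minus_commute)
          then show ?thesis using T(3)[OF z(2)] by (simp add: T'_def)
        qed
        moreover have "T' \<in> sets borel" unfolding T'_def using T(1) by measurable
        ultimately show "\<exists>h T. 0 < h \<and> h < e \<and> T \<in> sets borel \<and> emeasure lborel T \<le> ennreal ((C + c) * h) \<and>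
              (\<forall>b\<in>Basis. \<forall>y. (y - h *\<^sub>R b \<in> {x \<in> \<Omega>. t < w x}) \<noteq> (y \<in> {x \<in> \<Omega>. t < w x}) \<longrightarrow> y \<in> T)"
          using h by (intro exI[of _ h] exI[of _ T']) blast
      qed
    qed
  qed
qed

section \<open>Outer normals\<close>

text \<open>A ball of radius s*r has measure a fixed positive multiple of r^n, so it cannot sit in
  sets whose density tends to 0. The contradiction arguments about outer normals below all exhibit
  such a ball.\<close>

lemma positive_density_contradiction:
  fixes x :: "'a::euclidean_space"
  assumes s: "0 < s" and r0: "0 < r0"
    and A: "\<And>r. 0 < r \<Longrightarrow> r < r0 \<Longrightarrow> A r \<in> sets lebesgue \<and> A r \<subseteq> ball x r \<and> (\<exists>p. ball p (s * r) \<subseteq> A r)"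
    and lim: "((\<lambda>r. measure lebesgue (A r) / r ^ DIM('a)) \<longlongrightarrow> 0) (at_right 0)"
  shows False
proof -
  define c where "c = unit_ball_vol (real DIM('a)) * s ^ DIM('a)"
  have c: "0 < c" using s by (simp add: c_def)
  have "eventually (\<lambda>r. measure lebesgue (A r) / r ^ DIM('a) < c) (at_right 0)"
    by (rule order_tendstoD(2)[OF lim c])
  moreover have "eventually (\<lambda>r. 0 < r \<and> r < r0) (at_right (0::real))"
    using r0 by (intro eventually_at_rightI[of 0 r0]) auto
  ultimately have "eventually (\<lambda>r. measure lebesgue (A r) / r ^ DIM('a) < c \<and> 0 < r \<and> r < r0) (at_right 0)"
    by eventually_elim auto
  then obtain r where r: "measure lebesgue (A r) / r ^ DIM('a) < c" "0 < r" "r < r0"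
    using eventually_happens'[OF trivial_limit_at_right_real] by blast
  obtain p where p: "ball p (s * r) \<subseteq> A r" and Ar: "A r \<in> sets lebesgue" "A r \<subseteq> ball x r" using A r by blast
  have "A r \<in> lmeasurable"
    using Ar by (meson bounded_ball bounded_set_imp_lmeasurable bounded_subset)
  then have "measure lebesgue (ball p (s * r)) \<le> measure lebesgue (A r)"
    using p by (intro measure_mono_fmeasurable) auto
  moreover have "measure lebesgue (ball p (s * r)) = c * r ^ DIM('a)"
    using content_ball[of "s * r" p] s r by (simp add: c_def power_mult_distrib)
  ultimately show False using r by (simp add: field_simps)
qed

lemma ball_subset_half_ball:
  fixes x \<nu> :: "'a::euclidean_space"
  assumes "norm \<nu> = 1" "0 < r"
  shows "ball (x + (r / 2) *\<^sub>R \<nu>) (1 / 2 * r) \<subseteq> ball x r \<inter> {y. (y - x) \<bullet> \<nu> > 0}"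
proof
  fix y assume y: "y \<in> ball (x + (r / 2) *\<^sub>R \<nu>) (1 / 2 * r)"
  define v where "v = y - (x + (r / 2) *\<^sub>R \<nu>)"
  have v: "norm v < r / 2" using y by (simp add: v_def dist_norm norm_minus_commute)
  have yx: "y - x = (r / 2) *\<^sub>R \<nu> + v" by (simp add: v_def)
  have "norm (y - x) < r" unfolding yx using norm_triangle_ineq[of "(r / 2) *\<^sub>R \<nu>" v] v assms by simp
  moreover have "(y - x) \<bullet> \<nu> = r / 2 + v \<bullet> \<nu>"
    unfolding yx using assms by (simp add: inner_add_left dot_square_norm)
  moreover have "\<bar>v \<bullet> \<nu>\<bar> \<le> norm v" using Cauchy_Schwarz_ineq2[of v \<nu>] assms by simp
  ultimately show "y \<in> ball x r \<inter> {y. (y - x) \<bullet> \<nu> > 0}"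
    using v by (auto simp: dist_norm norm_minus_commute)
qed

lemma half_ball_sets [measurable]:
  "{y::'a::euclidean_space. (y - x) \<bullet> \<nu> > 0} \<in> sets lebesgue" "{y::'a. (y - x) \<bullet> \<nu> < 0} \<in> sets lebesgue"
proof -
  have "{y::'a. (y - x) \<bullet> \<nu> > 0} \<in> sets borel" "{y::'a. (y - x) \<bullet> \<nu> < 0} \<in> sets borel" by measurable
  then show "{y::'a. (y - x) \<bullet> \<nu> > 0} \<in> sets lebesgue" "{y::'a. (y - x) \<bullet> \<nu> < 0} \<in> sets lebesgue" by auto
qed

text \<open>Off the closure of E, small half balls on the inner side lie wholly outside E; in the
  interior, small half balls on the outer side lie wholly in E. Either way a set that should have
  density 0 contains a ball of radius r/2.\<close>

lemma reduced_boundary_subset_frontier: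
  fixes E :: "'a::euclidean_space set"
  assumes E: "E \<in> sets lebesgue"
  shows "reduced_boundary E \<subseteq> frontier E"
proof
  fix x assume "x \<in> reduced_boundary E"
  then obtain \<nu> where nu: "norm \<nu> = 1"
    and l1: "((\<lambda>r. measure lebesgue (ball x r \<inter> E \<inter> {y. (y - x) \<bullet> \<nu> > 0}) / r ^ DIM('a)) \<longlongrightarrow> 0) (at_right 0)"
    and l2: "((\<lambda>r. measure lebesgue ((ball x r \<inter> {y. (y - x) \<bullet> \<nu> < 0}) - E) / r ^ DIM('a)) \<longlongrightarrow> 0) (at_right 0)"
    unfolding reduced_boundary_def outer_normal_at_def by blast
  have half: "0 < (1/2::real)" by simp
  have "x \<in> closure E"
  proof (rule ccontr)
    assume "x \<notin> closure E"
    then obtain r0 where r0: "0 < r0" "\<And>y. y \<in> E \<Longrightarrow> \<not> dist y x < r0"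
      unfolding closure_approachable by blast
    show False
    proof (rule positive_density_contradiction[OF half r0(1) _ l2], intro conjI)
      fix r assume r: "0 < r" "r < r0"
      have nu': "norm (- \<nu>) = 1" using nu by simp
      have "ball (x + (r / 2) *\<^sub>R (- \<nu>)) (1 / 2 * r) \<subseteq> ball x r \<inter> {y. (y - x) \<bullet> (- \<nu>) > 0}"
        by (rule ball_subset_half_ball[OF nu' r(1)])
      also have "\<dots> = ball x r \<inter> {y. (y - x) \<bullet> \<nu> < 0} - E"
        using r r0(2) by (fastforce simp: dist_commute)
      finally show "\<exists>p. ball p (1 / 2 * r) \<subseteq> ball x r \<inter> {y. (y - x) \<bullet> \<nu> < 0} - E" by blast
      show "ball x r \<inter> {y. (y - x) \<bullet> \<nu> < 0} - E \<in> sets lebesgue" using E by (intro sets.Diff sets.Int half_ball_sets) auto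
    qed auto
  qed
  moreover have "x \<notin> interior E"
  proof
    assume "x \<in> interior E"
    then obtain r0 where r0: "0 < r0" "ball x r0 \<subseteq> E"
      using mem_interior by blast
    show False
    proof (rule positive_density_contradiction[OF half r0(1) _ l1], intro conjI)
      fix r assume r: "0 < r" "r < r0"
      have "ball (x + (r / 2) *\<^sub>R \<nu>) (1 / 2 * r) \<subseteq> ball x r \<inter> {y. (y - x) \<bullet> \<nu> > 0}"
        by (rule ball_subset_half_ball[OF nu r(1)])
      also have "\<dots> = ball x r \<inter> E \<inter> {y. (y - x) \<bullet> \<nu> > 0}"
        using r r0 subset_ball[of r r0 x] by auto
      finally show "\<exists>p. ball p (1 / 2 * r) \<subseteq> ball x r \<inter> E \<inter> {y. (y - x) \<bullet> \<nu> > 0}" by blast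
      show "ball x r \<inter> E \<inter> {y. (y - x) \<bullet> \<nu> > 0} \<in> sets lebesgue" using E by (intro sets.Int half_ball_sets) auto
    qed auto
  qed
  ultimately show "x \<in> frontier E" by (simp add: frontier_def)
qed

text \<open>If \<nu> and \<mu> differ, the wedge on the inner side of \<nu> and the outer side of
  \<mu> has positive density. Each of its points is in U, hence in \<Omega> on the outer side of
  \<mu>, or it is missing from U on the inner side of \<nu>; both kinds have density 0. With U =
  \<Omega> this is uniqueness of the normal; with U a superlevel set it gives the normal on the
  frontier however the level set meets it.\<close>

lemma outer_normal_at_subset_eq:
  fixes U \<Omega> :: "'a::euclidean_space set"
  assumes sets: "U \<in> sets lebesgue" "\<Omega> \<in> sets lebesgue" and sub: "U \<subseteq> \<Omega>"
    and U: "outer_normal_at U x \<nu>" and \<Omega>: "outer_normal_at \<Omega> x \<mu>"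
  shows "\<nu> = \<mu>"
proof (rule ccontr)
  assume ne: "\<nu> \<noteq> \<mu>"
  define A where "A r = (ball x r \<inter> \<Omega> \<inter> {y. (y - x) \<bullet> \<mu> > 0}) \<union> ((ball x r \<inter> {y. (y - x) \<bullet> \<nu> < 0}) - U)" for r
  have norms: "norm \<nu> = 1" "norm \<mu> = 1" using U \<Omega> by (auto simp: outer_normal_at_def)
  define c where "c = 1 - \<mu> \<bullet> \<nu>"
  have "(norm (\<mu> - \<nu>))\<^sup>2 = 2 * c"
    using norms dot_norm_neg[of \<mu> \<nu>] by (simp add: c_def)
  moreover have "0 < (norm (\<mu> - \<nu>))\<^sup>2" using ne by simp
  ultimately have c: "0 < c" by linarith
  have c2: "c \<le> 2" using Cauchy_Schwarz_ineq2[of \<mu> \<nu>] norms by (simp add: c_def abs_le_iff)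
  have lim0: "((\<lambda>r. measure lebesgue (ball x r \<inter> \<Omega> \<inter> {y. (y - x) \<bullet> \<mu> > 0}) / r ^ DIM('a)
     + measure lebesgue ((ball x r \<inter> {y. (y - x) \<bullet> \<nu> < 0}) - U) / r ^ DIM('a)) \<longlongrightarrow> 0 + 0) (at_right 0)"
    using U \<Omega> by (intro tendsto_add) (auto simp: outer_normal_at_def)
  have ms: "ball x r \<inter> \<Omega> \<inter> {y. (y - x) \<bullet> \<mu> > 0} \<in> sets lebesgue"
    "(ball x r \<inter> {y. (y - x) \<bullet> \<nu> < 0}) - U \<in> sets lebesgue" for r
    using sets by (auto intro!: sets.Int sets.Diff half_ball_sets)
  have lim: "((\<lambda>r. measure lebesgue (A r) / r ^ DIM('a)) \<longlongrightarrow> 0) (at_right 0)"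
  proof (rule tendsto_sandwich[OF _ _ tendsto_const lim0[simplified]])
    show "\<forall>\<^sub>F r in at_right 0. 0 \<le> measure lebesgue (A r) / r ^ DIM('a)"
      using eventually_at_right_less by eventually_elim auto
    show "\<forall>\<^sub>F r in at_right 0. measure lebesgue (A r) / r ^ DIM('a)
       \<le> measure lebesgue (ball x r \<inter> \<Omega> \<inter> {y. (y - x) \<bullet> \<mu> > 0}) / r ^ DIM('a)
     + measure lebesgue ((ball x r \<inter> {y. (y - x) \<bullet> \<nu> < 0}) - U) / r ^ DIM('a)"
      using eventually_at_right_less
    proof eventually_elim
      case (elim r)
      have "measure lebesgue (A r) \<le> measure lebesgue (ball x r \<inter> \<Omega> \<inter> {y. (y - x) \<bullet> \<mu> > 0})
         + measure lebesgue ((ball x r \<inter> {y. (y - x) \<bullet> \<nu> < 0}) - U)"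
        unfolding A_def using ms[of r] by (intro measure_Un_le) auto
      then show ?case using elim by (simp add: divide_right_mono flip: add_divide_distrib)
    qed
  qed
  have c8: "0 < c / 8" and one: "0 < (1::real)" using c by auto
  show False
  proof (rule positive_density_contradiction[OF c8 one _ lim], intro conjI)
    fix r :: real assume r: "0 < r" "r < 1"
    show "A r \<in> sets lebesgue" unfolding A_def using ms by auto
    show "A r \<subseteq> ball x r" by (auto simp: A_def)
    \<comment> \<open>\<mu> - \<nu> points into the wedge, with inner products c against \<mu> and
      -c against \<nu>. At x + (r/4)*z the distance to both bounding planes is c*r/4, so a ball of
      radius c*r/8 stays inside; the norm bound 2 for z keeps it in \<open>ball x r\<close>.\<close>
    define z where "z = \<mu> - \<nu>"
    have zn: "norm z \<le> 2" using norm_triangle_ineq4[of \<mu> \<nu>] norms by (simp add: z_def)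
    have zz: "z \<bullet> \<nu> = - c" "z \<bullet> \<mu> = c" using norms by (simp_all add: z_def c_def inner_diff inner_commute dot_square_norm)
    have "ball (x + (r / 4) *\<^sub>R z) (c / 8 * r) \<subseteq> A r"
    proof
      fix y assume y: "y \<in> ball (x + (r / 4) *\<^sub>R z) (c / 8 * r)"
      define v where "v = y - (x + (r / 4) *\<^sub>R z)"
      have v: "norm v < c / 8 * r" using y by (simp add: v_def dist_norm norm_minus_commute)
      have yx: "y - x = (r / 4) *\<^sub>R z + v" by (simp add: v_def)
      have "norm (y - x) \<le> r / 4 * norm z + norm v" unfolding yx using norm_triangle_ineq[of "(r / 4) *\<^sub>R z" v] r by simp
      also have "\<dots> < r"
      proof -
        have "r / 4 * norm z \<le> r / 4 * 2" using zn r by (intro mult_left_mono) auto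
        moreover have "c * r \<le> 2 * r" using c2 r by (intro mult_right_mono) auto
        moreover have "c / 8 * r = (c * r) / 8" by simp
        ultimately show ?thesis using v r by linarith
      qed
      finally have yb: "y \<in> ball x r" using r by (simp add: dist_norm norm_minus_commute)
      have "\<bar>v \<bullet> \<nu>\<bar> \<le> norm v" "\<bar>v \<bullet> \<mu>\<bar> \<le> norm v"
        using Cauchy_Schwarz_ineq2[of v \<nu>] Cauchy_Schwarz_ineq2[of v \<mu>] norms by auto
      moreover have "(y - x) \<bullet> \<nu> = - (c * r / 4) + v \<bullet> \<nu>" "(y - x) \<bullet> \<mu> = c * r / 4 + v \<bullet> \<mu>"
        unfolding yx by (simp_all add: inner_add_left zz)
      moreover have "0 < c * r" using c r by simp
      ultimately have "(y - x) \<bullet> \<nu> < 0" "(y - x) \<bullet> \<mu> > 0" using v by auto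
      then show "y \<in> A r" using yb sub by (auto simp: A_def)
    qed
    then show "\<exists>p. ball p (c / 8 * r) \<subseteq> A r" by blast
  qed
qed

lemma outer_normal_eqI:
  assumes "E \<in> sets lebesgue" "outer_normal_at E x \<nu>"
  shows "outer_normal E x = \<nu>"
  unfolding outer_normal_def
  using assms outer_normal_at_subset_eq[OF assms(1,1)] by (intro the_equality) auto

text \<open>By differentiability, a point of the ball on the wrong side of the tangent plane lies in
  a slab around that plane of width e*r, with e as small as desired; by
  \<open>emeasure_slab_le\<close> such a slab has measure of order e*r^n.\<close>

lemma outer_normal_at_sublevel:
  fixes f :: "'a::euclidean_space \<Rightarrow> real"
  assumes E: "E \<in> sets lebesgue" and r0: "0 < r0" and eq: "E \<inter> ball x r0 = {y \<in> ball x r0. f y < 0}"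
    and fx: "f x = 0" and der: "(f has_derivative (\<lambda>h. q \<bullet> h)) (at x)" and q: "q \<noteq> 0"
  shows "outer_normal_at E x (q /\<^sub>R norm q)"
proof -
  define \<nu> where "\<nu> = q /\<^sub>R norm q"
  have nu: "norm \<nu> = 1" using q by (simp add: \<nu>_def)
  have q_nu: "q \<bullet> y = norm q * (y \<bullet> \<nu>)" for y using q by (simp add: \<nu>_def inner_commute)
  \<comment> \<open>Both halves of \<open>outer_normal_at\<close> measure points at which f and its
    linear part disagree in sign. The second assumption expresses this for either half: there, the
    linearization error bounds the distance to the tangent plane.\<close>
  have lim: "((\<lambda>r. measure lebesgue (A r) / r ^ DIM('a)) \<longlongrightarrow> 0) (at_right 0)"
    if A: "\<And>r. A r \<in> sets lebesgue"
      "\<And>e r y. 0 < e \<Longrightarrow> 0 < r \<Longrightarrow> r < r0 \<Longrightarrow> y \<in> A r \<Longrightarrow>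
         \<bar>f y - q \<bullet> (y - x)\<bar> \<le> e * (norm q * norm (y - x)) \<Longrightarrow> \<bar>(y - x) \<bullet> \<nu>\<bar> \<le> e * norm (y - x)"
      "\<And>r. A r \<subseteq> ball x r" for A
  proof (rule tendstoI)
    fix e' :: real assume e': "0 < e'"
    \<comment> \<open>The slab lemma with d = e*r and l = r gives 6*e times the volume of the ball
      of radius 2*r, that is e*K*r^n. The condition 3*d \<le> l is e \<le> 1/3.\<close>
    define K where "K = 6 * unit_ball_vol (real DIM('a)) * 2 ^ DIM('a)"
    have K: "0 < K" by (simp add: K_def)
    define e where "e = min (1 / 3) (e' / (2 * K))"
    have e: "0 < e" "3 * e \<le> 1" "e * K < e'" 
    proof -
      show "0 < e" "3 * e \<le> 1" using e' K by (auto simp: e_def)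
      have "e * K \<le> e' / (2 * K) * K" unfolding e_def using K by (intro mult_right_mono) auto
      also have "\<dots> < e'" using K e' by simp
      finally show "e * K < e'" .
    qed
    have "0 < e * norm q" using e q by simp
    then obtain d where d: "0 < d" "\<And>y. norm (y - x) < d \<Longrightarrow> \<bar>f y - f x - q \<bullet> (y - x)\<bar> \<le> (e * norm q) * norm (y - x)"
      using der[unfolded has_derivative_at_alt] by (metis real_norm_def)
    have main: "dist (measure lebesgue (A r) / r ^ DIM('a)) 0 < e'" if r: "0 < r" "r < min d r0" for r
    proof -
      define S where "S = {y \<in> ball x r. \<bar>(y - x) \<bullet> \<nu>\<bar> \<le> e * r}"
      have Sm: "S \<in> sets borel" unfolding S_def by measurable
      have Sb: "bounded S" unfolding S_def by (rule bounded_subset[OF bounded_ball]) auto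
      have "A r \<subseteq> S"
      proof
        fix y assume y: "y \<in> A r"
        then have yb: "norm (y - x) < r" using A(3)[of r] by (auto simp: dist_norm norm_minus_commute)
        then have "\<bar>f y - q \<bullet> (y - x)\<bar> \<le> e * (norm q * norm (y - x))" using d(2)[of y] r fx by (simp add: mult.assoc)
        then have "\<bar>(y - x) \<bullet> \<nu>\<bar> \<le> e * norm (y - x)" using A(2)[OF e(1) r(1) _ y] r by auto
        moreover have "e * norm (y - x) \<le> e * r" using e yb by (intro mult_left_mono) auto
        ultimately show "y \<in> S" using y A(3)[of r] by (auto simp: S_def)
      qed
      then have "measure lebesgue (A r) \<le> measure lebesgue S"
        using A(1) Sm Sb by (intro measure_mono_fmeasurable bounded_set_imp_lmeasurable) auto
      also have "measure lebesgue S = measure lborel S" using Sm by simp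
      also have "\<dots> \<le> 6 * (e * r) / r * measure lborel (ball x (r + r))"
      proof -
        have "emeasure lborel S \<le> ennreal (6 * (e * r) / r * measure lborel (ball x (r + r)))"
          unfolding S_def
        proof (rule emeasure_slab_le[OF _ nu])
          show "(\<lambda>y. (y - x) \<bullet> \<nu>) \<in> borel_measurable borel" by measurable
          show "(y + s *\<^sub>R \<nu> - x) \<bullet> \<nu> = (y - x) \<bullet> \<nu> + s" for y s
            using nu by (simp add: inner_add_left inner_diff_left dot_square_norm)
          show "0 < e * r" "3 * (e * r) \<le> r" using e r by auto
        qed
        then show ?thesis using e r by (simp add: measure_def enn2real_leI)
      qed
      also have "measure lborel (ball x (r + r)) = unit_ball_vol (real DIM('a)) * (2 * r) ^ DIM('a)"
        using content_ball[of "2 * r" x] r by simp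
      finally have "measure lebesgue (A r) \<le> e * K * r ^ DIM('a)"
        using r by (simp add: K_def power_mult_distrib mult_ac)
      then have "measure lebesgue (A r) / r ^ DIM('a) \<le> e * K" using r by (simp add: divide_le_eq)
      then show ?thesis using e r by (simp add: dist_norm)
    qed
    show "\<forall>\<^sub>F r in at_right 0. dist (measure lebesgue (A r) / r ^ DIM('a)) 0 < e'"
      using d r0 by (intro eventually_at_rightI[of 0 "min d r0"] main) auto
  qed
  show ?thesis
    unfolding outer_normal_at_def \<nu>_def[symmetric]
  proof (intro conjI nu lim)
    fix r
    show "ball x r \<inter> E \<inter> {y. 0 < (y - x) \<bullet> \<nu>} \<in> sets lebesgue" "ball x r \<inter> {y. (y - x) \<bullet> \<nu> < 0} - E \<in> sets lebesgue"
      using E by (auto intro!: sets.Int sets.Diff half_ball_sets)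
  next
    fix e r y assume e: "0 < e" "0 < r" "r < r0"
      and y: "y \<in> ball x r \<inter> E \<inter> {y. 0 < (y - x) \<bullet> \<nu>}" "\<bar>f y - q \<bullet> (y - x)\<bar> \<le> e * (norm q * norm (y - x))"
    have "y \<in> E \<inter> ball x r0" using y(1) e(3) by simp
    then have "f y < 0" unfolding eq by simp
    then have "norm q * ((y - x) \<bullet> \<nu>) \<le> norm q * (e * norm (y - x))" using y(2) unfolding q_nu by (simp add: algebra_simps)
    then have "(y - x) \<bullet> \<nu> \<le> e * norm (y - x)" using q by simp
    then show "\<bar>(y - x) \<bullet> \<nu>\<bar> \<le> e * norm (y - x)" using y by auto
  next
    fix e r y assume e: "0 < e" "0 < r" "r < r0"
      and y: "y \<in> ball x r \<inter> {y. (y - x) \<bullet> \<nu> < 0} - E" "\<bar>f y - q \<bullet> (y - x)\<bar> \<le> e * (norm q * norm (y - x))"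
    have "y \<notin> E \<inter> ball x r0" "y \<in> ball x r0" using y(1) e(3) by simp_all
    then have "f y \<ge> 0" unfolding eq by simp
    then have "norm q * (- ((y - x) \<bullet> \<nu>)) \<le> norm q * (e * norm (y - x))" using y(2) unfolding q_nu by (simp add: algebra_simps)
    moreover have "0 < norm q" using q by simp
    ultimately have "- ((y - x) \<bullet> \<nu>) \<le> e * norm (y - x)" using mult_le_cancel_left_pos by blast
    then show "\<bar>(y - x) \<bullet> \<nu>\<bar> \<le> e * norm (y - x)" using y by auto
  qed auto
qed

text \<open>In a chart, \<Omega> is the sublevel set of y \<bullet> e - \<gamma> y, so the normal is
  e - G y normalized. This formula is continuous on the whole space, and by uniqueness it agrees
  with \<open>outer_normal\<close> on the frontier.\<close>

lemma C1alpha_boundary_outer_normal: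
  fixes \<Omega> :: "'a::euclidean_space set"
  assumes op: "open \<Omega>" and bd: "C1alpha_boundary \<alpha> \<Omega>"
  shows "\<And>x. x \<in> frontier \<Omega> \<Longrightarrow> outer_normal_at \<Omega> x (outer_normal \<Omega> x)"
    and "continuous_on (frontier \<Omega>) (outer_normal \<Omega>)"
proof -
  have \<Omega>: "\<Omega> \<in> sets lebesgue" using op by simp
  have chart: "\<exists>r>0. \<exists>n. continuous_on UNIV n \<and> (\<forall>x\<in>frontier \<Omega> \<inter> ball x0 r. outer_normal_at \<Omega> x (n x))"
    if x0: "x0 \<in> frontier \<Omega>" for x0
  proof -
    obtain r e \<gamma> G where r: "0 < r" and e: "norm e = 1" and inv: "\<forall>y. \<gamma> y = \<gamma> (y - (y \<bullet> e) *\<^sub>R e)"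
      and der: "\<And>y. (\<gamma> has_derivative (\<lambda>h. G y \<bullet> h)) (at y)" and Gc: "continuous_on UNIV G"
      and eq: "\<Omega> \<inter> ball x0 r = {x \<in> ball x0 r. x \<bullet> e < \<gamma> x}"
      using bd x0 unfolding C1alpha_boundary_def by meson
    have gc: "continuous_on UNIV \<gamma>"
      using der by (meson continuous_at_imp_continuous_on has_derivative_continuous)
    have ee: "e \<bullet> e = 1" using e by (simp add: dot_square_norm)
    note invs = graph_function_translate[OF e inv]
    \<comment> \<open>\<gamma> is constant along e, so its gradient is orthogonal to e; then (e - G
      y) \<bullet> e = 1, and the vector to be normalized is not 0.\<close>
    have Ge: "G y \<bullet> e = 0" for y
    proof -
      have "((\<lambda>s. y + s *\<^sub>R e) has_derivative (\<lambda>s. s *\<^sub>R e)) (at 0)"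
        by (auto intro!: derivative_eq_intros)
      then have "((\<lambda>s. \<gamma> (y + s *\<^sub>R e)) has_derivative (\<lambda>s. G y \<bullet> (s *\<^sub>R e))) (at 0)"
        by (rule has_derivative_compose) (use der[of y] in simp)
      then have "((\<lambda>s::real. \<gamma> y) has_derivative (\<lambda>s. G y \<bullet> (s *\<^sub>R e))) (at 0)" unfolding invs .
      then have "(\<lambda>s. G y \<bullet> (s *\<^sub>R e)) = (\<lambda>s::real. 0)" by (rule has_derivative_unique) simp
      from fun_cong[OF this, of 1] show ?thesis by simp
    qed
    have ne: "e - G y \<noteq> 0" for y
    proof
      assume "e - G y = 0"
      then have "(e - G y) \<bullet> e = 0" by simp
      then show False using Ge[of y] ee by (simp add: inner_diff_left)
    qed
    have "outer_normal_at \<Omega> x ((e - G x) /\<^sub>R norm (e - G x))" if x: "x \<in> frontier \<Omega> \<inter> ball x0 r" for x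
    proof -
      have "open (ball x0 r)" by simp
      then obtain s where s: "0 < s" "ball x s \<subseteq> ball x0 r" using x by (meson IntD2 openE)
      show ?thesis
      proof (rule outer_normal_at_sublevel[OF \<Omega> s(1) _ _ _ ne])
        show "\<Omega> \<inter> ball x s = {y \<in> ball x s. y \<bullet> e - \<gamma> y < 0}"
        proof -
          have "\<Omega> \<inter> ball x s = (\<Omega> \<inter> ball x0 r) \<inter> ball x s" using s by blast
          also have "\<dots> = {y \<in> ball x s. y \<bullet> e - \<gamma> y < 0}" unfolding eq using s by auto
          finally show ?thesis .
        qed
        show "x \<bullet> e - \<gamma> x = 0" using frontier_graph[OF op _ _ gc eq, of x] x by simp
        show "((\<lambda>y. y \<bullet> e - \<gamma> y) has_derivative (\<lambda>h. (e - G x) \<bullet> h)) (at x)"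
          by (auto intro!: derivative_eq_intros der simp: inner_diff_left inner_diff_right inner_commute)
      qed
    qed
    moreover have "continuous_on UNIV (\<lambda>x. (e - G x) /\<^sub>R norm (e - G x))"
      using Gc ne by (intro continuous_intros) auto
    ultimately show ?thesis using r by blast
  qed
  show nrm: "outer_normal_at \<Omega> x (outer_normal \<Omega> x)" if x: "x \<in> frontier \<Omega>" for x
  proof -
    obtain r n where "0 < r" "\<forall>y\<in>frontier \<Omega> \<inter> ball x r. outer_normal_at \<Omega> y (n y)" using chart[OF x] by blast
    then have "outer_normal_at \<Omega> x (n x)" using x by simp
    then show ?thesis using outer_normal_eqI[OF \<Omega>] by metis
  qed
  show "continuous_on (frontier \<Omega>) (outer_normal \<Omega>)"
    unfolding continuous_on_eq_continuous_within
  proof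
    fix x0 assume x0: "x0 \<in> frontier \<Omega>"
    obtain r n where r: "0 < r" and nc: "continuous_on UNIV n"
      and n: "\<forall>y\<in>frontier \<Omega> \<inter> ball x0 r. outer_normal_at \<Omega> y (n y)" using chart[OF x0] by blast
    have "continuous (at x0 within frontier \<Omega>) n"
      using nc by (simp add: continuous_on_eq_continuous_at continuous_at_imp_continuous_within)
    then show "continuous (at x0 within frontier \<Omega>) (outer_normal \<Omega>)"
    proof (rule continuous_transform_within[OF _ r x0])
      fix y assume "y \<in> frontier \<Omega>" "dist y x0 < r"
      then have "outer_normal_at \<Omega> y (n y)" using n by (simp add: dist_commute)
      then show "n y = outer_normal \<Omega> y" using outer_normal_eqI[OF \<Omega>] by metis
    qed
  qed
qed

section \<open>The weighted Cheeger inequality\<close>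

text \<open>No \<open>\<sigma>\<close>-finiteness is needed: if the right-hand side is finite, then \<open>w * k\<close> is the
  density of a finite measure, with respect to which Tonelli's theorem applies.\<close>
lemma upper_integral_layer_cake:
  fixes w :: "'a \<Rightarrow> real" and k :: "'a \<Rightarrow> ennreal"
  assumes [measurable]: "w \<in> borel_measurable M" "k \<in> borel_measurable M"
  shows "upper_integral_le (\<lambda>t. indicator {0<..} t * (\<integral>\<^sup>+x. indicator {x. t \<le> w x} x * k x \<partial>M))
     (\<integral>\<^sup>+x. ennreal (w x) * k x \<partial>M)"
proof (cases "(\<integral>\<^sup>+x. ennreal (w x) * k x \<partial>M) = \<infinity>")
  case True
  then show ?thesis by (intro upper_integral_leI[of "\<lambda>_. \<infinity>"]) auto
next
  case False
  define \<mu> where "\<mu> = density M (\<lambda>x. ennreal (w x) * k x)"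
  have sets_mu [measurable_cong]: "sets \<mu> = sets M" by (simp add: \<mu>_def)
  have em: "emeasure \<mu> (space \<mu>) = (\<integral>\<^sup>+x. ennreal (w x) * k x \<partial>M)"
    unfolding \<mu>_def by (subst emeasure_density) (auto intro!: nn_integral_cong simp: space_density indicator_def)
  interpret finite_measure \<mu> by (rule finite_measureI) (use False em in auto)
  have sf: "sigma_finite_measure \<mu>" by (rule sigma_finite_measure_axioms)
  interpret pair_sigma_finite lborel \<mu> by (intro pair_sigma_finite.intro) (simp_all add: lborel.sigma_finite_measure_axioms sigma_finite_measure_axioms)
  \<comment> \<open>The factor 1/w undoes the density w*k of \<mu> for fixed t; for fixed x it makes
    the integral over t in (0, w x] equal to 1.\<close>
  define u where "u t x = (if 0 < t \<and> t \<le> w x then ennreal (1 / w x) else 0)" for t x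
  have um [measurable]: "(\<lambda>(t, x). u t x) \<in> borel_measurable (lborel \<Otimes>\<^sub>M \<mu>)"
    unfolding u_def split_def by measurable
  have J: "indicator {0<..} t * (\<integral>\<^sup>+x. indicator {x. t \<le> w x} x * k x \<partial>M) = (\<integral>\<^sup>+x. u t x \<partial>\<mu>)" for t
  proof -
    have "(\<integral>\<^sup>+x. u t x \<partial>\<mu>) = (\<integral>\<^sup>+x. (ennreal (w x) * k x) * u t x \<partial>M)"
      unfolding \<mu>_def by (rule nn_integral_density) (auto simp: u_def)
    also have "\<dots> = (\<integral>\<^sup>+x. indicator {0<..} t * (indicator {x. t \<le> w x} x * k x) \<partial>M)"
    proof (rule nn_integral_cong)
      fix x
      have "ennreal (w x) * ennreal (1 / w x) = 1" if "0 < t" "t \<le> w x"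
        using that by (simp add: ennreal_mult[symmetric])
      then show "(ennreal (w x) * k x) * u t x = indicator {0<..} t * (indicator {x. t \<le> w x} x * k x)"
        by (auto simp: u_def indicator_def mult_ac)
    qed
    also have "\<dots> = indicator {0<..} t * (\<integral>\<^sup>+x. indicator {x. t \<le> w x} x * k x \<partial>M)"
      by (cases "0 < t") auto
    finally show ?thesis by simp
  qed
  show ?thesis
    unfolding J
  proof (rule upper_integral_leI)
    show "(\<lambda>t. \<integral>\<^sup>+x. u t x \<partial>\<mu>) \<in> borel_measurable borel"
      using sigma_finite_measure.borel_measurable_nn_integral[OF sf um] by simp
    have "(\<integral>\<^sup>+t. \<integral>\<^sup>+x. u t x \<partial>\<mu> \<partial>lborel) = (\<integral>\<^sup>+x. \<integral>\<^sup>+t. u t x \<partial>lborel \<partial>\<mu>)"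
      by (rule Fubini'[symmetric, OF um])
    also have "\<dots> \<le> (\<integral>\<^sup>+x. 1 \<partial>\<mu>)"
    proof (rule nn_integral_mono)
      fix x
      have "(\<integral>\<^sup>+t. u t x \<partial>lborel) \<le> (\<integral>\<^sup>+t. ennreal (1 / w x) * indicator {0..w x} t \<partial>lborel)"
        by (rule nn_integral_mono) (auto simp: u_def)
      also have "\<dots> = ennreal (1 / w x) * emeasure lborel {0..w x}" by (rule nn_integral_cmult_indicator) simp
      also have "\<dots> \<le> 1" by (cases "0 < w x") (auto simp: ennreal_mult[symmetric] ennreal_neg)
      finally show "(\<integral>\<^sup>+t. u t x \<partial>lborel) \<le> 1" .
    qed
    also have "\<dots> = (\<integral>\<^sup>+x. ennreal (w x) * k x \<partial>M)" by (simp add: em)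
    finally show "(\<integral>\<^sup>+t. \<integral>\<^sup>+x. u t x \<partial>\<mu> \<partial>lborel) \<le> (\<integral>\<^sup>+x. ennreal (w x) * k x \<partial>M)" .
  qed simp
qed

lemma nn_integral_level_sets:
  fixes w :: "'a::euclidean_space \<Rightarrow> real"
  assumes [measurable]: "A \<in> sets borel" "w \<in> borel_measurable borel"
  shows "(\<lambda>t. indicator {0<..} t * emeasure lborel {x \<in> A. t < w x}) \<in> borel_measurable borel"
    and "(\<integral>\<^sup>+t. indicator {0<..} t * emeasure lborel {x \<in> A. t < w x} \<partial>lborel) = (\<integral>\<^sup>+x\<in>A. ennreal (w x) \<partial>lborel)"
proof -
  define u :: "real \<Rightarrow> 'a \<Rightarrow> ennreal" where "u t x = (if 0 < t \<and> t < w x \<and> x \<in> A then 1 else 0)" for t x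
  have um [measurable]: "(\<lambda>(t, x). u t x) \<in> borel_measurable (lborel \<Otimes>\<^sub>M lborel)"
    unfolding u_def split_def by measurable
  have J: "indicator {0<..} t * emeasure lborel {x \<in> A. t < w x} = (\<integral>\<^sup>+x. u t x \<partial>lborel)" for t
  proof -
    have "indicator {0<..} t * emeasure lborel {x \<in> A. t < w x}
        = indicator {0<..} t * (\<integral>\<^sup>+x. indicator {x \<in> A. t < w x} x \<partial>lborel)"
      by (subst nn_integral_indicator) auto
    also have "\<dots> = (\<integral>\<^sup>+x. u t x \<partial>lborel)"
      by (cases "0 < t") (auto simp: u_def indicator_def intro!: nn_integral_cong)
    finally show ?thesis .
  qed
  show "(\<lambda>t. indicator {0<..} t * emeasure lborel {x \<in> A. t < w x}) \<in> borel_measurable borel"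
    unfolding J using lborel.borel_measurable_nn_integral[OF um] by simp
  have "(\<integral>\<^sup>+t. \<integral>\<^sup>+x. u t x \<partial>lborel \<partial>lborel) = (\<integral>\<^sup>+x. \<integral>\<^sup>+t. u t x \<partial>lborel \<partial>lborel)"
    by (rule lborel_pair.Fubini'[symmetric, OF um])
  also have "\<dots> = (\<integral>\<^sup>+x\<in>A. ennreal (w x) \<partial>lborel)"
  proof (rule nn_integral_cong)
    fix x
    have "(\<integral>\<^sup>+t. u t x \<partial>lborel) = (\<integral>\<^sup>+t. indicator A x * indicator {0<..<w x} t \<partial>lborel)"
      by (rule nn_integral_cong) (auto simp: u_def indicator_def)
    also have "\<dots> = indicator A x * emeasure lborel {0<..<w x}" by (rule nn_integral_cmult_indicator) simp
    also have "emeasure lborel {0<..<w x} = ennreal (w x)"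
      by (cases "0 \<le> w x") (auto simp: ennreal_neg)
    finally show "(\<integral>\<^sup>+t. u t x \<partial>lborel) = ennreal (w x) * indicator A x" by (simp add: mult.commute)
  qed
  finally show "(\<integral>\<^sup>+t. indicator {0<..} t * emeasure lborel {x \<in> A. t < w x} \<partial>lborel) = (\<integral>\<^sup>+x\<in>A. ennreal (w x) \<partial>lborel)"
    unfolding J .
qed

text \<open>The estimate is pointwise on the reduced boundary of U. Inside \<Omega> such a point has
  w = t, and f majorizes the weight, being infinite where W gives no normal. Outside \<Omega> the
  point is on the frontier with w \<ge> t, and \<open>outer_normal_at_subset_eq\<close> replaces the
  normal of U by that of \<Omega>.\<close>

lemma weighted_cheeger_level_set_le:
  fixes F :: "'a::euclidean_space \<Rightarrow> real" and \<Omega> :: "'a set"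
  assumes F_even: "\<And>\<xi>. F (- \<xi>) = F \<xi>" and F_hom: "\<And>t \<xi>. F (t *\<^sub>R \<xi>) = \<bar>t\<bar> * F \<xi>"
    and op: "open \<Omega>" and bdd: "bounded \<Omega>" and bd: "C1alpha_boundary \<alpha> \<Omega>"
    and der: "\<And>x. (w has_derivative (\<lambda>h. W x \<bullet> h)) (at x)"
    and per: "finite_perimeter {x \<in> \<Omega>. t < w x}"
    and f: "\<And>x. x \<in> \<Omega> \<Longrightarrow> W x = 0 \<Longrightarrow> f x = \<infinity>"
      "\<And>x. x \<in> \<Omega> \<Longrightarrow> W x \<noteq> 0 \<Longrightarrow> f x = ennreal (\<beta> x * F (W x) / norm (W x))"
    and k: "\<And>x. x \<in> frontier \<Omega> \<Longrightarrow> k x = ennreal (\<beta> x * F (outer_normal \<Omega> x))"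
  shows "weighted_cheeger F \<beta> \<Omega> * emeasure lborel {x \<in> \<Omega>. t < w x}
    \<le> (\<integral>\<^sup>+x. f x * indicator (\<Omega> \<inter> {y. w y = t}) x + indicator {x. t \<le> w x} x * k x
         \<partial>hausdorff_measure (real DIM('a) - 1))"
proof -
  define U where "U = {x \<in> \<Omega>. t < w x}"
  let ?H = "hausdorff_measure (real DIM('a) - 1) :: 'a measure"
  have wc: "continuous_on UNIV w"
    using der by (meson continuous_at_imp_continuous_on has_derivative_continuous)
  have Uop: "open U"
  proof -
    have "open {x. t < w x}" using wc by (intro open_Collect_less) auto
    then show ?thesis using op unfolding U_def by (simp add: Collect_conj_eq open_Int)
  qed
  have Us: "U \<in> sets lebesgue" "\<Omega> \<in> sets lebesgue" using Uop op by auto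
  have sub: "U \<subseteq> \<Omega>" by (auto simp: U_def)
  have le: "indicator (reduced_boundary U) x * ennreal (\<beta> x * F (outer_normal U x))
     \<le> f x * indicator (\<Omega> \<inter> {y. w y = t}) x + indicator {x. t \<le> w x} x * k x" for x
  proof (cases "x \<in> reduced_boundary U")
    case True
    then have fr: "x \<in> frontier U" using reduced_boundary_subset_frontier[OF Us(1)] by blast
    then have xU: "x \<notin> U" "x \<in> closure U" using Uop by (auto simp: frontier_def interior_open)
    have "closure U \<subseteq> {x. t \<le> w x}"
      by (rule closure_minimal) (use wc in \<open>auto simp: U_def intro!: closed_Collect_le\<close>)
    then have wt: "t \<le> w x" using xU by auto
    show ?thesis
    proof (cases "x \<in> \<Omega>")
      case in\<Omega>: True
      then have w: "w x = t" using xU(1) wt by (auto simp: U_def)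
      have "ennreal (\<beta> x * F (outer_normal U x)) \<le> f x"
      proof (cases "W x = 0")
        case True
        then show ?thesis using f(1)[OF in\<Omega>] by simp
      next
        case False
        obtain r where r: "0 < r" "ball x r \<subseteq> \<Omega>" using op in\<Omega> by (meson openE)
        have "outer_normal_at U x ((- W x) /\<^sub>R norm (- W x))"
        proof (rule outer_normal_at_sublevel[OF Us(1) r(1)])
          show "U \<inter> ball x r = {y \<in> ball x r. t - w y < 0}" using r by (auto simp: U_def)
          show "t - w x = 0" using w by simp
          show "((\<lambda>y. t - w y) has_derivative (\<lambda>h. - W x \<bullet> h)) (at x)"
            by (auto intro!: derivative_eq_intros der)
        qed (use False in simp)
        then have "outer_normal U x = (- W x) /\<^sub>R norm (- W x)" by (rule outer_normal_eqI[OF Us(1)])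
        then have "F (outer_normal U x) = F (W x) / norm (W x)"
          by (simp add: F_hom F_even divide_inverse)
        then show ?thesis using f(2)[OF in\<Omega> False] by simp
      qed
      then show ?thesis using True in\<Omega> w by (simp add: add_increasing2)
    next
      case False
      then have xf: "x \<in> frontier \<Omega>"
        using xU(2) closure_mono[OF sub] op by (auto simp: frontier_def interior_open)
      obtain \<nu> where nu: "outer_normal_at U x \<nu>" using True by (auto simp: reduced_boundary_def)
      have "\<nu> = outer_normal \<Omega> x"
        by (rule outer_normal_at_subset_eq[OF Us sub nu C1alpha_boundary_outer_normal(1)[OF op bd xf]])
      then have "outer_normal U x = outer_normal \<Omega> x" using outer_normal_eqI[OF Us(1) nu] by simp
      then show ?thesis using True wt k[OF xf] by (simp add: add_increasing)
    qed
  qed simp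
  show ?thesis
  proof (cases "emeasure lborel U = 0")
    case True
    then show ?thesis unfolding U_def by simp
  next
    case False
    have em: "emeasure lebesgue U = emeasure lborel U" using Uop by simp
    have fin: "emeasure lborel U < \<infinity>" using bounded_subset[OF bdd sub] by (rule emeasure_bounded_finite)
    have "weighted_cheeger F \<beta> \<Omega> \<le> (\<integral>\<^sup>+x. indicator (reduced_boundary U) x * ennreal (\<beta> x * F (outer_normal U x)) \<partial>?H) / emeasure lebesgue U"
      unfolding weighted_cheeger_def
      by (rule INF_lower) (use sub Us False em per in \<open>auto simp: U_def zero_less_iff_neq_zero\<close>)
    also have "\<dots> \<le> (\<integral>\<^sup>+x. f x * indicator (\<Omega> \<inter> {y. w y = t}) x + indicator {x. t \<le> w x} x * k x \<partial>?H) / emeasure lebesgue U"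
      by (intro divide_right_mono_ennreal nn_integral_mono le)
    finally have "weighted_cheeger F \<beta> \<Omega> * emeasure lborel U
       \<le> (\<integral>\<^sup>+x. f x * indicator (\<Omega> \<inter> {y. w y = t}) x + indicator {x. t \<le> w x} x * k x \<partial>?H) / emeasure lborel U * emeasure lborel U"
      unfolding em by (rule mult_right_mono) simp
    also have "\<dots> = (\<integral>\<^sup>+x. f x * indicator (\<Omega> \<inter> {y. w y = t}) x + indicator {x. t \<le> w x} x * k x \<partial>?H)"
      using False fin by (simp add: ennreal_divide_times ennreal_mult_divide_eq)
    finally show ?thesis unfolding U_def .
  qed
qed

lemma borel_measurable_frontier_weight:
  fixes F :: "'a::euclidean_space \<Rightarrow> real" and \<Omega> :: "'a set"
  assumes F_cont: "continuous_on UNIV F" and op: "open \<Omega>" and bd: "C1alpha_boundary \<alpha> \<Omega>"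
    and \<beta>: "continuous_on (closure \<Omega>) \<beta>"
  shows "(\<lambda>x. indicator (frontier \<Omega>) x *\<^sub>R (\<beta> x * F (outer_normal \<Omega> x))) \<in> borel_measurable borel"
proof -
  have frs: "frontier \<Omega> \<subseteq> closure \<Omega>" by (simp add: frontier_def)
  have "continuous_on (frontier \<Omega>) (\<lambda>x. \<beta> x * F (outer_normal \<Omega> x))"
    using continuous_on_subset[OF \<beta> frs] C1alpha_boundary_outer_normal(2)[OF op bd]
    by (intro continuous_on_mult continuous_on_compose2[OF F_cont]) auto
  then show ?thesis by (intro borel_measurable_continuous_on_indicator) auto
qed

lemma weighted_cheeger_integral_le:
  fixes F :: "'a::euclidean_space \<Rightarrow> real" and \<Omega> :: "'a set"
  assumes dim: "DIM('a) \<ge> 2"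
    and F_cont: "continuous_on UNIV F" and F_even: "\<And>\<xi>. F (- \<xi>) = F \<xi>" and F_hom: "\<And>t \<xi>. F (t *\<^sub>R \<xi>) = \<bar>t\<bar> * F \<xi>"
    and op: "open \<Omega>" and bdd: "bounded \<Omega>" and bd: "C1alpha_boundary \<alpha> \<Omega>"
    and \<beta>: "continuous_on (closure \<Omega>) \<beta>"
    and der: "\<And>x. (w has_derivative (\<lambda>h. W x \<bullet> h)) (at x)" and Wc: "continuous_on UNIV W"
    and L: "\<And>x. norm (W x) \<le> L"
  shows "weighted_cheeger F \<beta> \<Omega> * (\<integral>\<^sup>+x\<in>\<Omega>. ennreal (w x) \<partial>lborel)
    \<le> (\<integral>\<^sup>+x\<in>\<Omega>. ennreal (\<beta> x * F (W x)) \<partial>lborel)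
      + (\<integral>\<^sup>+x. ennreal (w x) * (indicator (frontier \<Omega>) x * ennreal (\<beta> x * F (outer_normal \<Omega> x)))
           \<partial>hausdorff_measure (real DIM('a) - 1))"
proof -
  define N where "N = DIM('a) - 1"
  have N: "DIM('a) = Suc N" "1 \<le> N" "real DIM('a) - 1 = real N" using dim by (auto simp: N_def)
  let ?H = "hausdorff_measure (real N) :: 'a measure"
  let ?h = "weighted_cheeger F \<beta> \<Omega>"
  have L0: "0 \<le> L" using order_trans[OF norm_ge_zero L] .
  have lip: "\<bar>w x - w y\<bar> \<le> L * norm (x - y)" for x y
    by (rule gradient_bound_imp_lipschitz[OF convex_UNIV der L]) auto
  have wc: "continuous_on UNIV w"
    using der by (meson continuous_at_imp_continuous_on has_derivative_continuous)
  have [measurable]: "w \<in> borel_measurable borel" "W \<in> borel_measurable borel" "F \<in> borel_measurable borel"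
    using wc Wc F_cont by (auto intro: borel_measurable_continuous_onI)
  have [measurable]: "\<Omega> \<in> sets borel" using op by simp
  have fin: "emeasure lborel \<Omega> < \<infinity>" using bdd by (rule emeasure_bounded_finite)
  have \<beta>m [measurable]: "(\<lambda>x. indicator \<Omega> x *\<^sub>R \<beta> x) \<in> borel_measurable borel"
    using op continuous_on_subset[OF \<beta> closure_subset] by (intro borel_measurable_continuous_on_indicator) auto
  \<comment> \<open>\<beta> is continuous only on the closure of \<Omega>, so it is cut off by the
    indicator to give a Borel function on the whole space.\<close>
  define f where "f x = (if W x = 0 then \<infinity> else ennreal (indicator \<Omega> x *\<^sub>R \<beta> x * F (W x) / norm (W x)))" for x
  have fm: "f \<in> borel_measurable borel" unfolding f_def by measurable
  define k where "k x = ennreal (indicator (frontier \<Omega>) x *\<^sub>R (\<beta> x * F (outer_normal \<Omega> x)))" for x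
  have "(\<lambda>x. indicator (frontier \<Omega>) x *\<^sub>R (\<beta> x * F (outer_normal \<Omega> x))) \<in> borel_measurable borel"
    by (rule borel_measurable_frontier_weight[OF F_cont op bd \<beta>])
  then have km: "k \<in> borel_measurable borel" unfolding k_def by measurable
  have kH: "k \<in> borel_measurable ?H" "f \<in> borel_measurable ?H" "w \<in> borel_measurable ?H"
    using km fm by (simp_all cong: measurable_cong_sets)
  have "upper_integral_le (\<lambda>t. (\<integral>\<^sup>+x. f x * indicator (\<Omega> \<inter> {y. w y = t}) x \<partial>?H)
       + indicator {0<..} t * (\<integral>\<^sup>+x. indicator {x. t \<le> w x} x * k x \<partial>?H))
     ((\<integral>\<^sup>+y. f y * (ennreal (norm (W y)) * indicator \<Omega> y) \<partial>lborel) + (\<integral>\<^sup>+x. ennreal (w x) * k x \<partial>?H))"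
    by (intro upper_integral_le_add coarea_le[OF N(1,2) der Wc L _ fin fm] upper_integral_layer_cake kH) simp
  then obtain g where g: "g \<in> borel_measurable borel"
    "\<And>t. (\<integral>\<^sup>+x. f x * indicator (\<Omega> \<inter> {y. w y = t}) x \<partial>?H)
       + indicator {0<..} t * (\<integral>\<^sup>+x. indicator {x. t \<le> w x} x * k x \<partial>?H) \<le> g t"
    "(\<integral>\<^sup>+t. g t \<partial>lborel) \<le> (\<integral>\<^sup>+y. f y * (ennreal (norm (W y)) * indicator \<Omega> y) \<partial>lborel) + (\<integral>\<^sup>+x. ennreal (w x) * k x \<partial>?H)"
    unfolding upper_integral_le_def by blast
  \<comment> \<open>Finite perimeter is available for almost every level only. This suffices, as
    both sides of the inequality are now Borel in t: the left by the layer cake formula, the right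
    being the majorant g.\<close>
  have AE: "AE t in lborel. ?h * (indicator {0<..} t * emeasure lborel {x \<in> \<Omega>. t < w x}) \<le> g t"
    using AE_finite_perimeter_level_sets[OF op bdd bd L0 lip wc]
  proof eventually_elim
    case (elim t)
    show ?case
    proof (cases "0 < t")
      case True
      have "?h * emeasure lborel {x \<in> \<Omega>. t < w x}
         \<le> (\<integral>\<^sup>+x. f x * indicator (\<Omega> \<inter> {y. w y = t}) x + indicator {x. t \<le> w x} x * k x \<partial>?H)"
        by (rule weighted_cheeger_level_set_le[OF F_even F_hom op bdd bd der elim, unfolded N(3)])
          (auto simp: f_def k_def)
      also have "\<dots> = (\<integral>\<^sup>+x. f x * indicator (\<Omega> \<inter> {y. w y = t}) x \<partial>?H) + (\<integral>\<^sup>+x. indicator {x. t \<le> w x} x * k x \<partial>?H)"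
      proof (rule nn_integral_add)
        have "\<Omega> \<inter> {y. w y = t} \<in> sets borel" "{x. t \<le> w x} \<in> sets borel" by measurable
        then show "(\<lambda>x. f x * indicator (\<Omega> \<inter> {y. w y = t}) x) \<in> borel_measurable ?H"
          "(\<lambda>x. indicator {x. t \<le> w x} x * k x) \<in> borel_measurable ?H"
          using kH by (auto intro!: borel_measurable_times_ennreal borel_measurable_indicator)
      qed
      also have "\<dots> \<le> g t" using g(2)[of t] True by simp
      finally show ?thesis using True by simp
    qed simp
  qed
  have "?h * (\<integral>\<^sup>+x\<in>\<Omega>. ennreal (w x) \<partial>lborel)
     = (\<integral>\<^sup>+t. ?h * (indicator {0<..} t * emeasure lborel {x \<in> \<Omega>. t < w x}) \<partial>lborel)"
    using nn_integral_level_sets(1)[of \<Omega> w]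
    by (subst nn_integral_cmult) (simp_all add: nn_integral_level_sets(2))
  also have "\<dots> \<le> (\<integral>\<^sup>+t. g t \<partial>lborel)" by (rule nn_integral_mono_AE[OF AE])
  also note g(3)
  \<comment> \<open>At critical points the left integrand is infinity times 0, which is 0, and the
    right one is 0 because F 0 = 0.\<close>
  also have "(\<integral>\<^sup>+y. f y * (ennreal (norm (W y)) * indicator \<Omega> y) \<partial>lborel) = (\<integral>\<^sup>+x\<in>\<Omega>. ennreal (\<beta> x * F (W x)) \<partial>lborel)"
  proof (rule nn_integral_cong)
    fix y
    have "F 0 = 0" using F_hom[of 0 0] by simp
    then show "f y * (ennreal (norm (W y)) * indicator \<Omega> y) = ennreal (\<beta> y * F (W y)) * indicator \<Omega> y"
      by (auto simp: f_def indicator_def ennreal_mult''[symmetric])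
  qed
  also have "(\<integral>\<^sup>+x. ennreal (w x) * k x \<partial>?H) = (\<integral>\<^sup>+x. ennreal (w x) * (indicator (frontier \<Omega>) x * ennreal (\<beta> x * F (outer_normal \<Omega> x))) \<partial>?H)"
    by (rule nn_integral_cong) (auto simp: k_def indicator_def)
  finally show ?thesis unfolding N(3) .
qed

section \<open>Powers of test functions and Young's inequality\<close>

text \<open>At 0 the difference quotient is bounded by |h| powr (p - 1), which tends to 0 since p >
  1. So the power of |\<phi>| remains differentiable at the zeros of \<phi>.\<close>

lemma DERIV_abs_powr:
  fixes s p :: real
  assumes p: "1 < p"
  shows "((\<lambda>s. \<bar>s\<bar> powr p) has_real_derivative p * \<bar>s\<bar> powr (p - 1) * sgn s) (at s)"
proof (cases s "0::real" rule: linorder_cases)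
  case equal
  have "((\<lambda>h. (\<bar>0 + h\<bar> powr p - \<bar>0\<bar> powr p) / h) \<longlongrightarrow> 0) (at 0)"
  proof (rule Lim_null_comparison)
    show "\<forall>\<^sub>F h in at 0. norm ((\<bar>0 + h\<bar> powr p - \<bar>0\<bar> powr p) / h) \<le> \<bar>h\<bar> powr (p - 1)"
      by (intro always_eventually allI) (auto simp: powr_diff)
    have "continuous_on UNIV (\<lambda>h::real. \<bar>h\<bar> powr (p - 1))"
      by (intro continuous_on_powr' continuous_intros) (use p in auto)
    then have "isCont (\<lambda>h::real. \<bar>h\<bar> powr (p - 1)) 0"
      by (simp add: continuous_on_eq_continuous_at)
    from isContD[OF this] show "((\<lambda>h::real. \<bar>h\<bar> powr (p - 1)) \<longlongrightarrow> 0) (at 0)" by simp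
  qed
  then show ?thesis using equal by (simp add: DERIV_def)
next
  case greater
  have "((\<lambda>s. s powr p) has_real_derivative p * s powr (p - 1)) (at s)"
    by (rule has_real_derivative_powr[OF greater])
  then have "((\<lambda>s. \<bar>s\<bar> powr p) has_real_derivative p * s powr (p - 1)) (at s)"
    by (rule has_field_derivative_transform_within_open[where S="{0<..}"]) (use greater in auto)
  then show ?thesis using greater by simp
next
  case less
  have "((\<lambda>s. (- s) powr p) has_real_derivative p * (- s) powr (p - 1) * (- 1)) (at s)"
    by (rule DERIV_chain2[OF has_real_derivative_powr]) (use less in \<open>auto intro!: derivative_eq_intros\<close>)
  then have "((\<lambda>s. \<bar>s\<bar> powr p) has_real_derivative p * (- s) powr (p - 1) * (- 1)) (at s)"
    by (rule has_field_derivative_transform_within_open[where S="{..<0}"]) (use less in auto)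
  then show ?thesis using less by simp
qed

text \<open>The jump of sgn at 0 disappears when the function is written as a difference of powers
  of the positive and negative parts.\<close>

lemma continuous_on_abs_powr_sgn:
  fixes q :: real
  assumes "0 < q"
  shows "continuous_on UNIV (\<lambda>s::real. \<bar>s\<bar> powr q * sgn s)"
proof -
  have eq: "(\<lambda>s::real. \<bar>s\<bar> powr q * sgn s) = (\<lambda>s. (max s 0) powr q - (max (- s) 0) powr q)"
    by (auto simp: fun_eq_iff max_def sgn_if)
  show ?thesis unfolding eq
    by (intro continuous_on_diff continuous_on_powr' continuous_intros) (use assms in auto)
qed

text \<open>Convexity of the power at the points x/(1-e) and y/e with weights 1-e and e. For small e
  the coefficient of x is close to 1, whereas the large coefficient of y will only multiply
  approximation errors that tend to 0 with e fixed.\<close>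

lemma powr_add_le_weighted:
  fixes x y e p :: real
  assumes e: "0 < e" "e < 1" and p: "1 \<le> p" and xy: "0 \<le> x" "0 \<le> y"
  shows "(x + y) powr p \<le> (1 - e) powr (1 - p) * x powr p + e powr (1 - p) * y powr p"
proof -
  have ge1: "1 \<le> c powr (1 - p)" if "0 < c" "c < 1" for c :: real
    using powr_mono'[of "1 - p" 0 c] that p by simp
  consider "x = 0" | "y = 0" | "0 < x" "0 < y" using xy by force
  then show ?thesis
  proof cases
    case 1
    then show ?thesis using mult_right_mono[OF ge1[OF e], of "y powr p"] by simp
  next
    case 2
    then show ?thesis using mult_right_mono[OF ge1[of "1 - e"], of "x powr p"] e by simp
  next
    case 3
    have "((1 - e) * (x / (1 - e)) + e * (y / e)) powr p \<le> (1 - e) * (x / (1 - e)) powr p + e * (y / e) powr p"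
      using convex_onD[OF powr_convex[OF p], of e "x / (1 - e)" "y / e"] e 3 by simp
    moreover have "c * (z / c) powr p = c powr (1 - p) * z powr p" if "0 < c" "0 \<le> z" for c z :: real
      using that by (simp add: powr_divide powr_diff)
    ultimately show ?thesis using e xy by simp
  qed
qed

lemma nn_integral_lebesgue_on:
  assumes "S \<in> sets lebesgue"
  shows "(\<integral>\<^sup>+x. f x \<partial>lebesgue_on S) = (\<integral>\<^sup>+x\<in>S. f x \<partial>lborel)"
  using assms by (subst nn_integral_restrict_space) (auto simp: nn_integral_completion)

text \<open>Apply the weighted inequality to \<open>|\<phi>|\<^sup>p\<close> and use Young's inequality
  \<open>\<beta> p |\<phi>|\<^sup>p\<^sup>-\<^sup>1 F(\<nabla>\<phi>) \<le> F(\<nabla>\<phi>)\<^sup>p + (p - 1) \<beta>\<^sup>p\<^sup>' |\<phi>|\<^sup>p\<close>.\<close>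
lemma weighted_cheeger_powr_le:
  fixes F :: "'a::euclidean_space \<Rightarrow> real" and \<Omega> :: "'a set"
  assumes dim: "DIM('a) \<ge> 2" and p: "1 < p"
    and F_cont: "continuous_on UNIV F" and F_even: "\<And>\<xi>. F (- \<xi>) = F \<xi>" and F_hom: "\<And>t \<xi>. F (t *\<^sub>R \<xi>) = \<bar>t\<bar> * F \<xi>"
    and F_nonneg: "\<And>\<xi>. 0 \<le> F \<xi>"
    and op: "open \<Omega>" and bdd: "bounded \<Omega>" and bd: "C1alpha_boundary \<alpha> \<Omega>"
    and \<beta>: "continuous_on (closure \<Omega>) \<beta>" "\<And>x. x \<in> closure \<Omega> \<Longrightarrow> 0 \<le> \<beta> x"
    and C: "\<And>x. x \<in> closure \<Omega> \<Longrightarrow> \<beta> x powr (p / (p - 1)) \<le> C"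
    and \<phi>: "C1c_with_grad UNIV \<phi> G"
  shows "weighted_cheeger F \<beta> \<Omega> * (\<integral>\<^sup>+x. ennreal (\<bar>\<phi> x\<bar> powr p) \<partial>lebesgue_on \<Omega>)
    \<le> (\<integral>\<^sup>+x. ennreal (F (G x) powr p) \<partial>lebesgue_on \<Omega>)
      + ennreal ((p - 1) * C) * (\<integral>\<^sup>+x. ennreal (\<bar>\<phi> x\<bar> powr p) \<partial>lebesgue_on \<Omega>)
      + (\<integral>\<^sup>+x. indicator (frontier \<Omega>) x * ennreal (\<beta> x * \<bar>\<phi> x\<bar> powr p * F (outer_normal \<Omega> x))
           \<partial>hausdorff_measure (real DIM('a) - 1))"
proof -
  have der: "\<And>x. (\<phi> has_derivative (\<lambda>h. G x \<bullet> h)) (at x)" and Gc: "continuous_on UNIV G"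
    and K: "compact (closure {x. \<phi> x \<noteq> 0})"
    using \<phi> by (auto simp: C1c_with_grad_def)
  have phic: "continuous_on UNIV \<phi>"
    using der by (meson continuous_at_imp_continuous_on has_derivative_continuous)
  define w where "w x = \<bar>\<phi> x\<bar> powr p" for x
  define W where "W x = (p * \<bar>\<phi> x\<bar> powr (p - 1) * sgn (\<phi> x)) *\<^sub>R G x" for x
  have Wd: "(w has_derivative (\<lambda>h. W x \<bullet> h)) (at x)" for x
    using has_derivative_compose[OF der DERIV_abs_powr[OF p, unfolded has_field_derivative_def], of x]
    by (simp add: w_def[abs_def] W_def)
  have Wc: "continuous_on UNIV W"
    unfolding W_def mult.assoc
    by (intro continuous_intros Gc continuous_on_compose2[OF continuous_on_abs_powr_sgn phic]) (use p in auto)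
  have "bounded (W ` closure {x. \<phi> x \<noteq> 0})"
    by (rule compact_imp_bounded[OF compact_continuous_image[OF continuous_on_subset[OF Wc] K]]) simp
  then obtain B where B: "\<forall>x\<in>closure {x. \<phi> x \<noteq> 0}. norm (W x) \<le> B" unfolding bounded_iff by blast
  have WB: "norm (W x) \<le> max B 0" for x
  proof (cases "\<phi> x = 0")
    case True
    then show ?thesis by (simp add: W_def)
  next
    case False
    then have "x \<in> closure {x. \<phi> x \<noteq> 0}" by (intro subsetD[OF closure_subset]) simp
    then show ?thesis using B by (simp add: le_max_iff_disj)
  qed
  have [measurable]: "\<phi> \<in> borel_measurable borel" "G \<in> borel_measurable borel" "F \<in> borel_measurable borel"
    using phic Gc F_cont by (auto intro: borel_measurable_continuous_onI)
  have [measurable]: "\<Omega> \<in> sets borel" using op by simp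
  have \<Omega>l: "\<Omega> \<in> sets lebesgue" using op by simp
  have Young: "\<beta> x * F (W x) \<le> F (G x) powr p + (p - 1) * C * \<bar>\<phi> x\<bar> powr p" if x: "x \<in> \<Omega>" for x
  proof -
    have xc: "x \<in> closure \<Omega>" using x closure_subset by blast
    define q where "q = p / (p - 1)"
    define y where "y = \<beta> x * \<bar>\<phi> x\<bar> powr (p - 1)"
    have q: "1 < q" "1 / p + 1 / q = 1" "p / q = p - 1" using p by (auto simp: q_def field_simps)
    have y0: "0 \<le> y" using \<beta>(2)[OF xc] by (simp add: y_def)
    have "F (G x) * y \<le> F (G x) powr p / p + y powr q / q"
      by (rule Youngs_inequality[OF p q(1,2) F_nonneg y0])
    then have "p * (F (G x) * y) \<le> p * (F (G x) powr p / p + y powr q / q)" using p by (intro mult_left_mono) auto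
    also have "\<dots> = F (G x) powr p + (p / q) * y powr q" using p by (simp add: distrib_left)
    also have "\<dots> = F (G x) powr p + (p - 1) * y powr q" unfolding q(3) ..
    also have "y powr q = \<beta> x powr q * \<bar>\<phi> x\<bar> powr p"
      using p \<beta>(2)[OF xc] by (simp add: y_def powr_mult powr_powr q_def)
    also have "\<dots> \<le> C * \<bar>\<phi> x\<bar> powr p" using C[OF xc] by (intro mult_right_mono) (auto simp: q_def)
    finally have "p * (F (G x) * y) \<le> F (G x) powr p + (p - 1) * (C * \<bar>\<phi> x\<bar> powr p)" using p by simp
    moreover have "\<beta> x * F (W x) \<le> p * (F (G x) * y)"
    proof (cases "\<phi> x = 0")
      case True
      then show ?thesis using F_hom[of 0 0] by (simp add: W_def y_def)
    next
      case False
      then show ?thesis using p by (simp add: W_def y_def F_hom abs_mult abs_sgn_eq)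
    qed
    ultimately show ?thesis by (simp add: mult.assoc)
  qed
  \<comment> \<open>Nonnegativity of C is read off at a point of \<Omega>; if \<Omega> is empty, C
    is unconstrained, but then the integrands vanish as well.\<close>
  have C0: "0 \<le> (p - 1) * C" if "x \<in> \<Omega>" for x
    using order_trans[OF powr_ge_zero C[OF subsetD[OF closure_subset that]]] p by simp
  have "weighted_cheeger F \<beta> \<Omega> * (\<integral>\<^sup>+x. ennreal (\<bar>\<phi> x\<bar> powr p) \<partial>lebesgue_on \<Omega>)
     = weighted_cheeger F \<beta> \<Omega> * (\<integral>\<^sup>+x\<in>\<Omega>. ennreal (w x) \<partial>lborel)"
    by (simp add: nn_integral_lebesgue_on[OF \<Omega>l] w_def)
  also have "\<dots> \<le> (\<integral>\<^sup>+x\<in>\<Omega>. ennreal (\<beta> x * F (W x)) \<partial>lborel)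
      + (\<integral>\<^sup>+x. ennreal (w x) * (indicator (frontier \<Omega>) x * ennreal (\<beta> x * F (outer_normal \<Omega> x)))
           \<partial>hausdorff_measure (real DIM('a) - 1))"
    by (rule weighted_cheeger_integral_le[OF dim F_cont F_even F_hom op bdd bd \<beta>(1) Wd Wc WB])
  also have "(\<integral>\<^sup>+x\<in>\<Omega>. ennreal (\<beta> x * F (W x)) \<partial>lborel)
     \<le> (\<integral>\<^sup>+x. ennreal (F (G x) powr p) * indicator \<Omega> x + ennreal ((p - 1) * C) * (ennreal (\<bar>\<phi> x\<bar> powr p) * indicator \<Omega> x) \<partial>lborel)"
  proof (rule nn_integral_mono)
    fix x
    show "ennreal (\<beta> x * F (W x)) * indicator \<Omega> x
       \<le> ennreal (F (G x) powr p) * indicator \<Omega> x + ennreal ((p - 1) * C) * (ennreal (\<bar>\<phi> x\<bar> powr p) * indicator \<Omega> x)"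
    proof (cases "x \<in> \<Omega>")
      case True
      have "ennreal (\<beta> x * F (W x)) \<le> ennreal (F (G x) powr p + (p - 1) * C * \<bar>\<phi> x\<bar> powr p)"
        by (rule ennreal_leI[OF Young[OF True]])
      also have "\<dots> = ennreal (F (G x) powr p) + ennreal ((p - 1) * C) * ennreal (\<bar>\<phi> x\<bar> powr p)"
        using C0[OF True] by (simp add: ennreal_mult)
      finally show ?thesis using True by simp
    qed simp
  qed
  also have "\<dots> = (\<integral>\<^sup>+x\<in>\<Omega>. ennreal (F (G x) powr p) \<partial>lborel) + ennreal ((p - 1) * C) * (\<integral>\<^sup>+x\<in>\<Omega>. ennreal (\<bar>\<phi> x\<bar> powr p) \<partial>lborel)"
    by (simp add: nn_integral_add nn_integral_cmult)
  also have "(\<integral>\<^sup>+x. ennreal (w x) * (indicator (frontier \<Omega>) x * ennreal (\<beta> x * F (outer_normal \<Omega> x)))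
           \<partial>hausdorff_measure (real DIM('a) - 1))
     = (\<integral>\<^sup>+x. indicator (frontier \<Omega>) x * ennreal (\<beta> x * \<bar>\<phi> x\<bar> powr p * F (outer_normal \<Omega> x))
           \<partial>hausdorff_measure (real DIM('a) - 1))"
    by (intro nn_integral_cong) (simp add: w_def indicator_def mult_ac flip: ennreal_mult')
  finally show ?thesis by (simp add: nn_integral_lebesgue_on[OF \<Omega>l] add_right_mono)
qed

section \<open>Passage to Sobolev functions and traces\<close>

lemma nn_integral_weighted_le:
  fixes u x y :: "'a \<Rightarrow> ennreal"
  assumes "\<And>z. z \<in> space M \<Longrightarrow> u z \<le> A * x z + B * y z"
    and "x \<in> borel_measurable M" "y \<in> borel_measurable M"
  shows "(\<integral>\<^sup>+z. u z \<partial>M) \<le> A * (\<integral>\<^sup>+z. x z \<partial>M) + B * (\<integral>\<^sup>+z. y z \<partial>M)"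
proof -
  have "(\<integral>\<^sup>+z. u z \<partial>M) \<le> (\<integral>\<^sup>+z. A * x z + B * y z \<partial>M)" by (rule nn_integral_mono) (rule assms)
  also have "\<dots> = A * (\<integral>\<^sup>+z. x z \<partial>M) + B * (\<integral>\<^sup>+z. y z \<partial>M)"
    using assms by (simp add: nn_integral_add nn_integral_cmult)
  finally show ?thesis .
qed

theorem theorem6p6:
  fixes F :: "'a::euclidean_space \<Rightarrow> real" and p a b \<alpha> :: real
    and \<Omega> :: "'a set" and \<beta> :: "'a \<Rightarrow> real"
  assumes dim: "DIM('a) \<ge> 2"
    and p: "1 < p"
    and F_convex: "convex_on UNIV F"
    and F_even: "\<And>\<xi>. F (- \<xi>) = F \<xi>"
    and F_hom: "\<And>t \<xi>. F (t *\<^sub>R \<xi>) = \<bar>t\<bar> * F \<xi>"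
    and ab: "0 < a" "a \<le> b"
    and F_bounds: "\<And>\<xi>. a * norm \<xi> \<le> F \<xi> \<and> F \<xi> \<le> b * norm \<xi>"
    and F_C2: "C2_on (UNIV - {0}) F"
    and F_hess: "hessian_posdef_on (UNIV - {0}) (\<lambda>\<xi>. F \<xi> powr p)"
    and \<alpha>: "0 < \<alpha>" "\<alpha> < 1"
    and \<Omega>: "open \<Omega>" "bounded \<Omega>" "C1alpha_boundary \<alpha> \<Omega>"
    and \<beta>_cont: "continuous_on (closure \<Omega>) \<beta>"
    and \<beta>_nonneg: "\<And>x. x \<in> closure \<Omega> \<Longrightarrow> 0 \<le> \<beta> x"
    and \<beta>_pos: "(\<integral>\<^sup>+ x. indicator (frontier \<Omega>) x * ennreal (\<beta> x * F (outer_normal \<Omega> x))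
                  \<partial>hausdorff_measure (real DIM('a) - 1)) > 0"
  shows "weighted_cheeger F \<beta> \<Omega>
           \<le> robin_ev1 F p \<beta> \<Omega> + ennreal ((p - 1) * (SUP x \<in> closure \<Omega>. \<beta> x powr (p / (p - 1))))"
proof -
  define H where "H = (hausdorff_measure (real DIM('a) - 1) :: 'a measure)"
  define C where "C = (SUP x \<in> closure \<Omega>. \<beta> x powr (p / (p - 1)))"
  have F_cont: "continuous_on UNIV F" using F_convex by (rule convex_on_continuous[OF open_UNIV])
  have F_nonneg: "0 \<le> F \<xi>" for \<xi>
    using F_bounds[of \<xi>] ab by (meson less_imp_le mult_nonneg_nonneg norm_ge_zero order_trans)
  \<comment> \<open>Convexity at the midpoint of 2*y and 2*(x - y), together with homogeneity, is
    the triangle inequality for F.\<close>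
  have F_le: "F x \<le> F y + b * norm (x - y)" for x y
  proof -
    have "F ((1 - 1/2) *\<^sub>R (2 *\<^sub>R y) + (1/2) *\<^sub>R (2 *\<^sub>R (x - y))) \<le> (1 - 1/2) * F (2 *\<^sub>R y) + (1/2) * F (2 *\<^sub>R (x - y))"
      by (rule convex_onD[OF F_convex]) auto
    also have "(1 - 1/2) *\<^sub>R (2 *\<^sub>R y) + (1/2) *\<^sub>R (2 *\<^sub>R (x - y)) = x" by simp
    also have "(1 - 1/2) * F (2 *\<^sub>R y) + (1/2) * F (2 *\<^sub>R (x - y)) = F y + F (x - y)" by (simp add: F_hom)
    finally show ?thesis using F_bounds[of "x - y"] by linarith
  qed
  have comp: "compact (closure \<Omega>)" using \<Omega> by (simp add: compact_closure)
  have pow_cont: "continuous_on (closure \<Omega>) (\<lambda>x. \<beta> x powr (p / (p - 1)))"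
    using p \<beta>_nonneg by (intro continuous_on_powr' continuous_intros \<beta>_cont) auto
  have C: "\<beta> x powr (p / (p - 1)) \<le> C" if "x \<in> closure \<Omega>" for x
    unfolding C_def using that
    by (intro cSUP_upper bounded_imp_bdd_above compact_imp_bounded compact_continuous_image pow_cont comp)
  have "bounded (\<beta> ` closure \<Omega>)" by (intro compact_imp_bounded compact_continuous_image \<beta>_cont comp)
  then obtain B0 where B0: "\<forall>x\<in>closure \<Omega>. norm (\<beta> x) \<le> B0" unfolding bounded_iff by blast
  have frs: "frontier \<Omega> \<subseteq> closure \<Omega>" by (simp add: frontier_def)
  have [measurable]: "F \<in> borel_measurable borel" using F_cont by (rule borel_measurable_continuous_onI)
  have \<Omega>l: "\<Omega> \<in> sets lebesgue" using \<Omega> by simp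
  have weight: "(\<lambda>x. indicator (frontier \<Omega>) x *\<^sub>R (\<beta> x * F (outer_normal \<Omega> x))) \<in> borel_measurable H"
    using borel_measurable_frontier_weight[OF F_cont \<Omega>(1,3) \<beta>_cont] by (simp add: H_def cong: measurable_cong_sets)
  \<comment> \<open>Dominates the boundary weight \<beta> F(\<nu>), so that convergence of the
    traces in the unweighted norm controls the weighted boundary term.\<close>
  define K where "K = max B0 0 * b"
  have K0: "0 \<le> K" using ab by (simp add: K_def)
  have K: "0 \<le> \<beta> x * F (outer_normal \<Omega> x)" "\<beta> x * F (outer_normal \<Omega> x) \<le> K" if x: "x \<in> frontier \<Omega>" for x
  proof -
    have "norm (outer_normal \<Omega> x) = 1"
      using C1alpha_boundary_outer_normal(1)[OF \<Omega>(1,3) x] by (simp add: outer_normal_at_def)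
    then have "F (outer_normal \<Omega> x) \<le> b" using F_bounds[of "outer_normal \<Omega> x"] by simp
    moreover have "0 \<le> \<beta> x" "\<beta> x \<le> max B0 0" using \<beta>_nonneg B0 x frs by (auto simp: le_max_iff_disj)
    ultimately show "0 \<le> \<beta> x * F (outer_normal \<Omega> x)" "\<beta> x * F (outer_normal \<Omega> x) \<le> K"
      using F_nonneg unfolding K_def by (auto intro!: mult_mono)
  qed
  have "weighted_cheeger F \<beta> \<Omega> \<le> robin_quotient F p \<beta> \<Omega> v g t + ennreal ((p - 1) * C)"
    if sob: "sobolev p \<Omega> v g" and tr: "sobolev_trace p \<Omega> v g t"
      and nz: "(\<integral>\<^sup>+ x. ennreal (\<bar>v x\<bar> powr p) \<partial>lebesgue_on \<Omega>) \<noteq> 0" for v g t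
  proof -
    let ?M = "lebesgue_on \<Omega>"
    define V where "V = (\<integral>\<^sup>+ x. ennreal (\<bar>v x\<bar> powr p) \<partial>?M)"
    define R where "R = (\<integral>\<^sup>+ x. ennreal (F (g x) powr p) \<partial>?M)"
    define S where "S = (\<integral>\<^sup>+ x. indicator (frontier \<Omega>) x * ennreal (\<beta> x * \<bar>t x\<bar> powr p * F (outer_normal \<Omega> x)) \<partial>H)"
    have [measurable]: "v \<in> borel_measurable ?M" "g \<in> borel_measurable ?M"
      using sob by (auto simp: sobolev_def)
    have Vfin: "V < \<infinity>"
    proof -
      have "integrable ?M (\<lambda>x. \<bar>v x\<bar> powr p)" using sob by (simp add: sobolev_def)
      then show ?thesis unfolding V_def by (simp add: integrable_iff_bounded)
    qed
    obtain \<phi> G where \<phi>: "\<And>k::nat. C1c_with_grad UNIV (\<phi> k) (G k)"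
      and lim1: "(\<lambda>k. \<integral>\<^sup>+ x. ennreal (\<bar>\<phi> k x - v x\<bar> powr p) \<partial>?M) \<longlonglongrightarrow> 0"
      and lim2: "(\<lambda>k. \<integral>\<^sup>+ x. ennreal (norm (G k x - g x) powr p) \<partial>?M) \<longlonglongrightarrow> 0"
      and lim3: "(\<lambda>k. \<integral>\<^sup>+ x. indicator (frontier \<Omega>) x * ennreal (\<bar>\<phi> k x - t x\<bar> powr p) \<partial>H) \<longlonglongrightarrow> 0"
      and tm: "t \<in> borel_measurable borel"
      using tr unfolding sobolev_trace_def H_def by blast
    define Vk where "Vk k = (\<integral>\<^sup>+ x. ennreal (\<bar>\<phi> k x\<bar> powr p) \<partial>?M)" for k
    define Rk where "Rk k = (\<integral>\<^sup>+ x. ennreal (F (G k x) powr p) \<partial>?M)" for k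
    define Sk where "Sk k = (\<integral>\<^sup>+ x. indicator (frontier \<Omega>) x * ennreal (\<beta> x * \<bar>\<phi> k x\<bar> powr p * F (outer_normal \<Omega> x)) \<partial>H)" for k
    define E1 where "E1 k = (\<integral>\<^sup>+ x. ennreal (\<bar>\<phi> k x - v x\<bar> powr p) \<partial>?M)" for k
    define E2 where "E2 k = (\<integral>\<^sup>+ x. ennreal (norm (G k x - g x) powr p) \<partial>?M)" for k
    define E3 where "E3 k = (\<integral>\<^sup>+ x. indicator (frontier \<Omega>) x * ennreal (\<bar>\<phi> k x - t x\<bar> powr p) \<partial>H)" for k
    have cont: "continuous_on UNIV (\<phi> k)" "continuous_on UNIV (G k)" for k
      using \<phi>[of k] unfolding C1c_with_grad_def
      by (meson continuous_at_imp_continuous_on has_derivative_continuous, blast)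
    have phib: "\<phi> k \<in> borel_measurable borel" "G k \<in> borel_measurable borel" for k
      using cont by (auto intro: borel_measurable_continuous_onI)
    have [measurable]: "\<phi> k \<in> borel_measurable ?M" "G k \<in> borel_measurable ?M" for k
      using phib[of k] by (auto intro!: measurable_restrict_space1 measurable_completion)
    have [measurable]: "\<phi> k \<in> borel_measurable H" "t \<in> borel_measurable H" "frontier \<Omega> \<in> sets H" for k
      using phib(1)[of k] tm by (auto simp: H_def cong: measurable_cong_sets)
    have basic: "weighted_cheeger F \<beta> \<Omega> * Vk k \<le> Rk k + ennreal ((p - 1) * C) * Vk k + Sk k" for k
      unfolding Vk_def Rk_def Sk_def H_def
      by (rule weighted_cheeger_powr_le[OF dim p F_cont F_even F_hom F_nonneg \<Omega> \<beta>_cont \<beta>_nonneg C \<phi>])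
    \<comment> \<open>One factor (1 - e) powr (1 - p) comes from comparing v with \<phi> k on the
      left, the other from comparing \<phi> k with v, g and t on the right. A real h below the
      Cheeger constant keeps every coefficient of the error terms finite, so that these vanish in
      the limit over k even if the Cheeger constant is infinite.\<close>
    have approx: "ennreal h * V \<le> ennreal ((1 - e) powr (1 - p)) * (ennreal ((1 - e) powr (1 - p)) * (R + ennreal ((p - 1) * C) * V + S))"
      if h: "ennreal h \<le> weighted_cheeger F \<beta> \<Omega>" and e: "0 < e" "e < 1" for h e
    proof -
      define A B where "A = (1 - e) powr (1 - p)" and "B = e powr (1 - p)"
      have AB: "0 \<le> A" "0 \<le> B" by (auto simp: A_def B_def)
      have p1: "1 \<le> p" using p by simp
      have V_le: "V \<le> ennreal A * Vk k + ennreal B * E1 k" for k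
        unfolding V_def Vk_def E1_def
      proof (rule nn_integral_weighted_le)
        fix x
        have "\<bar>v x\<bar> powr p \<le> (\<bar>\<phi> k x\<bar> + \<bar>\<phi> k x - v x\<bar>) powr p" using p by (intro powr_mono2) auto
        also have "\<dots> \<le> A * \<bar>\<phi> k x\<bar> powr p + B * \<bar>\<phi> k x - v x\<bar> powr p"
          unfolding A_def B_def by (rule powr_add_le_weighted[OF e p1]) auto
        finally show "ennreal (\<bar>v x\<bar> powr p) \<le> ennreal A * ennreal (\<bar>\<phi> k x\<bar> powr p) + ennreal B * ennreal (\<bar>\<phi> k x - v x\<bar> powr p)"
          using AB by (simp add: ennreal_leI flip: ennreal_mult ennreal_plus)
      qed measurable
      have Vk_le: "Vk k \<le> ennreal A * V + ennreal B * E1 k" for k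
        unfolding V_def Vk_def E1_def
      proof (rule nn_integral_weighted_le)
        fix x
        have "\<bar>\<phi> k x\<bar> powr p \<le> (\<bar>v x\<bar> + \<bar>\<phi> k x - v x\<bar>) powr p" using p by (intro powr_mono2) auto
        also have "\<dots> \<le> A * \<bar>v x\<bar> powr p + B * \<bar>\<phi> k x - v x\<bar> powr p"
          unfolding A_def B_def by (rule powr_add_le_weighted[OF e p1]) auto
        finally show "ennreal (\<bar>\<phi> k x\<bar> powr p) \<le> ennreal A * ennreal (\<bar>v x\<bar> powr p) + ennreal B * ennreal (\<bar>\<phi> k x - v x\<bar> powr p)"
          using AB by (simp add: ennreal_leI flip: ennreal_mult ennreal_plus)
      qed measurable
      have Rk_le: "Rk k \<le> ennreal A * R + ennreal (B * b powr p) * E2 k" for k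
        unfolding R_def Rk_def E2_def
      proof (rule nn_integral_weighted_le)
        fix x
        have "F (G k x) powr p \<le> (F (g x) + b * norm (G k x - g x)) powr p"
          using p F_nonneg F_le by (intro powr_mono2) auto
        also have "\<dots> \<le> A * F (g x) powr p + B * (b * norm (G k x - g x)) powr p"
          unfolding A_def B_def using ab F_nonneg by (intro powr_add_le_weighted[OF e p1]) auto
        also have "\<dots> = A * F (g x) powr p + (B * b powr p) * norm (G k x - g x) powr p"
          using ab by (simp add: powr_mult)
        finally show "ennreal (F (G k x) powr p) \<le> ennreal A * ennreal (F (g x) powr p) + ennreal (B * b powr p) * ennreal (norm (G k x - g x) powr p)"
          using AB by (simp add: ennreal_leI flip: ennreal_mult ennreal_plus)
      qed measurable
      have Sk_le: "Sk k \<le> ennreal A * S + ennreal (B * K) * E3 k" for k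
        unfolding S_def Sk_def E3_def
      proof (rule nn_integral_weighted_le)
        fix x
        show "indicator (frontier \<Omega>) x * ennreal (\<beta> x * \<bar>\<phi> k x\<bar> powr p * F (outer_normal \<Omega> x))
          \<le> ennreal A * (indicator (frontier \<Omega>) x * ennreal (\<beta> x * \<bar>t x\<bar> powr p * F (outer_normal \<Omega> x)))
            + ennreal (B * K) * (indicator (frontier \<Omega>) x * ennreal (\<bar>\<phi> k x - t x\<bar> powr p))"
        proof (cases "x \<in> frontier \<Omega>")
          case True
          let ?c = "\<beta> x * F (outer_normal \<Omega> x)"
          have "\<bar>\<phi> k x\<bar> powr p \<le> (\<bar>t x\<bar> + \<bar>\<phi> k x - t x\<bar>) powr p" using p by (intro powr_mono2) auto
          also have "\<dots> \<le> A * \<bar>t x\<bar> powr p + B * \<bar>\<phi> k x - t x\<bar> powr p"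
            unfolding A_def B_def by (rule powr_add_le_weighted[OF e p1]) auto
          finally have "?c * \<bar>\<phi> k x\<bar> powr p \<le> ?c * (A * \<bar>t x\<bar> powr p + B * \<bar>\<phi> k x - t x\<bar> powr p)"
            using K(1)[OF True] by (rule mult_left_mono)
          also have "\<dots> = A * (?c * \<bar>t x\<bar> powr p) + ?c * (B * \<bar>\<phi> k x - t x\<bar> powr p)"
            by (simp add: algebra_simps)
          also have "?c * (B * \<bar>\<phi> k x - t x\<bar> powr p) \<le> K * (B * \<bar>\<phi> k x - t x\<bar> powr p)"
            using K(2)[OF True] AB by (intro mult_right_mono) auto
          finally have "?c * \<bar>\<phi> k x\<bar> powr p \<le> A * (?c * \<bar>t x\<bar> powr p) + (B * K) * \<bar>\<phi> k x - t x\<bar> powr p"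
            by (simp add: mult_ac)
          then have "ennreal (?c * \<bar>\<phi> k x\<bar> powr p) \<le> ennreal (A * (?c * \<bar>t x\<bar> powr p) + (B * K) * \<bar>\<phi> k x - t x\<bar> powr p)"
            by (rule ennreal_leI)
          also have "\<dots> = ennreal A * ennreal (?c * \<bar>t x\<bar> powr p) + ennreal (B * K) * ennreal (\<bar>\<phi> k x - t x\<bar> powr p)"
            using AB K0 K(1)[OF True] by (simp add: ennreal_mult)
          finally show ?thesis using True by (simp add: mult_ac)
        qed simp
      next
        have "(\<lambda>x. ennreal (\<bar>t x\<bar> powr p * (indicator (frontier \<Omega>) x *\<^sub>R (\<beta> x * F (outer_normal \<Omega> x))))) \<in> borel_measurable H"
          using weight by measurable
        also have "(\<lambda>x. ennreal (\<bar>t x\<bar> powr p * (indicator (frontier \<Omega>) x *\<^sub>R (\<beta> x * F (outer_normal \<Omega> x)))))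
          = (\<lambda>x. indicator (frontier \<Omega>) x * ennreal (\<beta> x * \<bar>t x\<bar> powr p * F (outer_normal \<Omega> x)))"
          by (auto simp: fun_eq_iff indicator_def mult_ac)
        finally show "(\<lambda>x. indicator (frontier \<Omega>) x * ennreal (\<beta> x * \<bar>t x\<bar> powr p * F (outer_normal \<Omega> x))) \<in> borel_measurable H" .
      qed measurable
      define c where "c = ennreal ((p - 1) * C)"
      define Err where "Err k = ennreal A * (ennreal (B * b powr p) * E2 k + c * (ennreal B * E1 k) + ennreal (B * K) * E3 k)
         + ennreal h * (ennreal B * E1 k)" for k
      have step: "ennreal h * V \<le> ennreal A * (ennreal A * (R + c * V + S)) + Err k" for k
      proof -
        have "ennreal h * V \<le> ennreal h * (ennreal A * Vk k + ennreal B * E1 k)"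
          by (rule mult_left_mono[OF V_le]) simp
        also have "\<dots> = ennreal A * (ennreal h * Vk k) + ennreal h * (ennreal B * E1 k)"
          by (simp add: distrib_left mult_ac)
        also have "ennreal h * Vk k \<le> weighted_cheeger F \<beta> \<Omega> * Vk k" by (rule mult_right_mono[OF h]) simp
        also have "\<dots> \<le> Rk k + c * Vk k + Sk k" unfolding c_def by (rule basic)
        also have "\<dots> \<le> (ennreal A * R + ennreal (B * b powr p) * E2 k) + c * (ennreal A * V + ennreal B * E1 k)
            + (ennreal A * S + ennreal (B * K) * E3 k)"
          by (intro add_mono mult_left_mono Rk_le Vk_le Sk_le) simp
        also have "\<dots> = ennreal A * (R + c * V + S) + (ennreal (B * b powr p) * E2 k + c * (ennreal B * E1 k) + ennreal (B * K) * E3 k)"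
          by (simp add: distrib_left ac_simps)
        finally show ?thesis
          by (simp add: Err_def distrib_left add.assoc add_right_mono mult_left_mono)
      qed
      have "Err \<longlonglongrightarrow> ennreal A * (ennreal (B * b powr p) * 0 + c * (ennreal B * 0) + ennreal (B * K) * 0) + ennreal h * (ennreal B * 0)"
        unfolding Err_def c_def E1_def E2_def E3_def
        by (intro tendsto_add ennreal_tendsto_cmult lim1 lim2 lim3) auto
      then have "(\<lambda>k. ennreal A * (ennreal A * (R + c * V + S)) + Err k) \<longlonglongrightarrow> ennreal A * (ennreal A * (R + c * V + S)) + 0"
        by (intro tendsto_add tendsto_const) simp
      then have "ennreal h * V \<le> ennreal A * (ennreal A * (R + c * V + S)) + 0"
        by (rule LIMSEQ_le_const) (use step in auto)
      then show ?thesis by (simp add: A_def c_def)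
    qed
    have key: "ennreal h * V \<le> R + ennreal ((p - 1) * C) * V + S" (is "_ \<le> ?X")
      if h: "ennreal h \<le> weighted_cheeger F \<beta> \<Omega>" for h
    proof (cases "?X = \<infinity>")
      case True
      then show ?thesis by (simp only: infinity_ennreal_def top_greatest)
    next
      case False
      \<comment> \<open>The choice e = 1/(n+2) stays strictly between 0 and 1 and lets both factors
        tend to 1.\<close>
      have "((\<lambda>n. ennreal ((1 - 1 / real (Suc (Suc n))) powr (1 - p))) \<longlongrightarrow> ennreal ((1 - 0) powr (1 - p))) sequentially"
      proof (intro tendsto_ennrealI tendsto_powr tendsto_diff tendsto_const)
        show "(\<lambda>n. 1 / real (Suc (Suc n))) \<longlonglongrightarrow> 0"
          using LIMSEQ_Suc[OF LIMSEQ_inverse_real_of_nat] by (simp add: inverse_eq_divide)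
      qed simp
      then have l: "(\<lambda>n. ennreal ((1 - 1 / real (Suc (Suc n))) powr (1 - p))) \<longlonglongrightarrow> 1" by simp
      have "(\<lambda>n. ennreal ((1 - 1 / real (Suc (Suc n))) powr (1 - p)) * (ennreal ((1 - 1 / real (Suc (Suc n))) powr (1 - p)) * ?X)) \<longlonglongrightarrow> 1 * (1 * ?X)"
        by (intro tendsto_mult_ennreal l tendsto_const) (use False in auto)
      then have "ennreal h * V \<le> 1 * (1 * ?X)"
        by (rule LIMSEQ_le_const) (use approx[OF h] in auto)
      then show ?thesis by simp
    qed
    \<comment> \<open>Every y below the Cheeger constant is finite and can serve as h; division by V
      is legitimate since V is neither 0 nor infinite.\<close>
    have "weighted_cheeger F \<beta> \<Omega> \<le> (R + S) / V + ennreal ((p - 1) * C)"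
    proof (rule dense_le)
      fix y assume y: "y < weighted_cheeger F \<beta> \<Omega>"
      then have yfin: "y < \<infinity>" using less_le_trans[OF y, of \<infinity>] by simp
      define h where "h = enn2real y"
      have yh: "y = ennreal h" using yfin by (simp add: h_def)
      have V0: "V \<noteq> 0" "V \<noteq> top" using nz Vfin by (auto simp: V_def)
      have "y * V \<le> R + ennreal ((p - 1) * C) * V + S" using key[of h] y yh by simp
      then have "y * V / V \<le> (R + ennreal ((p - 1) * C) * V + S) / V" by (rule divide_right_mono_ennreal)
      also have "y * V / V = y" using V0 by (simp add: ennreal_mult_divide_eq)
      also have "(R + ennreal ((p - 1) * C) * V + S) / V = (R + S) / V + ennreal ((p - 1) * C)"
        using ennreal_mult_divide_eq[OF V0, of "ennreal ((p - 1) * C)"]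
        by (simp only: add_divide_distrib_ennreal add.assoc add.commute[of "_ / V" "ennreal ((p - 1) * C)"])
      finally show "y \<le> (R + S) / V + ennreal ((p - 1) * C)" .
    qed
    then show ?thesis unfolding robin_quotient_def R_def S_def V_def H_def .
  qed
  \<comment> \<open>The additive constant is moved to the left by truncated subtraction, so that a
    fixed quantity is compared with the infimum, and moved back afterwards; this is valid because
    the constant is finite.\<close>
  then have "weighted_cheeger F \<beta> \<Omega> - ennreal ((p - 1) * C) \<le> robin_ev1 F p \<beta> \<Omega>"
    unfolding robin_ev1_def by (intro INF_greatest) (auto simp: ennreal_minus_le_iff add.commute)
  then show ?thesis unfolding C_def by (simp add: ennreal_minus_le_iff add.commute)
qed

end
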